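(* Let $R$ be a commutative ring with identity and let $(A,B)$ be an algebraic quasi-Cartan pair over $R$. Let $\Sigma$ be the groupoid of ultrafilters of $N(B)$, let $G=\Sigma/{\simeq}$ be its quotient by the relation $U\simeq W\iff U=tW$ for some $t\in R^\times$, and let $(\Sigma,i,q)$ be the associated discrete $R$-twist over $G$. Then the map $\varphi\colon a\mapsto\widehat a$ from $A$ to $C(\Sigma,R)$ is an isomorphism of ($R$-algebras) $A$ onto the twisted Steinberg algebra $A_R(G;\Sigma)$ that takes $B$ to $A_R(G^{(0)};q^{-1}(G^{(0)}))$, which is isomorphic to $A_R(\Sigma^{(0)})$, and hence also to $A_R(G^{(0)})$.
   Context: $R^\times$ denotes the group of units of $R$ (discrete topology). **Normalisers.** For an $R$-algebra $A$ and commutative subalgebra $B$, $I(B)$ is the set of idempotents of $B$; it is a set of local units for $A$ if for every finite $\{a_1,\dots,a_n\}\subseteq A$ there is $e\in I(B)$ with $ea_i=a_i=a_ie$ for all $i$. $N(B)=\{n\in A:\exists k\in A,\ knk=k,\ nkn=n,\ kBn\cup nBk\subseteq B\}$. For $n\in N(B)$, $k$ is unique, denoted $n^\dagger$; $N(B)$ is an inverse semigroup with idempotent set $I(B)$ and partial order $n\le m\iff n=nn^\dagger m$. **Algebraic quasi-Cartan pairs.** Condition (WT): if $e\in I(B)\setminus\{0\}$, $t\in R$ and $te=0$, then $t=0$. A conditional expectation $P\colon A\to B$ is an $R$-linear map with $P|_B=\mathrm{id}_B$ and $P(bab')=bP(a)b'$. It is faithful if for all $a\in A\setminus\{0\}$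 there is $n\in N(B)$ with $P(na)\neq0$, and implemented by idempotents if for each $n\in N(B)$ there is $e\in I(B)$ with $P(n)=ne=en$. $(A,B)$ is an algebraic quasi-Cartan pair if $B\subseteq A$ is commutative and satisfies (WT), $I(B)$ is a set of local units for $A$, $B=\operatorname{span}_R I(B)$, $A=\operatorname{span}_R N(B)$, and there is a faithful conditional expectation $P\colon A\to B$ implemented by idempotents (such $P$ is unique). **The groupoids $\Sigma$ and $G$.** For $U\subseteq N(B)$ let $U^\uparrow=\{m\in N(B):n\le m\text{ for some }n\in U\}$. A filter is $U\subseteq N(B)\setminus\{0\}$ with $U=U^\uparrow$ such that any two elements of $U$ have a common lower bound in $U$; an ultrafilter is a maximal (nonempty) filter. $\Sigma$ is the set of ultrafilters with $U^{-1}=\{n^\dagger:n\in U\}$; $(U,V)$ composable iff $mn\ne0$ for all $m\in U,n\in V$, and then $UV=\{mn:m\in U,n\in V\}^\uparrow$; $s(U)=U^{-1}U$, $r(U)=UU^{-1}$, $\Sigma^{(0)}=\{U:U\cap I(B)\neq\varnothing\}$. The sets $\mathcal V_n=\{U\in\Sigma:n\in U\}$ ($n\in N(B)$) form a basis of the topology. For $t\in R^\times$, $tU=\{tm:m\in U\}$. $q\colon\Sigma\to G=\Sigma/{\simeq}$ is the quotient map, $G$ has the quotient topology and structure $q(U)^{-1}=q(U^{-1})$, $q(U)q(W)=q(UW)$ for composable $(U,W)$; $q$ restricts to a homeomorphism $\Sigma^{(0)}\to G^{(0)}$. $i\colon G^{(0)}\times R^\times\to\Sigma$ is $i(q(U),t)=tU$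 for $U\in\Sigma^{(0)}$. Then $G$ is an ample Hausdorff groupoid and $(\Sigma,i,q)$ is a discrete $R$-twist over it, with action $t\cdot U=tU$ of $R^\times$ on $\Sigma$. **Twisted Steinberg algebra.** $C(\Sigma,R)$ is the $R$-module of locally constant functions $\Sigma\to R$; $\operatorname{supp}(f)=\{\sigma:f(\sigma)\ne0\}$, $\operatorname{supp}_G(f)=q(\operatorname{supp}(f))$. $A_R(G;\Sigma)$ is the set of $f\in C(\Sigma,R)$ with $f(t\cdot\sigma)=t^{-1}f(\sigma)$ for all $t\in R^\times$, $\sigma\in\Sigma$, and $q(\operatorname{supp}(f))$ compact. It is an $R$-algebra under pointwise operations and the product $(f*g)(\sigma)=\sum_{\alpha\in r^{-1}(r(\sigma))\cap\operatorname{supp}_G(f)}f(S(\alpha))g(S(\alpha)^{-1}\sigma)$, where $S\colon\operatorname{supp}_G(f)\to\operatorname{supp}(f)$ is any section for $q$. $A_R(G^{(0)};q^{-1}(G^{(0)}))$ is regarded as the subalgebra of those $f$ supported in $q^{-1}(G^{(0)})$. For a totally disconnected locally compact Hausdorff space $X$, $A_R(X)=C_c(X,R)$ is the algebra of locally constant compactly supported functions $X\to R$ with pointwise operations. **The map $a\mapsto\widehat a$.** There is an $R$-algebra isomorphism $\phi\colon B\to A_R(\Sigma^{(0)})$ with $\phi(e)=1_{\mathcal V_e}$ for all $e\in I(B)$. For $a\in A$, $\widehat a\colon\Sigma\to R$ is defined by $\widehat a(U)=\phi(P(n^\dagger a))(s(U))$ for any choice of $n\in U$ (this is independent of the choice and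 $\widehat a$ is locally constant), where $P$ is the faithful conditional expectation implemented by idempotents. *)

theory Defs
  imports "HOL-Analysis.Analysis"
begin

text \<open>
  Coefficients have sort \<open>{comm_ring, comm_monoid_mult}\<close>, that is, commutative rings with
  identity; unlike \<open>comm_ring_1\<close> this does not exclude the zero ring.
\<close>

definition ring_units :: "'r::{comm_ring, comm_monoid_mult} set" where
  "ring_units = {t. \<exists>s. t * s = 1}"

definition unit_inverse :: "'r::{comm_ring, comm_monoid_mult} \<Rightarrow> 'r" where
  "unit_inverse t = (THE s. t * s = 1)"

text \<open>Algebras need not be unital, so no identity element is recorded.\<close>

record ('r, 'x) alg =
  elems :: "'x set"
  add_of :: "'x \<Rightarrow> 'x \<Rightarrow> 'x"
  mult_of :: "'x \<Rightarrow> 'x \<Rightarrow> 'x"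
  scale_of :: "'r \<Rightarrow> 'x \<Rightarrow> 'x"

definition alg_iso :: "('r, 'x) alg \<Rightarrow> ('r, 'y) alg \<Rightarrow> ('x \<Rightarrow> 'y) \<Rightarrow> bool" where
  "alg_iso X Y h \<longleftrightarrow>
     bij_betw h (elems X) (elems Y) \<and>
     (\<forall>x\<in>elems X. \<forall>y\<in>elems X. h (add_of X x y) = add_of Y (h x) (h y)) \<and>
     (\<forall>x\<in>elems X. \<forall>y\<in>elems X. h (mult_of X x y) = mult_of Y (h x) (h y)) \<and>
     (\<forall>t. \<forall>x\<in>elems X. h (scale_of X t x) = scale_of Y t (h x))"

definition alg_isomorphic :: "('r, 'x) alg \<Rightarrow> ('r, 'y) alg \<Rightarrow> bool" where
  "alg_isomorphic X Y \<longleftrightarrow> (\<exists>h. alg_iso X Y h)"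

text \<open>
  A function on the underlying set of a topological space is represented by its extension
  by \<open>0\<close> to the whole type, so that equality of representatives is equality of functions.
\<close>

definition locally_constant_functions :: "'x topology \<Rightarrow> ('x \<Rightarrow> 'r::zero) set" where
  "locally_constant_functions X =
     {f. (\<forall>x\<in>topspace X. \<exists>W. openin X W \<and> x \<in> W \<and> (\<forall>y\<in>W. f y = f x)) \<and>
         (\<forall>x. x \<notin> topspace X \<longrightarrow> f x = 0)}"

definition steinberg_algebra ::
    "'x topology \<Rightarrow> ('r::{comm_ring, comm_monoid_mult}, 'x \<Rightarrow> 'r) alg" where
  "steinberg_algebra X =
     \<lparr>elems = {f \<in> locally_constant_functions X. compactin X {x \<in> topspace X. f x \<noteq> 0}},
      add_of = (\<lambda>f g x. f x + g x),
      mult_of = (\<lambda>f g x. f x * g x),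
      scale_of = (\<lambda>t f x. t * f x)\<rparr>"


locale R_algebra =
  fixes scale :: "'r::{comm_ring, comm_monoid_mult} \<Rightarrow> 'a::ring \<Rightarrow> 'a"
  assumes scale_add_right: "scale t (a + b) = scale t a + scale t b"
    and scale_add_left: "scale (s + t) a = scale s a + scale t a"
    and scale_scale: "scale s (scale t a) = scale (s * t) a"
    and scale_one: "scale 1 a = a"
    and scale_mult_left: "scale t (a * b) = scale t a * b"
    and scale_mult_right: "scale t (a * b) = a * scale t b"
begin

definition whole_algebra :: "('r, 'a) alg" where
  "whole_algebra = \<lparr>elems = UNIV, add_of = (+), mult_of = (*), scale_of = scale\<rparr>"

definition R_span :: "'a set \<Rightarrow> 'a set" where
  "R_span X = {\<Sum>x\<in>F. scale (c x) x | F c. finite F \<and> F \<subseteq> X}"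

end


locale commutative_subalgebra = R_algebra scale
  for scale :: "'r::{comm_ring, comm_monoid_mult} \<Rightarrow> 'a::ring \<Rightarrow> 'a" +
  fixes B :: "'a set"
  assumes zero_mem: "0 \<in> B"
    and add_mem: "\<lbrakk>a \<in> B; b \<in> B\<rbrakk> \<Longrightarrow> a + b \<in> B"
    and mult_mem: "\<lbrakk>a \<in> B; b \<in> B\<rbrakk> \<Longrightarrow> a * b \<in> B"
    and scale_mem: "a \<in> B \<Longrightarrow> scale t a \<in> B"
    and commute: "\<lbrakk>a \<in> B; b \<in> B\<rbrakk> \<Longrightarrow> a * b = b * a"
begin

definition subalgebra_B :: "('r, 'a) alg" where
  "subalgebra_B = whole_algebra\<lparr>elems := B\<rparr>"

definition idempotents :: "'a set" where
  "idempotents = {e \<in> B. e * e = e}"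

definition local_units :: bool where
  "local_units \<longleftrightarrow>
     (\<forall>F. finite F \<longrightarrow> (\<exists>e\<in>idempotents. \<forall>a\<in>F. e * a = a \<and> a * e = a))"

definition is_quasi_inverse :: "'a \<Rightarrow> 'a \<Rightarrow> bool" where
  "is_quasi_inverse n k \<longleftrightarrow>
     k * n * k = k \<and> n * k * n = n \<and> (\<forall>b\<in>B. k * b * n \<in> B \<and> n * b * k \<in> B)"

definition normalisers :: "'a set" where
  "normalisers = {n. \<exists>k. is_quasi_inverse n k}"

definition dagger :: "'a \<Rightarrow> 'a" where
  "dagger n = (THE k. is_quasi_inverse n k)"

definition normaliser_le :: "'a \<Rightarrow> 'a \<Rightarrow> bool" where
  "normaliser_le n m \<longleftrightarrow> n = n * dagger n * m"

definition without_torsion :: bool where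
  "without_torsion \<longleftrightarrow> (\<forall>e\<in>idempotents - {0}. \<forall>t. scale t e = 0 \<longrightarrow> t = 0)"

definition conditional_expectation :: "('a \<Rightarrow> 'a) \<Rightarrow> bool" where
  "conditional_expectation P \<longleftrightarrow>
     (\<forall>a. P a \<in> B) \<and>
     (\<forall>a a'. P (a + a') = P a + P a') \<and>
     (\<forall>t a. P (scale t a) = scale t (P a)) \<and>
     (\<forall>b\<in>B. P b = b) \<and>
     (\<forall>a. \<forall>b\<in>B. \<forall>b'\<in>B. P (b * a * b') = b * P a * b')"

definition faithful :: "('a \<Rightarrow> 'a) \<Rightarrow> bool" where
  "faithful P \<longleftrightarrow> (\<forall>a. a \<noteq> 0 \<longrightarrow> (\<exists>n\<in>normalisers. P (n * a) \<noteq> 0))"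

definition implemented_by_idempotents :: "('a \<Rightarrow> 'a) \<Rightarrow> bool" where
  "implemented_by_idempotents P \<longleftrightarrow>
     (\<forall>n\<in>normalisers. \<exists>e\<in>idempotents. P n = n * e \<and> n * e = e * n)"

end


locale algebraic_quasi_cartan_pair = commutative_subalgebra scale B
  for scale :: "'r::{comm_ring, comm_monoid_mult} \<Rightarrow> 'a::ring \<Rightarrow> 'a" and B :: "'a set" +
  assumes without_torsion: without_torsion
    and local_units: local_units
    and span_idempotents: "B = R_span idempotents"
    and span_normalisers: "UNIV = R_span normalisers"
    and expectation_exists:
      "\<exists>P. conditional_expectation P \<and> faithful P \<and> implemented_by_idempotents P"
begin

definition expectation :: "'a \<Rightarrow> 'a" where
  "expectation =
     (THE P. conditional_expectation P \<and> faithful P \<and> implemented_by_idempotents P)"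

definition up_closure :: "'a set \<Rightarrow> 'a set" where
  "up_closure U = {m \<in> normalisers. \<exists>n\<in>U. normaliser_le n m}"

definition is_filter :: "'a set \<Rightarrow> bool" where
  "is_filter U \<longleftrightarrow>
     U \<subseteq> normalisers - {0} \<and> U = up_closure U \<and>
     (\<forall>m\<in>U. \<forall>n\<in>U. \<exists>k\<in>U. normaliser_le k m \<and> normaliser_le k n)"

definition ultrafilters :: "'a set set" where
  "ultrafilters = {U. is_filter U \<and> U \<noteq> {} \<and> (\<forall>V. is_filter V \<and> U \<subseteq> V \<longrightarrow> V = U)}"

definition uf_inv :: "'a set \<Rightarrow> 'a set" where
  "uf_inv U = dagger ` U"

definition uf_composable :: "'a set \<Rightarrow> 'a set \<Rightarrow> bool" where
  "uf_composable U V \<longleftrightarrow> (\<forall>m\<in>U. \<forall>n\<in>V. m * n \<noteq> 0)"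

definition uf_mult :: "'a set \<Rightarrow> 'a set \<Rightarrow> 'a set" where
  "uf_mult U V = up_closure {m * n | m n. m \<in> U \<and> n \<in> V}"

definition uf_source :: "'a set \<Rightarrow> 'a set" where
  "uf_source U = uf_mult (uf_inv U) U"

definition uf_range :: "'a set \<Rightarrow> 'a set" where
  "uf_range U = uf_mult U (uf_inv U)"

definition uf_units :: "'a set set" where
  "uf_units = {U \<in> ultrafilters. U \<inter> idempotents \<noteq> {}}"

definition basic_open :: "'a \<Rightarrow> 'a set set" where
  "basic_open n = {U \<in> ultrafilters. n \<in> U}"

definition uf_topology :: "'a set topology" where
  "uf_topology = topology_generated_by (basic_open ` normalisers)"

text \<open>
  The action of the units on the twist. The inclusion \<open>i\<close> of the twist is its restriction
  to \<open>uf_units\<close>: \<open>i (q U, t) = act t U\<close> for \<open>U\<close> in \<open>uf_units\<close>.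
\<close>

definition act :: "'r \<Rightarrow> 'a set \<Rightarrow> 'a set" where
  "act t U = scale t ` U"

definition twist_rel :: "('a set \<times> 'a set) set" where
  "twist_rel =
     {(U, W). U \<in> ultrafilters \<and> W \<in> ultrafilters \<and> (\<exists>t\<in>ring_units. U = act t W)}"

definition q :: "'a set \<Rightarrow> 'a set set" where
  "q U = twist_rel `` {U}"

definition quotient_groupoid :: "'a set set set" where
  "quotient_groupoid = ultrafilters // twist_rel"

definition quotient_topology :: "'a set set topology" where
  "quotient_topology =
     topology (\<lambda>W. W \<subseteq> quotient_groupoid \<and> openin uf_topology {U \<in> ultrafilters. q U \<in> W})"

lemma openin_quotient_topology:
  "openin quotient_topology W \<longleftrightarrow>
     W \<subseteq> quotient_groupoid \<and> openin uf_topology {U \<in> ultrafilters. q U \<in> W}"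
proof -
  let ?L = "\<lambda>W. W \<subseteq> quotient_groupoid \<and> openin uf_topology {U \<in> ultrafilters. q U \<in> W}"
  have "istopology ?L"
    unfolding istopology_def
  proof (intro conjI allI impI)
    fix S T assume S: "?L S" and T: "?L T"
    from S show "S \<inter> T \<subseteq> quotient_groupoid" by blast
    have "{U \<in> ultrafilters. q U \<in> S \<inter> T} =
        {U \<in> ultrafilters. q U \<in> S} \<inter> {U \<in> ultrafilters. q U \<in> T}" by blast
    then show "openin uf_topology {U \<in> ultrafilters. q U \<in> S \<inter> T}"
      using S T by (simp only: openin_Int)
  next
    fix K assume K: "\<forall>S\<in>K. ?L S"
    then show "\<Union>K \<subseteq> quotient_groupoid" by blast
    have "{U \<in> ultrafilters. q U \<in> \<Union>K} = (\<Union>S\<in>K. {U \<in> ultrafilters. q U \<in> S})" by blast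
    then show "openin uf_topology {U \<in> ultrafilters. q U \<in> \<Union>K}"
      using K by (simp only:) (rule openin_Union, blast)
  qed
  then show ?thesis
    unfolding quotient_topology_def by (simp only: topology_inverse')
qed

lemma topspace_uf_topology: "topspace uf_topology = ultrafilters"
proof -
  have "\<exists>n\<in>normalisers. U \<in> basic_open n" if U: "U \<in> ultrafilters" for U
  proof -
    from U have "is_filter U" "U \<noteq> {}"
      unfolding ultrafilters_def by blast+
    then have "U \<subseteq> normalisers"
      unfolding is_filter_def by blast
    with U \<open>U \<noteq> {}\<close> show ?thesis
      unfolding basic_open_def by blast
  qed
  moreover have "basic_open n \<subseteq> ultrafilters" for n
    unfolding basic_open_def by blast
  ultimately show ?thesis
    unfolding uf_topology_def topology_generated_by_topspace by blast
qed

text \<open>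
  Operations on classes are unions over representatives, as in
  \<^theory>\<open>HOL.Equiv_Relations\<close>: all the classes united are the same one.
\<close>

definition G_inv :: "'a set set \<Rightarrow> 'a set set" where
  "G_inv \<alpha> = (\<Union>U\<in>\<alpha>. q (uf_inv U))"

definition G_mult :: "'a set set \<Rightarrow> 'a set set \<Rightarrow> 'a set set" where
  "G_mult \<alpha> \<beta> = (\<Union>U\<in>\<alpha>. \<Union>W\<in>{W \<in> \<beta>. uf_composable U W}. q (uf_mult U W))"

definition G_range :: "'a set set \<Rightarrow> 'a set set" where
  "G_range \<alpha> = G_mult \<alpha> (G_inv \<alpha>)"

definition G_units :: "'a set set set" where
  "G_units = G_range ` quotient_groupoid"

definition supp :: "('a set \<Rightarrow> 'r) \<Rightarrow> 'a set set" where
  "supp f = {\<sigma> \<in> ultrafilters. f \<sigma> \<noteq> 0}"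

definition supp_G :: "('a set \<Rightarrow> 'r) \<Rightarrow> 'a set set set" where
  "supp_G f = q ` supp f"

definition is_section :: "('a set \<Rightarrow> 'r) \<Rightarrow> ('a set set \<Rightarrow> 'a set) \<Rightarrow> bool" where
  "is_section f S \<longleftrightarrow> (\<forall>\<alpha>\<in>supp_G f. S \<alpha> \<in> supp f \<and> q (S \<alpha>) = \<alpha>)"

text \<open>
  The value does not depend on the section. The range map of the quotient takes values
  in its own unit space, which \<open>q\<close> identifies with \<open>uf_units\<close>.
\<close>

definition convolution ::
    "('a set \<Rightarrow> 'r) \<Rightarrow> ('a set \<Rightarrow> 'r) \<Rightarrow> 'a set \<Rightarrow> 'r" where
  "convolution f g \<sigma> =
     (if \<sigma> \<in> ultrafilters
      then THE z. \<forall>S. is_section f S \<longrightarrow>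
        z = (\<Sum>\<alpha> \<in> {\<alpha> \<in> quotient_groupoid. G_range \<alpha> = q (uf_range \<sigma>)} \<inter> supp_G f.
               f (S \<alpha>) * g (uf_mult (uf_inv (S \<alpha>)) \<sigma>))
      else 0)"

definition twisted_steinberg_algebra :: "('r, 'a set \<Rightarrow> 'r) alg" where
  "twisted_steinberg_algebra =
     \<lparr>elems = {f \<in> locally_constant_functions uf_topology.
        (\<forall>t\<in>ring_units. \<forall>\<sigma>\<in>ultrafilters. f (act t \<sigma>) = unit_inverse t * f \<sigma>) \<and>
        compactin quotient_topology (supp_G f)},
      add_of = (\<lambda>f g \<sigma>. f \<sigma> + g \<sigma>),
      mult_of = convolution,
      scale_of = (\<lambda>t f \<sigma>. t * f \<sigma>)\<rparr>"

text \<open>The subalgebra of the functions supported over the unit space.\<close>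

definition unit_twisted_steinberg_algebra :: "('r, 'a set \<Rightarrow> 'r) alg" where
  "unit_twisted_steinberg_algebra =
     twisted_steinberg_algebra\<lparr>elems :=
       {f \<in> elems twisted_steinberg_algebra. \<forall>\<sigma>\<in>supp f. q \<sigma> \<in> G_units}\<rparr>"

text \<open>
  The isomorphism is determined on \<open>B\<close> because the idempotents span \<open>B\<close>; it is extended
  by \<open>0\<close> to make the total function unique.
\<close>

definition phi :: "'a \<Rightarrow> 'a set \<Rightarrow> 'r" where
  "phi = (THE \<phi>.
     alg_iso subalgebra_B (steinberg_algebra (subtopology uf_topology uf_units)) \<phi> \<and>
     (\<forall>e\<in>idempotents. \<phi> e = (\<lambda>U. if U \<in> basic_open e then 1 else 0)) \<and>
     (\<forall>a. a \<notin> B \<longrightarrow> \<phi> a = (\<lambda>U. 0)))"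

text \<open>The value does not depend on the choice of \<open>n\<close>.\<close>

definition hat :: "'a \<Rightarrow> 'a set \<Rightarrow> 'r" where
  "hat a U =
     (if U \<in> ultrafilters
      then THE z. \<forall>n\<in>U. z = phi (expectation (dagger n * a)) (uf_source U)
      else 0)"

end

end

theory Submission
  imports Defs
begin

text \<open>
  Why the theorem holds. Normalisers form an inverse semigroup whose order is restriction by
  idempotents of \<open>B\<close>. Maximality makes ultrafilters prime: for an idempotent \<open>e\<close>, an ultrafilter
  either is closed under restriction to \<open>e\<close> or contains an element killed by \<open>e\<close>
  (\<open>range_idem_dichotomy\<close>). From this come the groupoid structure on ultrafilters and the compactness
  of the sets \<open>basic_open n\<close> (\<open>basic_open_compactness\<close>).

  At a unit ultrafilter \<open>V\<close> every \<open>b\<close> in \<open>B\<close> is locally a scalar: some \<open>e\<close> in \<open>V\<close> satisfies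
  \<open>e * b = scale t e\<close>, and the absence of torsion makes \<open>t\<close> unique. Sending \<open>b\<close> to these scalars
  is the Stone-type isomorphism \<^const>\<open>algebraic_quasi_cartan_pair.phi\<close> of \<open>B\<close> with the locally
  constant functions of compact support on the unit space. In the same way \<open>hat a U = t\<close> holds
  exactly if \<open>expectation (dagger m * a) = scale t (dagger m * m)\<close> for some \<open>m\<close> in \<open>U\<close>
  (\<open>hat_eqI\<close>, \<open>hat_obtain\<close>). As such an equation passes to smaller \<open>m\<close>, linearity, local constancy
  and equivariance of \<open>hat a\<close> are immediate.

  For a normaliser \<open>n\<close> the nonzero values of \<open>hat n\<close> are units \<open>t\<close>, taken where \<open>n\<close> lies in
  \<open>act t U\<close> (\<open>scalar_normaliser_unit\<close>, \<open>hat_normaliser_nonzero\<close>). Hence \<open>hat n\<close> is supported over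
  the compact open set \<open>q ` basic_open n\<close>, on which the range map is injective. Since normalisers
  span, every \<open>hat a\<close> has compact support. Faithfulness of the expectation makes the map injective.
  Conversely, a function in the twisted Steinberg algebra is cut along finitely many of these
  clopen supports, and over one of them it is \<open>hat (n * b)\<close> for a \<open>b\<close> interpolating its values
  (\<open>hat_surjective_basic\<close>).

  For multiplicativity, linearity in the first factor leaves the case of a normaliser \<open>n\<close>. The
  convolution sum at \<open>\<sigma>\<close> then has at most one term, belonging to the ultrafilter \<open>U\<close> with \<open>n\<close> in
  \<open>U\<close> and the range of \<open>\<sigma>\<close>, and \<open>hat (n * b) \<sigma>\<close> is the value of \<open>hat b\<close> at \<open>U\<^sup>-\<^sup>1 \<sigma>\<close>
  (\<open>convolution_normaliser\<close>). Finally, \<open>a\<close> and \<open>expectation a\<close> have the same values at units, so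
  injectivity puts every \<open>a\<close> with \<open>hat a\<close> supported over the units into \<open>B\<close>
  (\<open>hat_image_subalgebra\<close>); the unit spaces are compared by means of the open map \<open>q\<close>.
\<close>

section \<open>Normalisers as an inverse semigroup\<close>

context R_algebra
begin

lemma scale_zero_left: "scale 0 a = 0"
  using scale_add_left[of 0 0 a] by simp

lemma scale_zero_right: "scale t 0 = 0"
  using scale_add_right[of t 0 0] by simp

lemma scale_minus_left: "scale (- t) a = - scale t a"
  using scale_add_left[of "- t" t a] by (simp add: scale_zero_left eq_neg_iff_add_eq_0)

lemma scale_diff_left: "scale (s - t) a = scale s a - scale t a"
  using scale_add_left[of s "- t" a] by (simp add: scale_minus_left)

lemma mult_scale_right: "a * scale t b = scale t (a * b)"
  by (simp add: scale_mult_right)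

lemma mult_scale_left: "scale t a * b = scale t (a * b)"
  by (simp add: scale_mult_left)

text \<open>
  Linear statements are reduced to the spanning set by induction over the terms of a finite sum.
\<close>

lemma R_span_induct [consumes 1, case_names zero add]:
  assumes "a \<in> R_span X" "Q 0" "\<And>a t x. Q a \<Longrightarrow> x \<in> X \<Longrightarrow> Q (a + scale t x)"
  shows "Q a"
proof -
  obtain F c where F: "finite F" "F \<subseteq> X" "a = (\<Sum>x\<in>F. scale (c x) x)"
    using assms(1) unfolding R_span_def by blast
  have "Q (\<Sum>x\<in>F. scale (c x) x)"
    using F(1,2)
  proof (induction F rule: finite_induct)
    case (insert x F)
    then show ?case using assms(3)[of "\<Sum>x\<in>F. scale (c x) x" x "c x"] by (simp add: add.commute)
  qed (simp add: assms(2))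
  with F(3) show ?thesis by simp
qed

end

lemma ring_unit_obtain:
  fixes t :: "'r::{comm_ring, comm_monoid_mult}"
  assumes "t \<in> ring_units"
  obtains s where "s \<in> ring_units" "t * s = 1" "s * t = 1" "unit_inverse t = s"
proof -
  obtain s where s: "t * s = 1" using assms unfolding ring_units_def by blast
  have "u = s" if "t * u = 1" for u
    by (metis s that mult.commute mult.left_commute mult_1)
  then have "unit_inverse t = s" unfolding unit_inverse_def using s by blast
  moreover have "s \<in> ring_units" "s * t = 1" using s by (auto simp: ring_units_def mult.commute)
  ultimately show ?thesis using that s by blast
qed

lemma ring_units_one: "(1::'r::{comm_ring, comm_monoid_mult}) \<in> ring_units"
  unfolding ring_units_def by (auto intro: exI[of _ 1])

lemma ring_units_mult:
  fixes s t :: "'r::{comm_ring, comm_monoid_mult}"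
  assumes "s \<in> ring_units" "t \<in> ring_units"
  shows "s * t \<in> ring_units"
proof -
  obtain s' t' where "s * s' = 1" "t * t' = 1" using assms unfolding ring_units_def by blast
  then have "(s * t) * (t' * s') = 1" by (metis mult.assoc mult.commute mult_1)
  then show ?thesis unfolding ring_units_def by blast
qed

context algebraic_quasi_cartan_pair
begin

lemma local_unit_obtain:
  obtains u where "u \<in> idempotents" "u * a = a" "a * u = a" "u * b = b" "b * u = b"
  using local_units unfolding local_units_def
  by (metis finite.emptyI finite.insertI insert_iff)

lemma minus_mem: "b \<in> B \<Longrightarrow> - b \<in> B"
  using scale_mem[of b "- 1"] by (simp add: scale_minus_left scale_one)

lemma diff_mem: "a \<in> B \<Longrightarrow> b \<in> B \<Longrightarrow> a - b \<in> B"
  using add_mem[of a "- b"] minus_mem by simp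

lemma idem_mem: "e \<in> idempotents \<Longrightarrow> e \<in> B"
  and idem_idem: "e \<in> idempotents \<Longrightarrow> e * e = e"
  and idem_idem_left: "e \<in> idempotents \<Longrightarrow> e * (e * x) = e * x"
  unfolding idempotents_def by (auto simp flip: mult.assoc)

lemma idem_commute: "e \<in> idempotents \<Longrightarrow> b \<in> B \<Longrightarrow> e * b = b * e"
  using commute idem_mem by blast

lemma idem_left_commute: "e \<in> idempotents \<Longrightarrow> b \<in> B \<Longrightarrow> e * (b * x) = b * (e * x)"
  by (metis idem_commute mult.assoc)

lemma idem_zero: "0 \<in> idempotents"
  unfolding idempotents_def by (simp add: zero_mem)

lemma idem_mult: "e \<in> idempotents \<Longrightarrow> f \<in> idempotents \<Longrightarrow> e * f \<in> idempotents"
  unfolding idempotents_def by (auto simp: mult_mem) (metis commute mult.assoc)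

lemma idem_diff:
  assumes "e \<in> idempotents" "f \<in> idempotents"
  shows "e - e * f \<in> idempotents"
proof -
  have "(e - e * f) * (e - e * f) = e - e * f"
    using assms by (simp add: algebra_simps idem_idem idem_idem_left)
      (metis assms idem_commute idem_idem idem_idem_left idem_mem mult.assoc diff_self diff_zero)
  then show ?thesis using assms unfolding idempotents_def by (auto intro: diff_mem mult_mem)
qed

lemma idem_join:
  assumes "e \<in> idempotents" "f \<in> idempotents"
  shows "e + f - e * f \<in> idempotents"
proof -
  have c: "f * e = e * f" "f * (e * x) = e * (f * x)" for x
    using assms idem_commute idem_mem idem_left_commute by auto
  have "(e + f - e * f) * (e + f - e * f) = e + f - e * f"
    using assms by (simp add: algebra_simps c idem_idem idem_idem_left)
  then show ?thesis using assms unfolding idempotents_def by (auto intro: diff_mem mult_mem add_mem)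
qed

lemma quasi_inverse_idem:
  assumes "is_quasi_inverse n k"
  shows "k * n \<in> idempotents" "n * k \<in> idempotents"
proof -
  obtain u where u: "u \<in> idempotents" "u * n = n" "u * k = k"
    using local_unit_obtain by metis
  have "k * u * n \<in> B" "n * u * k \<in> B"
    using assms u(1) idem_mem unfolding is_quasi_inverse_def by blast+
  then have "k * n \<in> B" "n * k \<in> B" using u by (simp_all add: mult.assoc)
  then show "k * n \<in> idempotents" "n * k \<in> idempotents"
    using assms unfolding is_quasi_inverse_def idempotents_def by (simp_all flip: mult.assoc)
qed

text \<open>Quasi-inverses are unique because the idempotents attached to two of them commute.\<close>

lemma dagger_eq:
  assumes "is_quasi_inverse n k"
  shows "dagger n = k"
proof -
  have "l = k" if l: "is_quasi_inverse n l" for l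
  proof -
    note i = quasi_inverse_idem[OF assms] quasi_inverse_idem[OF l]
    have k: "k * n * k = k" "n * k * n = n" and l': "l * n * l = l" "n * l * n = n"
      using assms l unfolding is_quasi_inverse_def by auto
    have "k = (k * n) * (l * n) * k" using k l' by (metis mult.assoc)
    also have "\<dots> = (l * n) * (k * n) * k" using i idem_commute idem_mem by metis
    also have "\<dots> = l * n * k" using k by (metis mult.assoc)
    finally have 1: "k = l * n * k" .
    have "l = l * ((n * k) * (n * l))" using k l' by (metis mult.assoc)
    also have "\<dots> = l * ((n * l) * (n * k))" using i idem_commute idem_mem by metis
    also have "\<dots> = l * n * k" using l' by (metis mult.assoc)
    finally show ?thesis using 1 by simp
  qed
  then show ?thesis unfolding dagger_def using assms by blast
qed

lemma normaliser_intro: "is_quasi_inverse n k \<Longrightarrow> n \<in> normalisers"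
  unfolding normalisers_def by blast

lemma dagger_quasi_inverse: "n \<in> normalisers \<Longrightarrow> is_quasi_inverse n (dagger n)"
  using dagger_eq unfolding normalisers_def by blast

lemma quasi_inverse_sym: "is_quasi_inverse n k \<Longrightarrow> is_quasi_inverse k n"
  unfolding is_quasi_inverse_def by blast

lemma dagger_normaliser: "n \<in> normalisers \<Longrightarrow> dagger n \<in> normalisers"
  using dagger_quasi_inverse normaliser_intro quasi_inverse_sym by blast

lemma dagger_dagger: "n \<in> normalisers \<Longrightarrow> dagger (dagger n) = n"
  using dagger_quasi_inverse dagger_eq quasi_inverse_sym by blast

lemma
  assumes "n \<in> normalisers"
  shows mult_dagger_mult: "n * (dagger n * n) = n"
    and mult_dagger_mult_left: "n * (dagger n * (n * x)) = n * x"
    and dagger_mult_dagger: "dagger n * (n * dagger n) = dagger n"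
    and dagger_mult_dagger_left: "dagger n * (n * (dagger n * x)) = dagger n * x"
    and source_idem: "dagger n * n \<in> idempotents"
    and range_idem: "n * dagger n \<in> idempotents"
    and conj_mem: "b \<in> B \<Longrightarrow> n * (b * dagger n) \<in> B"
    and conj_dagger_mem: "b \<in> B \<Longrightarrow> dagger n * (b * n) \<in> B"
  using dagger_quasi_inverse[OF assms] quasi_inverse_idem[OF dagger_quasi_inverse[OF assms]]
  unfolding is_quasi_inverse_def by (auto simp: mult.assoc) (metis mult.assoc)+

lemma conj_idem:
  assumes n: "n \<in> normalisers" and e: "e \<in> idempotents"
  shows "n * (e * dagger n) \<in> idempotents"
proof -
  have "n * (e * dagger n) * (n * (e * dagger n)) = n * (e * ((dagger n * n) * (e * dagger n)))"
    by (simp add: mult.assoc)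
  also have "\<dots> = n * ((dagger n * n) * (e * (e * dagger n)))"
    using idem_left_commute[OF e idem_mem[OF source_idem[OF n]]] by simp
  also have "\<dots> = n * (e * dagger n)"
    using n e by (simp add: mult.assoc mult_dagger_mult_left idem_idem_left)
  finally show ?thesis using conj_mem[OF n idem_mem[OF e]] unfolding idempotents_def by simp
qed

lemma conj_dagger_idem:
  assumes n: "n \<in> normalisers" and e: "e \<in> idempotents"
  shows "dagger n * (e * n) \<in> idempotents"
  using conj_idem[OF dagger_normaliser[OF n] e] dagger_dagger[OF n] by simp

text \<open>
  The idempotent commutes with \<open>dagger n * n\<close> because both lie in \<open>B\<close>; therefore restrictions of a
  normaliser on the left and on the right are the same thing.
\<close>

lemma mult_idem_swap:
  assumes n: "n \<in> normalisers" and e: "e \<in> idempotents"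
  shows "n * e = (n * (e * dagger n)) * n"
proof -
  have "(n * (e * dagger n)) * n = n * (e * (dagger n * n))" by (simp add: mult.assoc)
  also have "\<dots> = n * ((dagger n * n) * e)" using idem_commute[OF e idem_mem[OF source_idem[OF n]]] by simp
  also have "\<dots> = n * e" using n by (simp add: mult.assoc mult_dagger_mult_left)
  finally show ?thesis by simp
qed

lemma idem_mult_swap:
  assumes n: "n \<in> normalisers" and e: "e \<in> idempotents"
  shows "e * n = n * (dagger n * (e * n))"
proof -
  have "n * (dagger n * (e * n)) = ((n * dagger n) * e) * n" by (simp add: mult.assoc)
  also have "\<dots> = e * n"
    using idem_commute[OF e idem_mem[OF range_idem[OF n]]] n
    by (metis mult.assoc mult_dagger_mult)
  finally show ?thesis by simp
qed

lemma quasi_inverse_mult: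
  assumes m: "m \<in> normalisers" and n: "n \<in> normalisers"
  shows "is_quasi_inverse (m * n) (dagger n * dagger m)"
proof -
  have c: "(n * dagger n) * (dagger m * m) = (dagger m * m) * (n * dagger n)"
    using idem_commute[OF range_idem[OF n] idem_mem[OF source_idem[OF m]]] .
  have "(m * n) * (dagger n * dagger m) * (m * n) = m * (((n * dagger n) * (dagger m * m)) * n)"
    by (simp add: mult.assoc)
  also have "\<dots> = m * (((dagger m * m) * (n * dagger n)) * n)" using c by simp
  also have "\<dots> = m * n" using m n by (simp add: mult.assoc mult_dagger_mult_left mult_dagger_mult)
  finally have 1: "(m * n) * (dagger n * dagger m) * (m * n) = m * n" .
  have "(dagger n * dagger m) * (m * n) * (dagger n * dagger m)
      = dagger n * (((dagger m * m) * (n * dagger n)) * dagger m)"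
    by (simp add: mult.assoc)
  also have "\<dots> = dagger n * (((n * dagger n) * (dagger m * m)) * dagger m)" using c by simp
  also have "\<dots> = dagger n * dagger m"
    using m n by (simp add: mult.assoc dagger_mult_dagger_left dagger_mult_dagger)
  finally have 2: "(dagger n * dagger m) * (m * n) * (dagger n * dagger m) = dagger n * dagger m" .
  have "(dagger n * dagger m) * b * (m * n) \<in> B" "(m * n) * b * (dagger n * dagger m) \<in> B"
    if b: "b \<in> B" for b
    using conj_dagger_mem[OF n conj_dagger_mem[OF m b]] conj_mem[OF m conj_mem[OF n b]]
    by (simp_all add: mult.assoc)
  with 1 2 show ?thesis unfolding is_quasi_inverse_def by blast
qed

lemma normaliser_mult: "m \<in> normalisers \<Longrightarrow> n \<in> normalisers \<Longrightarrow> m * n \<in> normalisers"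
  using quasi_inverse_mult normaliser_intro by blast

lemma dagger_mult: "m \<in> normalisers \<Longrightarrow> n \<in> normalisers \<Longrightarrow> dagger (m * n) = dagger n * dagger m"
  using quasi_inverse_mult dagger_eq by blast

lemma quasi_inverse_of_idem: "e \<in> idempotents \<Longrightarrow> is_quasi_inverse e e"
  unfolding is_quasi_inverse_def by (auto simp: idem_idem idem_mem mult_mem)

lemma idem_normaliser: "e \<in> idempotents \<Longrightarrow> e \<in> normalisers"
  using quasi_inverse_of_idem normaliser_intro by blast

lemma dagger_idem: "e \<in> idempotents \<Longrightarrow> dagger e = e"
  using quasi_inverse_of_idem dagger_eq by blast

lemma dagger_zero: "dagger 0 = 0"
  using dagger_idem idem_zero by blast

lemma quasi_inverse_scale:
  assumes n: "n \<in> normalisers" and t: "t * s = 1"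
  shows "is_quasi_inverse (scale t n) (scale s (dagger n))"
proof -
  have st: "s * t = 1" using t by (simp add: mult.commute)
  have "scale t n * scale s (dagger n) * scale t n = scale t n"
    "scale s (dagger n) * scale t n * scale s (dagger n) = scale s (dagger n)"
    using n t st
    by (simp_all add: mult_scale_left mult_scale_right scale_scale mult.assoc mult_dagger_mult
        dagger_mult_dagger)
  moreover have "scale t n * b * scale s (dagger n) \<in> B" "scale s (dagger n) * b * scale t n \<in> B"
    if "b \<in> B" for b
    using conj_mem[OF n that] conj_dagger_mem[OF n that] t st
    by (simp_all add: mult_scale_left mult_scale_right scale_scale mult.assoc scale_one)
  ultimately show ?thesis unfolding is_quasi_inverse_def by blast
qed

lemma normaliser_scale: "n \<in> normalisers \<Longrightarrow> t \<in> ring_units \<Longrightarrow> scale t n \<in> normalisers"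
  using quasi_inverse_scale normaliser_intro unfolding ring_units_def by blast

lemma dagger_scale: "n \<in> normalisers \<Longrightarrow> t * s = 1 \<Longrightarrow> dagger (scale t n) = scale s (dagger n)"
  using quasi_inverse_scale dagger_eq by blast

text \<open>
  The order is used through its two symmetric descriptions, by restriction to an idempotent
  on the left and on the right.
\<close>

lemma le_idem_left:
  assumes n: "n \<in> normalisers" and e: "e \<in> idempotents"
  shows "normaliser_le (e * n) n"
proof -
  have "(e * n) * dagger (e * n) * n = e * ((n * dagger n) * (e * n))"
    using dagger_mult[OF idem_normaliser[OF e] n] dagger_idem[OF e] by (simp add: mult.assoc)
  also have "\<dots> = e * (e * ((n * dagger n) * n))"
    using idem_left_commute[OF e idem_mem[OF range_idem[OF n]]] by simp
  also have "\<dots> = e * n" using n e by (simp add: mult.assoc mult_dagger_mult idem_idem_left)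
  finally show ?thesis unfolding normaliser_le_def by simp
qed

lemma le_idem_right:
  assumes n: "n \<in> normalisers" and e: "e \<in> idempotents"
  shows "normaliser_le (n * e) n"
  using le_idem_left[OF n conj_idem[OF n e]] mult_idem_swap[OF n e] by simp

lemma le_obtain_left:
  assumes "normaliser_le n m" "n \<in> normalisers"
  obtains e where "e \<in> idempotents" "n = e * m"
  using assms range_idem[OF assms(2)] unfolding normaliser_le_def by blast

lemma le_obtain_right:
  assumes "normaliser_le n m" "n \<in> normalisers" "m \<in> normalisers"
  obtains e where "e \<in> idempotents" "n = m * e"
  using le_obtain_left[OF assms(1,2)] idem_mult_swap[OF assms(3)] conj_dagger_idem[OF assms(3)]
  by metis

lemma le_refl: "n \<in> normalisers \<Longrightarrow> normaliser_le n n"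
  unfolding normaliser_le_def by (simp add: mult.assoc mult_dagger_mult)

lemma le_trans:
  assumes "normaliser_le k m" "normaliser_le m n"
    and "k \<in> normalisers" "m \<in> normalisers" "n \<in> normalisers"
  shows "normaliser_le k n"
proof -
  obtain e f where "e \<in> idempotents" "k = e * m" "f \<in> idempotents" "m = f * n"
    using assms le_obtain_left by metis
  then have "k = (e * f) * n" "e * f \<in> idempotents" by (simp_all add: mult.assoc idem_mult)
  then show ?thesis using le_idem_left assms(5) by simp
qed

lemma le_mult:
  assumes "normaliser_le k m" "normaliser_le l n"
    and "k \<in> normalisers" "m \<in> normalisers" "l \<in> normalisers" "n \<in> normalisers"
  shows "normaliser_le (k * l) (m * n)"
proof -
  obtain e f where ef: "e \<in> idempotents" "k = e * m" "f \<in> idempotents" "l = n * f"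
    using assms le_obtain_left le_obtain_right by metis
  have "k * l = e * ((m * n) * f)" using ef by (simp add: mult.assoc)
  moreover have "normaliser_le (e * ((m * n) * f)) (m * n)"
    by (rule le_trans[OF le_idem_left le_idem_right])
      (use ef assms in \<open>blast intro: normaliser_mult idem_normaliser\<close>)+
  ultimately show ?thesis by simp
qed

lemma le_dagger:
  assumes "normaliser_le n m" "n \<in> normalisers" "m \<in> normalisers"
  shows "normaliser_le (dagger n) (dagger m)"
proof -
  obtain e where e: "e \<in> idempotents" "n = e * m" using le_obtain_left assms by metis
  then have "dagger n = dagger m * e"
    using dagger_mult[OF idem_normaliser[OF e(1)] assms(3)] dagger_idem by simp
  then show ?thesis using le_idem_right dagger_normaliser assms(3) e by simp
qed

lemma le_scale:
  assumes "normaliser_le n m" "n \<in> normalisers" "m \<in> normalisers" "t \<in> ring_units"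
  shows "normaliser_le (scale t n) (scale t m)"
proof -
  obtain e where e: "e \<in> idempotents" "n = e * m" using le_obtain_left assms by metis
  then have "scale t n = e * scale t m" by (simp add: mult_scale_right)
  then show ?thesis using le_idem_left e normaliser_scale assms by simp
qed

lemma le_zero: "normaliser_le n 0 \<Longrightarrow> n = 0"
  unfolding normaliser_le_def by simp

lemma source_le:
  assumes "normaliser_le k m" "normaliser_le k n"
    and "k \<in> normalisers" "m \<in> normalisers" "n \<in> normalisers"
  shows "normaliser_le (dagger k * k) (dagger m * n)"
  using assms by (intro le_mult le_dagger dagger_normaliser)

lemma range_le:
  assumes "normaliser_le k m" "normaliser_le k n"
    and "k \<in> normalisers" "m \<in> normalisers" "n \<in> normalisers"
  shows "normaliser_le (k * dagger k) (m * dagger n)"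
  using assms by (intro le_mult le_dagger dagger_normaliser)

lemma le_idem_iff:
  assumes "e \<in> idempotents" "f \<in> idempotents"
  shows "normaliser_le e f \<longleftrightarrow> e = e * f"
  using assms unfolding normaliser_le_def by (simp add: dagger_idem idem_idem)

lemma le_idem_is_idem:
  assumes "normaliser_le n f" "n \<in> normalisers" "f \<in> idempotents"
  shows "n \<in> idempotents"
  using le_obtain_left[OF assms(1,2)] idem_mult assms(3) by metis

lemma dagger_mult_nonzero:
  assumes "n \<in> normalisers" "n \<noteq> 0"
  shows "dagger n * n \<noteq> 0" "n * dagger n \<noteq> 0" "dagger n \<noteq> 0"
  using assms mult_dagger_mult[of n] mult.assoc[of n "dagger n" n] by auto

end

section \<open>Filters, ultrafilters and their products\<close>

context algebraic_quasi_cartan_pair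
begin

lemma filter_normaliser: "is_filter U \<Longrightarrow> n \<in> U \<Longrightarrow> n \<in> normalisers"
  and filter_nonzero: "is_filter U \<Longrightarrow> n \<in> U \<Longrightarrow> n \<noteq> 0"
  unfolding is_filter_def by blast+

lemma filter_up: "is_filter U \<Longrightarrow> n \<in> U \<Longrightarrow> normaliser_le n m \<Longrightarrow> m \<in> normalisers \<Longrightarrow> m \<in> U"
  unfolding is_filter_def up_closure_def by blast

lemma filter_lower_obtain:
  assumes "is_filter U" "m \<in> U" "n \<in> U"
  obtains k where "k \<in> U" "normaliser_le k m" "normaliser_le k n"
  using assms unfolding is_filter_def by blast

lemma subset_up_closure: "D \<subseteq> normalisers \<Longrightarrow> D \<subseteq> up_closure D"
  unfolding up_closure_def using le_refl by blast

lemma is_filterI: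
  assumes "U \<subseteq> normalisers - {0}" "up_closure U \<subseteq> U"
    and "\<And>m n. m \<in> U \<Longrightarrow> n \<in> U \<Longrightarrow> \<exists>k\<in>U. normaliser_le k m \<and> normaliser_le k n"
  shows "is_filter U"
proof -
  have "U = up_closure U" using subset_up_closure[of U] assms(1,2) by auto
  then show ?thesis unfolding is_filter_def using assms(1,3) by simp
qed

lemma up_closure_filter:
  assumes "D \<subseteq> normalisers" "0 \<notin> D"
    and dir: "\<And>m n. m \<in> D \<Longrightarrow> n \<in> D \<Longrightarrow> \<exists>k\<in>D. normaliser_le k m \<and> normaliser_le k n"
  shows "is_filter (up_closure D)"
proof -
  have D: "d \<in> normalisers" if "d \<in> D" for d using that assms(1) by blast
  have "up_closure D \<subseteq> normalisers - {0}"
    unfolding up_closure_def using assms(2) le_zero by auto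
  moreover have "up_closure (up_closure D) \<subseteq> up_closure D"
    unfolding up_closure_def using D by (auto intro: le_trans)
  moreover have "\<exists>k\<in>up_closure D. normaliser_le k m \<and> normaliser_le k n"
    if mn: "m \<in> up_closure D" "n \<in> up_closure D" for m n
  proof -
    obtain c d where c: "c \<in> D" "normaliser_le c m" "m \<in> normalisers"
      and d: "d \<in> D" "normaliser_le d n" "n \<in> normalisers"
      using mn unfolding up_closure_def by blast
    obtain k where k: "k \<in> D" "normaliser_le k c" "normaliser_le k d" using dir c d by blast
    then have "normaliser_le k m" "normaliser_le k n"
      using le_trans[OF k(2) c(2)] le_trans[OF k(3) d(2)] c d D by simp_all
    then show ?thesis using k(1) subset_up_closure[OF assms(1)] by blast
  qed
  ultimately show ?thesis by (rule is_filterI)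
qed

lemma principal_filter:
  assumes "n \<in> normalisers" "n \<noteq> 0"
  shows "is_filter (up_closure {n})"
  by (rule up_closure_filter) (use assms le_refl in auto)

lemma ultrafilter_filter: "U \<in> ultrafilters \<Longrightarrow> is_filter U"
  and ultrafilter_nonempty: "U \<in> ultrafilters \<Longrightarrow> U \<noteq> {}"
  and ultrafilter_maximal: "U \<in> ultrafilters \<Longrightarrow> is_filter V \<Longrightarrow> U \<subseteq> V \<Longrightarrow> V = U"
  unfolding ultrafilters_def by auto

lemma ultrafilter_normaliser: "U \<in> ultrafilters \<Longrightarrow> n \<in> U \<Longrightarrow> n \<in> normalisers"
  and ultrafilter_nonzero: "U \<in> ultrafilters \<Longrightarrow> n \<in> U \<Longrightarrow> n \<noteq> 0"
  using ultrafilter_filter filter_normaliser filter_nonzero by blast+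

lemma ultrafilter_extension:
  assumes F: "is_filter F" "F \<noteq> {}"
  obtains U where "U \<in> ultrafilters" "F \<subseteq> U"
proof -
  let ?A = "{V. is_filter V \<and> F \<subseteq> V}"
  have "\<exists>M\<in>?A. \<forall>X\<in>?A. M \<subseteq> X \<longrightarrow> X = M"
  proof (rule subset_Zorn_nonempty)
    show "?A \<noteq> {}" using F by blast
    fix C assume C: "C \<noteq> {}" "subset.chain ?A C"
    have filt: "is_filter V" if "V \<in> C" for V using C(2) that unfolding subset.chain_def by blast
    have "\<Union>C \<subseteq> normalisers - {0}" using filt unfolding is_filter_def by blast
    moreover have "up_closure (\<Union>C) \<subseteq> \<Union>C"
      unfolding up_closure_def using filt filter_up by blast
    moreover have "\<exists>k\<in>\<Union>C. normaliser_le k m \<and> normaliser_le k n"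
      if mn: "m \<in> \<Union>C" "n \<in> \<Union>C" for m n
    proof -
      obtain V where V: "V \<in> C" "m \<in> V" "n \<in> V"
        using mn C(2) unfolding subset.chain_def by blast
      then show ?thesis using filter_lower_obtain[OF filt[OF V(1)]] by blast
    qed
    ultimately have "is_filter (\<Union>C)" by (rule is_filterI)
    moreover have "F \<subseteq> \<Union>C" using C unfolding subset.chain_def by blast
    ultimately show "\<Union>C \<in> ?A" by blast
  qed
  then obtain M where M: "is_filter M" "F \<subseteq> M" "\<forall>X\<in>?A. M \<subseteq> X \<longrightarrow> X = M"
    by auto
  have "V = M" if V: "is_filter V" "M \<subseteq> V" for V
    using M(2) V by (intro M(3)[rule_format]) auto
  then have "M \<in> ultrafilters" using M(1,2) F(2) unfolding ultrafilters_def by auto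
  with M(2) that show thesis by blast
qed

lemma ultrafilter_of_normaliser:
  assumes "n \<in> normalisers" "n \<noteq> 0"
  obtains U where "U \<in> ultrafilters" "n \<in> U"
proof -
  have "n \<in> up_closure {n}" using subset_up_closure[of "{n}"] assms by blast
  then show thesis using ultrafilter_extension[OF principal_filter[OF assms]] that by blast
qed

lemma ultrafilter_eqI:
  assumes "U \<in> ultrafilters" "V \<in> ultrafilters" "U \<subseteq> V"
  shows "U = V"
  using assms ultrafilter_maximal ultrafilter_filter by blast

subsection \<open>Inverses\<close>

lemma uf_inv_mem: "n \<in> U \<Longrightarrow> dagger n \<in> uf_inv U"
  unfolding uf_inv_def by blast

lemma uf_inv_uf_inv:
  assumes "U \<subseteq> normalisers"
  shows "uf_inv (uf_inv U) = U"
proof -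
  have "(\<lambda>x. dagger (dagger x)) ` U = (\<lambda>x. x) ` U"
    using assms dagger_dagger by (intro image_cong) auto
  then show ?thesis unfolding uf_inv_def by (simp add: image_image)
qed

lemma uf_inv_filter:
  assumes U: "is_filter U"
  shows "is_filter (uf_inv U)"
proof -
  note N = filter_normaliser[OF U]
  have "uf_inv U \<subseteq> normalisers - {0}"
    unfolding uf_inv_def using N filter_nonzero[OF U] by (auto simp: dagger_normaliser dagger_mult_nonzero(3))
  moreover have "up_closure (uf_inv U) \<subseteq> uf_inv U"
  proof
    fix x assume "x \<in> up_closure (uf_inv U)"
    then obtain n where n: "n \<in> U" "normaliser_le (dagger n) x" "x \<in> normalisers"
      unfolding up_closure_def uf_inv_def by blast
    then have "normaliser_le n (dagger x)"
      using le_dagger[OF n(2)] dagger_dagger N dagger_normaliser by simp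
    then have "dagger x \<in> U" using filter_up[OF U n(1)] dagger_normaliser n(3) by simp
    then show "x \<in> uf_inv U" using uf_inv_mem dagger_dagger n(3) by metis
  qed
  moreover have "\<exists>k\<in>uf_inv U. normaliser_le k m \<and> normaliser_le k n"
    if mn: "m \<in> uf_inv U" "n \<in> uf_inv U" for m n
  proof -
    obtain a b where ab: "a \<in> U" "b \<in> U" "m = dagger a" "n = dagger b"
      using mn unfolding uf_inv_def by blast
    obtain k where "k \<in> U" "normaliser_le k a" "normaliser_le k b"
      using filter_lower_obtain[OF U ab(1,2)] .
    then show ?thesis using ab le_dagger N uf_inv_mem by blast
  qed
  ultimately show ?thesis by (rule is_filterI)
qed

lemma uf_inv_ultrafilter:
  assumes U: "U \<in> ultrafilters"
  shows "uf_inv U \<in> ultrafilters"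
proof -
  have "V = uf_inv U" if V: "is_filter V" "uf_inv U \<subseteq> V" for V
  proof -
    have s: "U \<subseteq> normalisers" "V \<subseteq> normalisers"
      using ultrafilter_normaliser[OF U] filter_normaliser[OF V(1)] by blast+
    have "uf_inv (uf_inv U) \<subseteq> uf_inv V" using V(2) unfolding uf_inv_def by blast
    then have "uf_inv V = U"
      using ultrafilter_maximal[OF U uf_inv_filter[OF V(1)]] uf_inv_uf_inv[OF s(1)] by simp
    then show ?thesis using uf_inv_uf_inv[OF s(2)] by simp
  qed
  moreover have "uf_inv U \<noteq> {}" using ultrafilter_nonempty[OF U] unfolding uf_inv_def by blast
  ultimately show ?thesis
    using uf_inv_filter[OF ultrafilter_filter[OF U]] unfolding ultrafilters_def by blast
qed

subsection \<open>Products\<close>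

lemma uf_mult_obtain:
  assumes "x \<in> uf_mult U V"
  obtains m n where "m \<in> U" "n \<in> V" "normaliser_le (m * n) x" "x \<in> normalisers"
  using assms unfolding uf_mult_def up_closure_def by blast

lemma uf_mult_memI:
  assumes "m \<in> U" "n \<in> V" "normaliser_le (m * n) x" "x \<in> normalisers"
  shows "x \<in> uf_mult U V"
  using assms unfolding uf_mult_def up_closure_def by blast

lemma uf_mult_mem:
  assumes "is_filter U" "is_filter V" "m \<in> U" "n \<in> V"
  shows "m * n \<in> uf_mult U V"
  using assms by (intro uf_mult_memI[of m _ n] le_refl normaliser_mult filter_normaliser)

lemma uf_mult_filter:
  assumes U: "is_filter U" and V: "is_filter V" and c: "uf_composable U V"
  shows "is_filter (uf_mult U V)"
  unfolding uf_mult_def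
proof (rule up_closure_filter)
  note N = filter_normaliser[OF U] filter_normaliser[OF V]
  show "{m * n |m n. m \<in> U \<and> n \<in> V} \<subseteq> normalisers" using N normaliser_mult by blast
  show "0 \<notin> {m * n |m n. m \<in> U \<and> n \<in> V}" using c unfolding uf_composable_def by fastforce
  fix x y assume "x \<in> {m * n |m n. m \<in> U \<and> n \<in> V}" "y \<in> {m * n |m n. m \<in> U \<and> n \<in> V}"
  then obtain a b a' b' where *: "x = a * b" "y = a' * b'" "a \<in> U" "b \<in> V" "a' \<in> U" "b' \<in> V"
    by blast
  obtain k where k: "k \<in> U" "normaliser_le k a" "normaliser_le k a'"
    using filter_lower_obtain[OF U] * by metis
  obtain l where l: "l \<in> V" "normaliser_le l b" "normaliser_le l b'"
    using filter_lower_obtain[OF V] * by metis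
  have "normaliser_le (k * l) x \<and> normaliser_le (k * l) y"
    using * k l N by (auto intro!: le_mult)
  then show "\<exists>k\<in>{m * n |m n. m \<in> U \<and> n \<in> V}. normaliser_le k x \<and> normaliser_le k y"
    using k l by blast
qed

text \<open>
  If a filter \<open>W\<close> contains the product, then dividing \<open>W\<close> by the left factor gives a filter that
  contains \<open>V\<close>, hence equals \<open>V\<close>; multiplying back shows that \<open>W\<close> was not larger than the product.
\<close>

lemma uf_mult_ultrafilter:
  assumes U: "is_filter U" "U \<noteq> {}" and V: "V \<in> ultrafilters" and c: "uf_composable U V"
  shows "uf_mult U V \<in> ultrafilters"
proof -
  note FV = ultrafilter_filter[OF V]
  note N = filter_normaliser[OF U(1)] filter_normaliser[OF FV]
  have UV: "is_filter (uf_mult U V)" using uf_mult_filter[OF U(1) FV c] .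
  have max: "W \<subseteq> uf_mult U V" if W: "is_filter W" "uf_mult U V \<subseteq> W" for W
  proof
    note NW = filter_normaliser[OF W(1)]
    have comp: "uf_composable (uf_inv U) W"
      unfolding uf_composable_def
    proof (intro ballI)
      fix m' w assume mw: "m' \<in> uf_inv U" "w \<in> W"
      then obtain m where m: "m \<in> U" "m' = dagger m" unfolding uf_inv_def by blast
      obtain n where n: "n \<in> V" using ultrafilter_nonempty[OF V] by blast
      have "m * n \<in> W" using uf_mult_mem[OF U(1) FV m(1) n] W(2) by blast
      then obtain x where x: "x \<in> W" "normaliser_le x (m * n)" "normaliser_le x w"
        using filter_lower_obtain[OF W(1) _ mw(2)] by blast
      obtain f where "f \<in> idempotents" "x = m * n * f"
        using le_obtain_right[OF x(2)] NW[OF x(1)] normaliser_mult N m n by metis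
      then have "m * (m' * x) = x" using m N by (simp add: mult.assoc mult_dagger_mult_left)
      then have "m' * x \<noteq> 0" using filter_nonzero[OF W(1) x(1)] by fastforce
      moreover have "normaliser_le (m' * x) (m' * w)"
        using x m mw NW N by (intro le_mult le_refl) (auto simp: dagger_normaliser)
      ultimately show "m' * w \<noteq> 0" using le_zero by fastforce
    qed
    have F: "is_filter (uf_mult (uf_inv U) W)"
      using uf_mult_filter[OF uf_inv_filter[OF U(1)] W(1) comp] .
    have "V \<subseteq> uf_mult (uf_inv U) W"
    proof
      fix n assume n: "n \<in> V"
      obtain m where m: "m \<in> U" using U(2) by blast
      have "m * n \<in> W" using uf_mult_mem[OF U(1) FV m n] W(2) by blast
      moreover have "normaliser_le (dagger m * (m * n)) n"
        using le_idem_left[OF N(2)[OF n] source_idem[OF N(1)[OF m]]] by (simp add: mult.assoc)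
      ultimately show "n \<in> uf_mult (uf_inv U) W"
        using uf_mult_memI uf_inv_mem[OF m] N(2)[OF n] by blast
    qed
    then have eq: "uf_mult (uf_inv U) W = V" using ultrafilter_maximal[OF V F] by blast
    fix w assume w: "w \<in> W"
    obtain m where m: "m \<in> U" using U(2) by blast
    have "dagger m * w \<in> V"
      using uf_mult_mem[OF uf_inv_filter[OF U(1)] W(1) uf_inv_mem[OF m] w] eq by simp
    moreover have "normaliser_le (m * (dagger m * w)) w"
      using le_idem_left[OF NW[OF w] range_idem[OF N(1)[OF m]]] by (simp add: mult.assoc)
    ultimately show "w \<in> uf_mult U V" using uf_mult_memI m NW[OF w] by blast
  qed
  obtain m n where "m \<in> U" "n \<in> V" using U(2) ultrafilter_nonempty[OF V] by blast
  then have "uf_mult U V \<noteq> {}" using uf_mult_mem[OF U(1) FV] by blast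
  then show ?thesis using UV max unfolding ultrafilters_def by blast
qed

subsection \<open>Range and source\<close>

lemma uf_range_iff:
  assumes U: "is_filter U"
  shows "x \<in> uf_range U \<longleftrightarrow> x \<in> normalisers \<and> (\<exists>k\<in>U. normaliser_le (k * dagger k) x)"
proof
  note N = filter_normaliser[OF U]
  assume "x \<in> uf_range U"
  then obtain m n where mn: "m \<in> U" "n \<in> U" "normaliser_le (m * dagger n) x" "x \<in> normalisers"
    unfolding uf_range_def uf_inv_def by (elim uf_mult_obtain) auto
  then obtain k where k: "k \<in> U" "normaliser_le k m" "normaliser_le k n"
    using filter_lower_obtain[OF U] by metis
  then have "normaliser_le (k * dagger k) (m * dagger n)" using range_le N mn by blast
  then have "normaliser_le (k * dagger k) x"
    by (rule le_trans[OF _ mn(3)]) (use k mn N normaliser_mult dagger_normaliser in auto)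
  then show "x \<in> normalisers \<and> (\<exists>k\<in>U. normaliser_le (k * dagger k) x)" using k mn by blast
next
  assume "x \<in> normalisers \<and> (\<exists>k\<in>U. normaliser_le (k * dagger k) x)"
  then show "x \<in> uf_range U"
    unfolding uf_range_def using uf_mult_memI uf_inv_mem by blast
qed

lemma uf_range_mem: "is_filter U \<Longrightarrow> n \<in> U \<Longrightarrow> n * dagger n \<in> uf_range U"
  unfolding uf_range_def using uf_mult_mem uf_inv_filter uf_inv_mem by blast

lemma uf_source_eq: "U \<subseteq> normalisers \<Longrightarrow> uf_source U = uf_range (uf_inv U)"
  unfolding uf_source_def uf_range_def by (simp add: uf_inv_uf_inv)

lemma uf_inv_composable:
  assumes U: "U \<in> ultrafilters"
  shows "uf_composable U (uf_inv U)"
  unfolding uf_composable_def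
proof (intro ballI)
  note F = ultrafilter_filter[OF U] and N = ultrafilter_normaliser[OF U]
  fix m n' assume mn: "m \<in> U" "n' \<in> uf_inv U"
  then obtain n where n: "n \<in> U" "n' = dagger n" unfolding uf_inv_def by blast
  then obtain k where k: "k \<in> U" "normaliser_le k m" "normaliser_le k n"
    using filter_lower_obtain[OF F] mn by metis
  then have "normaliser_le (k * dagger k) (m * dagger n)" using range_le N mn n by blast
  moreover have "k * dagger k \<noteq> 0" using dagger_mult_nonzero N ultrafilter_nonzero[OF U] k by blast
  ultimately show "m * n' \<noteq> 0" using le_zero n by fastforce
qed

lemma uf_range_unit:
  assumes U: "U \<in> ultrafilters"
  shows "uf_range U \<in> uf_units"
proof -
  note F = ultrafilter_filter[OF U]
  note N = ultrafilter_normaliser[OF U]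
  have "uf_range U \<in> ultrafilters"
    unfolding uf_range_def
    using uf_mult_ultrafilter[OF F ultrafilter_nonempty[OF U] uf_inv_ultrafilter[OF U] uf_inv_composable[OF U]] .
  moreover obtain n where "n \<in> U" using ultrafilter_nonempty[OF U] by blast
  ultimately show ?thesis
    using uf_range_mem[OF F] range_idem[OF N] unfolding uf_units_def by blast
qed

lemma uf_units_ultrafilter: "V \<in> uf_units \<Longrightarrow> V \<in> ultrafilters"
  unfolding uf_units_def by blast

lemma uf_range_ultrafilter: "U \<in> ultrafilters \<Longrightarrow> uf_range U \<in> ultrafilters"
  using uf_range_unit uf_units_ultrafilter by blast

lemma ultrafilter_mem_units: "U \<in> ultrafilters \<Longrightarrow> e \<in> U \<Longrightarrow> e \<in> idempotents \<Longrightarrow> U \<in> uf_units"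
  unfolding uf_units_def by blast

lemma unit_lower_obtain:
  assumes V: "V \<in> uf_units" and n: "n \<in> V"
  obtains e where "e \<in> V" "e \<in> idempotents" "normaliser_le e n"
proof -
  obtain f where f: "f \<in> V" "f \<in> idempotents" using V unfolding uf_units_def by blast
  note F = ultrafilter_filter[OF uf_units_ultrafilter[OF V]]
  obtain k where k: "k \<in> V" "normaliser_le k f" "normaliser_le k n"
    using filter_lower_obtain[OF F f(1) n] .
  then show thesis using that le_idem_is_idem[OF k(2) filter_normaliser[OF F k(1)] f(2)] by blast
qed

lemma uf_inv_of_unit:
  assumes V: "V \<in> uf_units"
  shows "uf_inv V = V"
proof (rule ultrafilter_eqI)
  note VU = uf_units_ultrafilter[OF V]
  show "V \<in> ultrafilters" "uf_inv V \<in> ultrafilters" using VU uf_inv_ultrafilter by blast+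
  show "uf_inv V \<subseteq> V"
  proof
    fix x assume "x \<in> uf_inv V"
    then obtain n where n: "n \<in> V" "x = dagger n" unfolding uf_inv_def by blast
    obtain e where e: "e \<in> V" "e \<in> idempotents" "normaliser_le e n"
      using unit_lower_obtain[OF V n(1)] .
    have "normaliser_le e x"
      using le_dagger[OF e(3) idem_normaliser[OF e(2)] ultrafilter_normaliser[OF VU n(1)]]
        dagger_idem[OF e(2)] n(2) by simp
    then show "x \<in> V"
      using filter_up[OF ultrafilter_filter[OF VU] e(1)] dagger_normaliser n
        ultrafilter_normaliser[OF VU] by blast
  qed
qed

lemma uf_range_of_unit:
  assumes V: "V \<in> uf_units"
  shows "uf_range V = V"
proof (rule ultrafilter_eqI)
  note VU = uf_units_ultrafilter[OF V]
  note F = ultrafilter_filter[OF VU]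
  show "V \<in> ultrafilters" "uf_range V \<in> ultrafilters" using VU uf_range_ultrafilter by blast+
  show "uf_range V \<subseteq> V"
  proof
    fix x assume "x \<in> uf_range V"
    then obtain k where x: "x \<in> normalisers" and k: "k \<in> V" "normaliser_le (k * dagger k) x"
      using uf_range_iff[OF F] by blast
    note kN = filter_normaliser[OF F k(1)]
    obtain e where e: "e \<in> V" "e \<in> idempotents" "normaliser_le e k"
      using unit_lower_obtain[OF V k(1)] .
    have "normaliser_le (e * dagger e) (k * dagger k)"
      using range_le[OF e(3) e(3)] idem_normaliser[OF e(2)] kN by blast
    then have "normaliser_le e (k * dagger k)" using e(2) by (simp add: dagger_idem idem_idem)
    then show "x \<in> V" using filter_up[OF F] k(2) e(1) x normaliser_mult dagger_normaliser kN by blast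
  qed
qed

lemma uf_source_unit: "U \<in> ultrafilters \<Longrightarrow> uf_source U \<in> uf_units"
  using uf_source_eq uf_range_unit uf_inv_ultrafilter ultrafilter_normaliser by (metis subsetI)

lemma uf_source_of_unit: "V \<in> uf_units \<Longrightarrow> uf_source V = V"
  using uf_source_eq uf_inv_of_unit uf_range_of_unit uf_units_ultrafilter ultrafilter_normaliser
  by (metis subsetI)

text \<open>
  If \<open>e\<close> lies above \<open>m * dagger m\<close> for some \<open>m\<close> in \<open>U\<close>, then \<open>e\<close> fixes every lower bound of \<open>m\<close>
  and \<open>n\<close>, so that such a bound lies below \<open>e * n\<close>.
\<close>

lemma range_idem_mult_mem:
  assumes U: "U \<in> ultrafilters" and e: "e \<in> idempotents" "e \<in> uf_range U" and n: "n \<in> U"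
  shows "e * n \<in> U"
proof -
  note F = ultrafilter_filter[OF U]
  note N = ultrafilter_normaliser[OF U]
  obtain m where m: "m \<in> U" "normaliser_le (m * dagger m) e" using uf_range_iff[OF F] e by blast
  obtain k where k: "k \<in> U" "normaliser_le k m" "normaliser_le k n"
    using filter_lower_obtain[OF F m(1) n] .
  obtain f where f: "f \<in> idempotents" "k = m * f"
    using le_obtain_right[OF k(2)] k m N by metis
  have "e * (m * dagger m) = m * dagger m"
    using m(2) le_idem_iff range_idem[OF N[OF m(1)]] e(1) idem_commute idem_mem by metis
  then have "e * m = m" using mult_dagger_mult[OF N[OF m(1)]] by (metis mult.assoc)
  then have "e * k = k" using f by (metis mult.assoc)
  moreover have "normaliser_le (e * k) (e * n)"
    using k n N e idem_normaliser by (intro le_mult le_refl) auto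
  ultimately show ?thesis
    using filter_up[OF F k(1)] normaliser_mult idem_normaliser e N n by simp
qed

lemma range_idem_memI:
  assumes U: "U \<in> ultrafilters" and e: "e \<in> idempotents" and n: "n \<in> normalisers" "e * n \<in> U"
  shows "e \<in> uf_range U"
proof -
  have "dagger (e * n) = dagger n * e" using dagger_mult idem_normaliser e dagger_idem n by simp
  then have "(e * n) * dagger (e * n) = e * ((n * dagger n) * e)" by (simp add: mult.assoc)
  moreover have "normaliser_le (e * ((n * dagger n) * e)) e"
    using le_idem_right[OF idem_normaliser[OF e], of "(n * dagger n) * e"] range_idem[OF n(1)] idem_mult e
    by simp
  ultimately show ?thesis
    using uf_range_iff[OF ultrafilter_filter[OF U]] n(2) idem_normaliser[OF e] by metis
qed

text \<open>
  This is the primeness of ultrafilters. If no \<open>e * n\<close> vanishes, the products of the principal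
  filter of \<open>e\<close> with \<open>U\<close> generate a filter that contains \<open>U\<close>, and by maximality it is \<open>U\<close>.
\<close>

lemma range_idem_dichotomy:
  assumes U: "U \<in> ultrafilters" and e: "e \<in> idempotents"
  shows "e \<in> uf_range U \<or> (\<exists>n\<in>U. e * n = 0)"
proof (rule disjCI)
  note F = ultrafilter_filter[OF U]
  note N = ultrafilter_normaliser[OF U]
  assume no: "\<not> (\<exists>n\<in>U. e * n = 0)"
  then have "e \<noteq> 0" using ultrafilter_nonempty[OF U] by auto
  then have E: "is_filter (up_closure {e})" using principal_filter idem_normaliser e by blast
  have ee: "e \<in> up_closure {e}" using subset_up_closure[of "{e}"] idem_normaliser e by blast
  have "uf_composable (up_closure {e}) U"
    unfolding uf_composable_def
  proof (intro ballI)
    fix x n assume x: "x \<in> up_closure {e}" and n: "n \<in> U"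
    then have "normaliser_le (e * n) (x * n)"
      using e N idem_normaliser unfolding up_closure_def by (auto intro!: le_mult le_refl)
    then show "x * n \<noteq> 0" using no n le_zero by fastforce
  qed
  then have "is_filter (uf_mult (up_closure {e}) U)" using uf_mult_filter[OF E F] by blast
  moreover have "U \<subseteq> uf_mult (up_closure {e}) U"
    using uf_mult_memI[OF ee] le_idem_left e N by blast
  ultimately have eq: "uf_mult (up_closure {e}) U = U" using ultrafilter_maximal[OF U] by blast
  obtain n where n: "n \<in> U" using ultrafilter_nonempty[OF U] by blast
  have "e * n \<in> U" using uf_mult_mem[OF E F ee n] eq by simp
  then show "e \<in> uf_range U" using range_idem_memI[OF U e] N n by blast
qed

lemma source_idem_mult_mem:
  assumes U: "U \<in> ultrafilters" and e: "e \<in> idempotents" "e \<in> uf_source U" and n: "n \<in> U"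
  shows "n * e \<in> U"
proof -
  note N = ultrafilter_normaliser[OF U]
  have s: "U \<subseteq> normalisers" using N by blast
  have "e * dagger n \<in> uf_inv U"
    using range_idem_mult_mem[OF uf_inv_ultrafilter[OF U] e(1) _ uf_inv_mem[OF n]] e(2)
      uf_source_eq[OF s] by simp
  then have "dagger (e * dagger n) \<in> uf_inv (uf_inv U)" using uf_inv_mem by blast
  moreover have "dagger (e * dagger n) = n * e"
    using dagger_mult[OF idem_normaliser[OF e(1)] dagger_normaliser[OF N[OF n]]]
      dagger_dagger[OF N[OF n]] dagger_idem[OF e(1)] by simp
  ultimately show ?thesis using uf_inv_uf_inv[OF s] by simp
qed

lemma source_idem_dichotomy:
  assumes U: "U \<in> ultrafilters" and e: "e \<in> idempotents"
  shows "e \<in> uf_source U \<or> (\<exists>n\<in>U. n * e = 0)"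
proof -
  note N = ultrafilter_normaliser[OF U]
  have s: "U \<subseteq> normalisers" using N by blast
  have "\<exists>n\<in>U. n * e = 0" if z: "n \<in> uf_inv U" "e * n = 0" for n
  proof -
    obtain m where m: "m \<in> U" "n = dagger m" using z(1) unfolding uf_inv_def by blast
    then have "m * e = dagger (e * n)"
      using dagger_mult[OF idem_normaliser[OF e] dagger_normaliser[OF N[OF m(1)]]]
        dagger_dagger[OF N[OF m(1)]] dagger_idem[OF e] by simp
    then show ?thesis using z(2) dagger_zero m(1) by force
  qed
  then show ?thesis
    using range_idem_dichotomy[OF uf_inv_ultrafilter[OF U] e] uf_source_eq[OF s] by auto
qed

lemma uf_source_mem: "U \<in> ultrafilters \<Longrightarrow> n \<in> U \<Longrightarrow> dagger n * n \<in> uf_source U"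
  unfolding uf_source_def using uf_mult_mem uf_inv_filter uf_inv_mem ultrafilter_filter by blast

lemma unit_idem_dichotomy:
  assumes V: "V \<in> uf_units" and e: "e \<in> idempotents" and "e \<notin> V"
  obtains f where "f \<in> V" "f \<in> idempotents" "f * e = 0"
proof -
  note VU = uf_units_ultrafilter[OF V]
  obtain n where n: "n \<in> V" "n * e = 0"
    using source_idem_dichotomy[OF VU e] uf_source_of_unit[OF V] assms(3) by auto
  obtain f where f: "f \<in> V" "f \<in> idempotents" "normaliser_le f n"
    using unit_lower_obtain[OF V n(1)] .
  obtain g where "g \<in> idempotents" "f = g * n"
    using le_obtain_left[OF f(3) idem_normaliser[OF f(2)]] .
  then have "f * e = 0" using n(2) by (simp add: mult.assoc)
  with f that show thesis by blast
qed

lemma unit_idem_mult_mem: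
  assumes V: "V \<in> uf_units" and "e \<in> V" "e \<in> idempotents" "n \<in> V"
  shows "e * n \<in> V"
  using range_idem_mult_mem[OF uf_units_ultrafilter[OF V]] uf_range_of_unit[OF V] assms by simp

lemma uf_range_eqI:
  assumes U: "U \<in> ultrafilters" and V: "V \<in> uf_units"
    and sub: "\<And>k. k \<in> U \<Longrightarrow> k * dagger k \<in> V"
  shows "uf_range U = V"
proof (rule ultrafilter_eqI)
  show "uf_range U \<in> ultrafilters" "V \<in> ultrafilters"
    using U V uf_range_ultrafilter uf_units_ultrafilter by blast+
  show "uf_range U \<subseteq> V"
    using uf_range_iff[OF ultrafilter_filter[OF U]] sub
      filter_up[OF ultrafilter_filter[OF uf_units_ultrafilter[OF V]]] by blast
qed

text \<open>
  An element \<open>l\<close> below \<open>n\<close> equals \<open>l * dagger l * n\<close>, hence is determined by its range; so the range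
  map is injective on each basic open set.
\<close>

lemma ultrafilter_eq_of_range:
  assumes U: "U \<in> ultrafilters" and W: "W \<in> ultrafilters"
    and n: "n \<in> U" "n \<in> W" and r: "uf_range U = uf_range W"
  shows "U = W"
proof (rule sym, rule ultrafilter_eqI[OF W U], rule subsetI)
  fix x assume x: "x \<in> W"
  note NW = ultrafilter_normaliser[OF W]
  obtain l where l: "l \<in> W" "normaliser_le l x" "normaliser_le l n"
    using filter_lower_obtain[OF ultrafilter_filter[OF W] x n(2)] .
  have "l * dagger l \<in> uf_range U" using uf_range_mem[OF ultrafilter_filter[OF W] l(1)] r by simp
  then have "l * dagger l * n \<in> U"
    using range_idem_mult_mem[OF U range_idem[OF NW[OF l(1)]] _ n(1)] by blast
  then have "l \<in> U" using l(3) unfolding normaliser_le_def by simp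
  then show "x \<in> U" using filter_up[OF ultrafilter_filter[OF U]] l(2) NW x by blast
qed

text \<open>
  The ultrafilter is the translate \<open>V n\<close>. It is obtained as the inverse of the product of the
  principal filter of \<open>dagger n\<close> with \<open>V\<close>, so that the ultrafilter is the right-hand factor as in
  \<open>uf_mult_ultrafilter\<close>.
\<close>

lemma ultrafilter_with_range:
  assumes V: "V \<in> uf_units" and n: "n \<in> normalisers" "n * dagger n \<in> V"
  obtains U where "U \<in> ultrafilters" "n \<in> U" "uf_range U = V"
proof -
  note VU = uf_units_ultrafilter[OF V]
  note F = ultrafilter_filter[OF VU]
  let ?f = "n * dagger n" and ?D = "up_closure {dagger n}"
  have dn: "dagger n \<in> normalisers" "dagger n \<noteq> 0"
    using n dagger_normaliser filter_nonzero[OF F] by force+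
  then have D: "is_filter ?D" "dagger n \<in> ?D" "?D \<noteq> {}"
    using principal_filter subset_up_closure[of "{dagger n}"] by blast+
  have "uf_composable ?D V"
    unfolding uf_composable_def
  proof (intro ballI)
    fix x v assume x: "x \<in> ?D" and v: "v \<in> V"
    have "?f * v \<in> V" using unit_idem_mult_mem[OF V n(2) range_idem[OF n(1)] v] .
    then have "dagger n * v \<noteq> 0" using filter_nonzero[OF F] by (fastforce simp: mult.assoc)
    moreover have "normaliser_le (dagger n * v) (x * v)"
      using x v dn filter_normaliser[OF F] unfolding up_closure_def by (auto intro!: le_mult le_refl)
    ultimately show "x * v \<noteq> 0" using le_zero by fastforce
  qed
  then have W: "uf_mult ?D V \<in> ultrafilters" using uf_mult_ultrafilter[OF D(1,3) VU] by blast
  let ?U = "uf_inv (uf_mult ?D V)"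
  have U: "?U \<in> ultrafilters" using uf_inv_ultrafilter[OF W] .
  have "dagger n * (n * dagger n) \<in> uf_mult ?D V" using uf_mult_mem[OF D(1) F D(2) n(2)] .
  then have "dagger n \<in> uf_mult ?D V" using dagger_mult_dagger n by simp
  then have nU: "n \<in> ?U" using uf_inv_mem dagger_dagger n(1) by metis
  have "uf_range ?U = V"
  proof (rule uf_range_eqI[OF U V])
    fix k assume k: "k \<in> ?U"
    then obtain w where w: "w \<in> uf_mult ?D V" "k = dagger w" unfolding uf_inv_def by blast
    note wN = ultrafilter_normaliser[OF W w(1)]
    obtain x v where xv: "x \<in> ?D" "v \<in> V" "normaliser_le (x * v) w"
      using w(1) by (elim uf_mult_obtain)
    obtain e where e: "e \<in> V" "e \<in> idempotents" "normaliser_le e v"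
      using unit_lower_obtain[OF V xv(2)] .
    have x: "x \<in> normalisers" "normaliser_le (dagger n) x" using xv(1) unfolding up_closure_def by auto
    have "normaliser_le (dagger n * e) (x * v)"
      using le_mult[OF x(2) e(3)] x(1) dn idem_normaliser[OF e(2)] filter_normaliser[OF F xv(2)] by blast
    then have le: "normaliser_le (dagger n * e) w"
      by (rule le_trans[OF _ xv(3)])
        (use dn e x xv wN idem_normaliser normaliser_mult filter_normaliser[OF F] in auto)
    have "normaliser_le (dagger (dagger n * e) * (dagger n * e)) (dagger w * w)"
      using source_le[OF le le] dn idem_normaliser[OF e(2)] wN normaliser_mult by blast
    moreover have "dagger (dagger n * e) * (dagger n * e) = e * (?f * e)"
      using dagger_mult[OF dn(1) idem_normaliser[OF e(2)]] dagger_dagger[OF n(1)] dagger_idem[OF e(2)]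
      by (simp add: mult.assoc)
    moreover have "e * (?f * e) \<in> V"
      using unit_idem_mult_mem[OF V] e n(2) range_idem[OF n(1)] by blast
    moreover have "dagger w * w = k * dagger k" using w(2) dagger_dagger[OF wN] by simp
    ultimately show "k * dagger k \<in> V"
      using filter_up[OF F] normaliser_mult dagger_normaliser wN w(2) by metis
  qed
  with U nU that show thesis by blast
qed

text \<open>Division of ultrafilters with the same range, as it occurs in the convolution product.\<close>

lemma uf_divide_ultrafilter:
  assumes U: "U \<in> ultrafilters" and W: "W \<in> ultrafilters" and r: "uf_range U = uf_range W"
  shows "uf_mult (uf_inv U) W \<in> ultrafilters"
proof -
  note FU = ultrafilter_filter[OF U] and NU = ultrafilter_normaliser[OF U]
  have "dagger m * w \<noteq> 0" if mw: "m \<in> U" "w \<in> W" for m w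
  proof -
    have "m * dagger m * w \<in> W"
      using range_idem_mult_mem[OF W range_idem[OF NU[OF mw(1)]] _ mw(2)] uf_range_mem[OF FU mw(1)] r
      by simp
    then show ?thesis using ultrafilter_nonzero[OF W] by (fastforce simp: mult.assoc)
  qed
  then have "uf_composable (uf_inv U) W" unfolding uf_composable_def uf_inv_def by blast
  moreover have "uf_inv U \<noteq> {}" using ultrafilter_nonempty[OF U] unfolding uf_inv_def by blast
  ultimately show ?thesis using uf_mult_ultrafilter[OF uf_inv_filter[OF FU]] W by blast
qed

lemma uf_divide_mult_mem:
  assumes U: "U \<in> ultrafilters" and W: "W \<in> ultrafilters" and r: "uf_range U = uf_range W"
    and n: "n \<in> U" and k: "k \<in> uf_mult (uf_inv U) W"
  shows "n * k \<in> W"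
proof -
  note NU = ultrafilter_normaliser[OF U] and NW = ultrafilter_normaliser[OF W]
  obtain m w where mw: "m \<in> U" "w \<in> W" "normaliser_le (dagger m * w) k" and kN: "k \<in> normalisers"
    using k unfolding uf_inv_def by (elim uf_mult_obtain) auto
  obtain l where l: "l \<in> U" "normaliser_le l n" "normaliser_le l m"
    using filter_lower_obtain[OF ultrafilter_filter[OF U] n mw(1)] .
  have lN: "l * dagger l \<in> normalisers" using idem_normaliser range_idem NU l by blast
  have "l * dagger l \<in> uf_range W" using uf_range_mem[OF ultrafilter_filter[OF U] l(1)] r by simp
  then have 1: "l * dagger l * w \<in> W"
    using range_idem_mult_mem[OF W range_idem[OF NU[OF l(1)]] _ mw(2)] by blast
  have "normaliser_le (l * dagger l) (n * dagger m)" using range_le l NU n mw by blast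
  then have "normaliser_le (l * dagger l * w) (n * dagger m * w)"
    by (rule le_mult[OF _ le_refl])
      (use NW[OF mw(2)] lN NU[OF n] NU[OF mw(1)] in \<open>simp_all add: normaliser_mult dagger_normaliser\<close>)
  moreover have "n * dagger m * w = n * (dagger m * w)" by (simp add: mult.assoc)
  ultimately have "normaliser_le (l * dagger l * w) (n * (dagger m * w))" by simp
  moreover have "normaliser_le (n * (dagger m * w)) (n * k)"
    using mw kN NU n NW by (intro le_mult le_refl) (auto intro: normaliser_mult dagger_normaliser)
  ultimately have "normaliser_le (l * dagger l * w) (n * k)"
    by (rule le_trans) (use mw kN NU n NW lN in \<open>simp_all add: normaliser_mult dagger_normaliser\<close>)
  then show ?thesis
    using filter_up[OF ultrafilter_filter[OF W] 1] normaliser_mult NU n kN by blast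
qed

subsection \<open>Action of the units of the coefficient ring\<close>

lemma act_one: "act 1 U = U"
  unfolding act_def by (simp add: scale_one)

lemma act_act: "act s (act t U) = act (s * t) U"
  unfolding act_def by (simp add: image_image scale_scale)

lemma act_mem: "n \<in> U \<Longrightarrow> scale t n \<in> act t U"
  unfolding act_def by blast

lemma up_closure_act:
  assumes t: "t \<in> ring_units" and D: "D \<subseteq> normalisers"
  shows "up_closure (act t D) = act t (up_closure D)"
proof -
  obtain s where s: "s \<in> ring_units" "t * s = 1" "s * t = 1" using ring_unit_obtain[OF t] by metis
  show ?thesis
  proof
    show "up_closure (act t D) \<subseteq> act t (up_closure D)"
    proof
      fix x assume "x \<in> up_closure (act t D)"
      then obtain d where d: "d \<in> D" "normaliser_le (scale t d) x" "x \<in> normalisers"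
        unfolding up_closure_def act_def by blast
      have "normaliser_le (scale s (scale t d)) (scale s x)"
        using le_scale[OF d(2)] d D normaliser_scale t s by blast
      then have "scale s x \<in> up_closure D"
        using d normaliser_scale s unfolding up_closure_def by (auto simp: scale_scale scale_one)
      then have "scale t (scale s x) \<in> act t (up_closure D)" unfolding act_def by blast
      then show "x \<in> act t (up_closure D)" using s by (simp add: scale_scale scale_one)
    qed
    show "act t (up_closure D) \<subseteq> up_closure (act t D)"
      using D normaliser_scale le_scale t unfolding up_closure_def act_def by blast
  qed
qed

lemma act_filter:
  assumes U: "is_filter U" and t: "t \<in> ring_units"
  shows "is_filter (act t U)"
proof -
  note N = filter_normaliser[OF U]
  obtain s where s: "s * t = 1" using ring_unit_obtain[OF t] by metis
  have "scale t n \<noteq> 0" if "n \<in> U" for n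
  proof
    assume "scale t n = 0"
    then have "scale s (scale t n) = 0" by (simp add: scale_zero_right)
    then show False using s filter_nonzero[OF U that] by (simp add: scale_scale scale_one)
  qed
  then have "act t U \<subseteq> normalisers - {0}" using N t normaliser_scale unfolding act_def by auto
  moreover have "up_closure (act t U) \<subseteq> act t U"
    using up_closure_act[OF t, of U] U N unfolding is_filter_def by auto
  moreover have "\<exists>k\<in>act t U. normaliser_le k m \<and> normaliser_le k n"
    if mn: "m \<in> act t U" "n \<in> act t U" for m n
  proof -
    obtain a b where ab: "a \<in> U" "b \<in> U" "m = scale t a" "n = scale t b"
      using mn unfolding act_def by blast
    obtain k where "k \<in> U" "normaliser_le k a" "normaliser_le k b"
      using filter_lower_obtain[OF U ab(1,2)] .
    then show ?thesis using ab le_scale N t act_mem by blast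
  qed
  ultimately show ?thesis by (rule is_filterI)
qed

lemma act_ultrafilter:
  assumes U: "U \<in> ultrafilters" and t: "t \<in> ring_units"
  shows "act t U \<in> ultrafilters"
proof -
  obtain s where s: "s \<in> ring_units" "t * s = 1" "s * t = 1" using ring_unit_obtain[OF t] by metis
  have "V = act t U" if V: "is_filter V" "act t U \<subseteq> V" for V
  proof -
    have "act s (act t U) \<subseteq> act s V" using V(2) unfolding act_def by blast
    then have "act s V = U"
      using ultrafilter_maximal[OF U act_filter[OF V(1) s(1)]] s by (simp add: act_act act_one)
    then show ?thesis using s act_act[of t s V] act_one by simp
  qed
  moreover have "act t U \<noteq> {}" using ultrafilter_nonempty[OF U] unfolding act_def by blast
  ultimately show ?thesis
    using act_filter[OF ultrafilter_filter[OF U] t] unfolding ultrafilters_def by blast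
qed

lemma uf_mult_act:
  assumes "U \<subseteq> normalisers" "V \<subseteq> normalisers" and s: "s \<in> ring_units" and t: "t \<in> ring_units"
  shows "uf_mult (act s U) (act t V) = act (s * t) (uf_mult U V)"
proof -
  have "{m * n |m n. m \<in> act s U \<and> n \<in> act t V} = act (s * t) {m * n |m n. m \<in> U \<and> n \<in> V}" (is "?L = ?R")
  proof
    show "?L \<subseteq> ?R"
    proof
      fix x assume "x \<in> ?L"
      then obtain m n where mn: "m \<in> U" "n \<in> V" "x = scale s m * scale t n" unfolding act_def by blast
      have "x = scale (s * t) (m * n)"
        using mn(3) by (simp add: mult_scale_left mult_scale_right scale_scale mult.commute[of s t])
      then show "x \<in> ?R" unfolding act_def using mn(1,2) by (intro image_eqI[of _ _ "m * n"]) auto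
    qed
    show "?R \<subseteq> ?L"
    proof
      fix x assume "x \<in> ?R"
      then obtain m n where mn: "m \<in> U" "n \<in> V" "x = scale (s * t) (m * n)" unfolding act_def by auto
      have "x = scale s m * scale t n"
        using mn(3) by (simp add: mult_scale_left mult_scale_right scale_scale mult.commute[of s t])
      then show "x \<in> ?L" using act_mem[OF mn(1), of s] act_mem[OF mn(2), of t] by auto
    qed
  qed
  moreover have "{m * n |m n. m \<in> U \<and> n \<in> V} \<subseteq> normalisers" using assms normaliser_mult by blast
  ultimately show ?thesis
    unfolding uf_mult_def using up_closure_act[OF ring_units_mult[OF s t]] by simp
qed

lemma uf_inv_act:
  assumes "U \<subseteq> normalisers" and t: "t * s = 1"
  shows "uf_inv (act t U) = act s (uf_inv U)"
proof -
  have "(\<lambda>n. dagger (scale t n)) ` U = (\<lambda>n. scale s (dagger n)) ` U"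
    using assms(1) dagger_scale[OF _ t] by (intro image_cong) auto
  then show ?thesis unfolding uf_inv_def act_def by (simp add: image_image)
qed

lemma uf_inv_subset: "U \<subseteq> normalisers \<Longrightarrow> uf_inv U \<subseteq> normalisers"
  unfolding uf_inv_def using dagger_normaliser by blast

end

section \<open>Locally constant functions\<close>

lemma locally_constant_nonzero_closedin:
  assumes "f \<in> locally_constant_functions X"
  shows "closedin X {x \<in> topspace X. f x \<noteq> 0}"
proof -
  have "openin X {x \<in> topspace X. f x = 0}"
  proof (subst openin_subopen, intro ballI)
    fix x assume "x \<in> {x \<in> topspace X. f x = 0}"
    then have x: "x \<in> topspace X" "f x = 0" by auto
    then obtain W where W: "openin X W" "x \<in> W" "\<forall>y\<in>W. f y = f x"
      using assms unfolding locally_constant_functions_def by blast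
    then have "W \<subseteq> {x \<in> topspace X. f x = 0}" using openin_subset[OF W(1)] x by auto
    then show "\<exists>T. openin X T \<and> x \<in> T \<and> T \<subseteq> {x \<in> topspace X. f x = 0}" using W by blast
  qed
  moreover have "topspace X - {x \<in> topspace X. f x \<noteq> 0} = {x \<in> topspace X. f x = 0}" by blast
  ultimately show ?thesis unfolding closedin_def by simp
qed

section \<open>The topology of the ultrafilter groupoid\<close>

context algebraic_quasi_cartan_pair
begin

lemma basic_open_iff: "U \<in> basic_open n \<longleftrightarrow> U \<in> ultrafilters \<and> n \<in> U"
  unfolding basic_open_def by blast

lemma basic_open_mono:
  assumes "normaliser_le m n" "n \<in> normalisers"
  shows "basic_open m \<subseteq> basic_open n"
  using filter_up[OF ultrafilter_filter _ assms] unfolding basic_open_def by blast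

lemma openin_basic_open: "n \<in> normalisers \<Longrightarrow> openin uf_topology (basic_open n)"
  unfolding uf_topology_def by (rule topology_generated_by_Basis) blast

lemma openin_uf_topology:
  "openin uf_topology W \<longleftrightarrow> W \<subseteq> ultrafilters \<and> (\<forall>U\<in>W. \<exists>m\<in>U. basic_open m \<subseteq> W)"
proof
  assume W: "openin uf_topology W"
  then have "generate_topology_on (basic_open ` normalisers) W"
    unfolding uf_topology_def openin_topology_generated_by_iff .
  then have "\<forall>U\<in>W. U \<in> ultrafilters \<longrightarrow> (\<exists>m\<in>U. basic_open m \<subseteq> W)"
  proof induction
    case (Int S T)
    show ?case
    proof (intro ballI impI)
      fix U assume U: "U \<in> S \<inter> T" "U \<in> ultrafilters"
      then obtain m n where mn: "m \<in> U" "basic_open m \<subseteq> S" "n \<in> U" "basic_open n \<subseteq> T"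
        using Int.IH by blast
      obtain k where k: "k \<in> U" "normaliser_le k m" "normaliser_le k n"
        using filter_lower_obtain[OF ultrafilter_filter[OF U(2)] mn(1,3)] .
      then have "basic_open k \<subseteq> S \<inter> T"
        using basic_open_mono ultrafilter_normaliser[OF U(2)] mn by blast
      with k(1) show "\<exists>m\<in>U. basic_open m \<subseteq> S \<inter> T" by blast
    qed
  next
    case (UN K)
    then show ?case by (meson Union_iff Union_upper order_trans)
  next
    case (Basis S)
    then show ?case unfolding basic_open_def by blast
  qed simp
  moreover have "W \<subseteq> ultrafilters" using openin_subset[OF W] topspace_uf_topology by simp
  ultimately show "W \<subseteq> ultrafilters \<and> (\<forall>U\<in>W. \<exists>m\<in>U. basic_open m \<subseteq> W)" by blast
next
  assume R: "W \<subseteq> ultrafilters \<and> (\<forall>U\<in>W. \<exists>m\<in>U. basic_open m \<subseteq> W)"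
  show "openin uf_topology W"
  proof (subst openin_subopen, intro ballI)
    fix U assume U: "U \<in> W"
    then obtain m where m: "m \<in> U" "basic_open m \<subseteq> W" using R by blast
    have "U \<in> ultrafilters" using U R by blast
    then show "\<exists>T. openin uf_topology T \<and> U \<in> T \<and> T \<subseteq> W"
      using openin_basic_open[of m] ultrafilter_normaliser m basic_open_iff by blast
  qed
qed

lemma basic_open_refine:
  assumes U: "U \<in> ultrafilters" and n: "n \<in> U" and m: "m \<in> U"
  obtains e where "e \<in> idempotents" "n * e \<in> U" "basic_open (n * e) \<subseteq> basic_open m"
proof -
  note N = ultrafilter_normaliser[OF U]
  obtain k where k: "k \<in> U" "normaliser_le k n" "normaliser_le k m"
    using filter_lower_obtain[OF ultrafilter_filter[OF U] n m] .
  obtain e where e: "e \<in> idempotents" "k = n * e"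
    using le_obtain_right[OF k(2)] N k(1) n by metis
  show thesis using that[OF e(1)] k e basic_open_mono N m by blast
qed

lemma basic_open_zero: "basic_open 0 = {}"
  unfolding basic_open_def using ultrafilter_nonzero by blast

text \<open>
  Primeness again: an ultrafilter containing the restriction of \<open>n\<close> to a join contains the
  restriction to \<open>e\<close>, or has an element killed by \<open>e\<close>, below which only \<open>f\<close> remains of the join.
\<close>

lemma basic_open_join:
  assumes n: "n \<in> normalisers" and e: "e \<in> idempotents" and f: "f \<in> idempotents"
  shows "basic_open (n * (e + f - e * f)) \<subseteq> basic_open (n * e) \<union> basic_open (n * f)"
proof
  fix U assume "U \<in> basic_open (n * (e + f - e * f))"
  then have U: "U \<in> ultrafilters" and x: "n * (e + f - e * f) \<in> U" (is "?x \<in> U")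
    using basic_open_iff by auto
  note F = ultrafilter_filter[OF U] and N = ultrafilter_normaliser[OF U]
  have fe: "f * (e * y) = e * (f * y)" for y using idem_left_commute[OF f idem_mem[OF e]] .
  show "U \<in> basic_open (n * e) \<union> basic_open (n * f)"
  proof (cases "e \<in> uf_source U")
    case True
    have "?x * e \<in> U" using source_idem_mult_mem[OF U e True x] .
    moreover have "?x * e = n * e"
      using e f by (simp add: algebra_simps idem_idem idem_idem_left idem_commute[OF f idem_mem[OF e]])
    ultimately show ?thesis using U basic_open_iff by simp
  next
    case False
    then obtain y where y: "y \<in> U" "y * e = 0" using source_idem_dichotomy[OF U e] by blast
    obtain z where z: "z \<in> U" "normaliser_le z ?x" "normaliser_le z y"
      using filter_lower_obtain[OF F x y(1)] .
    obtain g where g: "g \<in> idempotents" "z = g * y" using le_obtain_left[OF z(3)] N z by metis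
    obtain h where h: "h \<in> idempotents" "z = h * ?x" using le_obtain_left[OF z(2)] N z by metis
    have ze: "z * e = 0" using g y by (simp add: mult.assoc)
    have "z * (e + f - e * f) = z"
      using h idem_idem[OF idem_join[OF e f]] by (simp add: mult.assoc)
    moreover have "z * (e * f) = 0" using ze by (simp flip: mult.assoc)
    ultimately have "z = z * f" using ze by (simp add: algebra_simps)
    also have "\<dots> = h * (n * ((e + f - e * f) * f))" using h by (simp add: mult.assoc)
    also have "\<dots> = h * (n * f)" using f by (simp add: algebra_simps idem_idem)
    finally have "normaliser_le z (n * f)"
      using le_idem_left[OF normaliser_mult[OF n idem_normaliser[OF f]] h(1)] by simp
    then show ?thesis
      using filter_up[OF F z(1)] normaliser_mult[OF n idem_normaliser[OF f]] U basic_open_iff by blast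
  qed
qed

text \<open>
  This is the compactness of basic open sets, in the form of an induction principle: if the restrictions
  \<open>n * e\<close> with \<open>Q e\<close> cover and \<open>Q\<close> passes to joins, then \<open>Q\<close> holds for one restriction that is all of \<open>n\<close>.
  Otherwise the elements \<open>n - n * e\<close> with \<open>Q e\<close> are nonzero and form the base of a filter, and an
  ultrafilter containing it contains \<open>n\<close> but none of the \<open>n * e\<close>.
\<close>

lemma basic_open_compactness:
  assumes n: "n \<in> normalisers" and zero: "Q 0"
    and join: "\<And>e f. e \<in> idempotents \<Longrightarrow> f \<in> idempotents \<Longrightarrow> Q e \<Longrightarrow> Q f \<Longrightarrow> Q (e + f - e * f)"
    and cover: "\<And>U. U \<in> basic_open n \<Longrightarrow> \<exists>e\<in>idempotents. n * e \<in> U \<and> Q e"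
  obtains e where "e \<in> idempotents" "Q e" "n * e = n"
proof (rule ccontr)
  assume "\<not> thesis"
  then have no: "\<forall>e\<in>idempotents. Q e \<longrightarrow> n * e \<noteq> n" using that by blast
  let ?d = "dagger n * n"
  let ?D = "{n - n * e |e. e \<in> idempotents \<and> Q e}"
  have d: "?d \<in> idempotents" "n * ?d = n" using n source_idem mult_dagger_mult by auto
  \<comment> \<open>The complement of \<open>n * e\<close> in \<open>n\<close> is itself a restriction of \<open>n\<close>, and restricting that of \<open>n * f\<close>
    to the complement of \<open>e\<close> gives the complement of the join.\<close>
  have restrict: "n - n * e = n * (?d - ?d * e)" "(n - n * f) * (?d - ?d * e) = n - n * (e + f - e * f)"
    if "e \<in> idempotents" "f \<in> idempotents" for e f
  proof -
    have nd: "n * (?d * x) = n * x" for x using d(2) by (metis mult.assoc)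
    have "f * ?d = ?d * f" "f * (?d * e) = ?d * (f * e)" "f * e = e * f"
      using that d(1) idem_commute idem_mem idem_left_commute by auto
    then have "n * (f * ?d) = n * f" "n * (f * (?d * e)) = n * (e * f)" using nd by simp_all
    then show "(n - n * f) * (?d - ?d * e) = n - n * (e + f - e * f)"
      using d(2) nd by (simp add: right_diff_distrib left_diff_distrib distrib_left mult.assoc)
    show "n - n * e = n * (?d - ?d * e)" using d(2) nd by (simp add: right_diff_distrib)
  qed
  have DN: "n - n * e \<in> normalisers" if "e \<in> idempotents" for e
    using restrict(1)[OF that that] normaliser_mult[OF n idem_normaliser[OF idem_diff[OF d(1) that]]]
    by simp
  have F: "is_filter (up_closure ?D)"
  proof (rule up_closure_filter)
    show "?D \<subseteq> normalisers" using DN by blast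
    show "0 \<notin> ?D" using no by auto
    fix x y assume "x \<in> ?D" "y \<in> ?D"
    then obtain e f where ef: "e \<in> idempotents" "Q e" "f \<in> idempotents" "Q f"
      and xy: "x = n - n * e" "y = n - n * f" by blast
    let ?k = "n - n * (e + f - e * f)"
    have "normaliser_le ?k y"
      using restrict(2)[OF ef(1,3)] le_idem_right[OF DN[OF ef(3)] idem_diff[OF d(1) ef(1)]] xy by simp
    moreover have sw: "f + e - f * e = e + f - e * f"
      using idem_commute[OF ef(1) idem_mem[OF ef(3)]] by (simp add: add.commute)
    have "normaliser_le ((n - n * e) * (?d - ?d * f)) (n - n * e)"
      using le_idem_right[OF DN[OF ef(1)] idem_diff[OF d(1) ef(3)]] .
    then have "normaliser_le ?k x" by (simp only: restrict(2)[OF ef(3,1)] sw xy)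
    moreover have "?k \<in> ?D" using idem_join[OF ef(1,3)] join[OF ef(1,3,2,4)] by blast
    ultimately show "\<exists>k\<in>?D. normaliser_le k x \<and> normaliser_le k y" by blast
  qed
  have sub: "?D \<subseteq> up_closure ?D" by (rule subset_up_closure) (use DN in blast)
  have "n - n * 0 \<in> ?D" using idem_zero zero by blast
  then obtain U where U: "U \<in> ultrafilters" "up_closure ?D \<subseteq> U"
    using ultrafilter_extension[OF F] sub by blast
  have DU: "?D \<subseteq> U" using sub U(2) by (rule order_trans)
  have "n - n * 0 \<in> U" using \<open>n - n * 0 \<in> ?D\<close> DU by (rule rev_subsetD)
  then have "n \<in> U" by simp
  then obtain e where e: "e \<in> idempotents" "n * e \<in> U" "Q e"
    using cover[of U] U(1) basic_open_iff[of U n] by auto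
  have "n - n * e \<in> U" by (rule subsetD[OF DU]) (use e in blast)
  then obtain x where x: "x \<in> U" "normaliser_le x (n - n * e)" "normaliser_le x (n * e)"
    using filter_lower_obtain[OF ultrafilter_filter[OF U(1)]] e(2) by metis
  note xN = ultrafilter_normaliser[OF U(1) x(1)]
  obtain g where g: "x = g * (n - n * e)" using le_obtain_left[OF x(2) xN] by metis
  obtain h where h: "x = h * (n * e)" using le_obtain_left[OF x(3) xN] by metis
  have "x * e = 0" unfolding g using e(1) by (simp add: algebra_simps idem_idem)
  moreover have "x * e = x" unfolding h using e(1) by (simp add: mult.assoc idem_idem)
  ultimately show False using ultrafilter_nonzero[OF U(1) x(1)] by simp
qed

lemma compactin_basic_open:
  assumes n: "n \<in> normalisers"
  shows "compactin uf_topology (basic_open n)"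
  unfolding compactin_def
proof (intro conjI allI impI)
  show "basic_open n \<subseteq> topspace uf_topology" unfolding topspace_uf_topology basic_open_def by blast
  fix \<U> assume cov: "(\<forall>U\<in>\<U>. openin uf_topology U) \<and> basic_open n \<subseteq> \<Union>\<U>"
  let ?Q = "\<lambda>e. \<exists>\<F>. finite \<F> \<and> \<F> \<subseteq> \<U> \<and> basic_open (n * e) \<subseteq> \<Union>\<F>"
  obtain e where "?Q e" "n * e = n"
  proof (rule basic_open_compactness[OF n, of ?Q])
    show "?Q 0" using basic_open_zero by (intro exI[of _ "{}"]) simp
    show "?Q (e + f - e * f)"
      if e: "e \<in> idempotents" "f \<in> idempotents" and qe: "?Q e" and qf: "?Q f" for e f
    proof -
      obtain \<F> \<G> where "finite \<F>" "\<F> \<subseteq> \<U>" "basic_open (n * e) \<subseteq> \<Union>\<F>"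
        "finite \<G>" "\<G> \<subseteq> \<U>" "basic_open (n * f) \<subseteq> \<Union>\<G>"
        using qe qf by blast
      then show ?thesis using basic_open_join[OF n e] by (intro exI[of _ "\<F> \<union> \<G>"]) auto
    qed
    fix U assume U: "U \<in> basic_open n"
    then obtain S where S: "S \<in> \<U>" "U \<in> S" using cov by blast
    obtain m where m: "m \<in> U" "basic_open m \<subseteq> S" using cov S openin_uf_topology by metis
    obtain e where e: "e \<in> idempotents" "n * e \<in> U" "basic_open (n * e) \<subseteq> basic_open m"
      using basic_open_refine[of U n m] U m(1) basic_open_iff by metis
    have "?Q e" using S m e by (intro exI[of _ "{S}"]) auto
    then show "\<exists>e\<in>idempotents. n * e \<in> U \<and> ?Q e" using e(1,2) by (intro bexI[of _ e] conjI)
  next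
    fix e assume "e \<in> idempotents" and e: "?Q e" "n * e = n"
    show thesis by (rule that[OF e])
  qed
  then show "\<exists>\<F>. finite \<F> \<and> \<F> \<subseteq> \<U> \<and> basic_open n \<subseteq> \<Union>\<F>" by simp
qed

section \<open>The subalgebra as locally constant functions on the unit space\<close>

text \<open>
  Near a unit ultrafilter every element of \<open>B\<close> is a scalar, in the sense that it becomes one after
  multiplication with a suitable idempotent of the ultrafilter.
\<close>

definition value_at :: "'a set \<Rightarrow> 'a \<Rightarrow> 'r" where
  "value_at V b = (THE t. \<exists>e\<in>V \<inter> idempotents. e * b = scale t e)"

lemma scale_idem_cancel:
  assumes "e \<in> idempotents" "e \<noteq> 0" "scale s e = scale t e"
  shows "s = t"
proof -
  have "scale (s - t) e = 0" using assms(3) by (simp add: scale_diff_left)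
  then have "s - t = 0" using without_torsion assms(1,2) unfolding without_torsion_def by blast
  then show ?thesis by simp
qed

lemma value_at_eqI:
  assumes V: "V \<in> uf_units" and e: "e \<in> V" "e \<in> idempotents" "e * b = scale t e"
  shows "value_at V b = t"
proof -
  note VU = uf_units_ultrafilter[OF V]
  have "s = t" if f: "f \<in> V" "f \<in> idempotents" "f * b = scale s f" for s f
  proof -
    have c: "f * e = e * f" using idem_commute[OF f(2) idem_mem[OF e(2)]] .
    have "e * f \<in> V" using unit_idem_mult_mem[OF V e(1,2) f(1)] .
    then have "e * f \<noteq> 0" using ultrafilter_nonzero[OF VU] by blast
    moreover have "scale s (e * f) = scale t (e * f)"
    proof -
      have "scale s (e * f) = e * (f * b)" using f(3) by (simp add: mult_scale_right)
      also have "\<dots> = f * (e * b)" using c by (metis mult.assoc)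
      also have "\<dots> = scale t (e * f)" using e(3) c by (simp add: mult_scale_right)
      finally show ?thesis .
    qed
    ultimately show ?thesis using scale_idem_cancel idem_mult e f by blast
  qed
  then show ?thesis unfolding value_at_def using e by (intro the_equality) blast+
qed

lemma value_at_obtain:
  assumes V: "V \<in> uf_units" and b: "b \<in> B"
  obtains e where "e \<in> V" "e \<in> idempotents" "e * b = scale (value_at V b) e"
proof -
  have "b \<in> R_span idempotents" using b span_idempotents by simp
  then have "\<exists>t. \<exists>e\<in>V \<inter> idempotents. e * b = scale t e"
  proof (induction rule: R_span_induct)
    case zero
    obtain e where "e \<in> V \<inter> idempotents" using V unfolding uf_units_def by blast
    then show ?case by (intro exI[of _ 0] bexI[of _ e]) (auto simp: scale_zero_left)
  next
    case (add a s x)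
    obtain t e where e: "e \<in> V" "e \<in> idempotents" "e * a = scale t e" using add(1) by blast
    obtain r f where f: "f \<in> V" "f \<in> idempotents" "f * x = scale r f"
    proof (cases "x \<in> V")
      case True
      then show thesis using that[of x 1] add by (simp add: idem_idem scale_one)
    next
      case False
      then show thesis using unit_idem_dichotomy[OF V add(2)] that[of _ 0] by (metis scale_zero_left)
    qed
    have c: "f * e = e * f" using idem_commute[OF f(2) idem_mem[OF e(2)]] .
    have "(e * f) * (a + scale s x) = f * (e * a) + scale s (e * (f * x))"
      by (simp add: distrib_left mult_scale_right flip: mult.assoc c)
    also have "\<dots> = scale (t + s * r) (e * f)"
      using e f c by (simp add: mult_scale_right scale_scale scale_add_left)
    finally have "(e * f) * (a + scale s x) = scale (t + s * r) (e * f)" .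
    moreover have "e * f \<in> V \<inter> idempotents"
      using unit_idem_mult_mem[OF V] e f idem_mult by blast
    ultimately show ?case by blast
  qed
  then show thesis using value_at_eqI[OF V] that by (metis IntE)
qed

lemma value_at_common:
  assumes V: "V \<in> uf_units" and b: "b \<in> B" and c: "c \<in> B"
  obtains e where "e \<in> V" "e \<in> idempotents"
    "e * b = scale (value_at V b) e" "e * c = scale (value_at V c) e"
proof -
  obtain e where e: "e \<in> V" "e \<in> idempotents" "e * b = scale (value_at V b) e"
    using value_at_obtain[OF V b] .
  obtain f where f: "f \<in> V" "f \<in> idempotents" "f * c = scale (value_at V c) f"
    using value_at_obtain[OF V c] .
  have fe: "f * e = e * f" using idem_commute[OF f(2) idem_mem[OF e(2)]] .
  have "(e * f) * b = scale (value_at V b) (e * f)"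
    using e(3) fe by (metis mult.assoc mult_scale_right)
  moreover have "(e * f) * c = scale (value_at V c) (e * f)"
    using f(3) by (simp add: mult.assoc mult_scale_right)
  moreover have "e * f \<in> V" "e * f \<in> idempotents"
    using unit_idem_mult_mem[OF V e(1,2) f(1)] idem_mult e f by blast+
  ultimately show thesis using that by blast
qed

lemma
  assumes V: "V \<in> uf_units" and b: "b \<in> B" and c: "c \<in> B"
  shows value_at_add: "value_at V (b + c) = value_at V b + value_at V c"
    and value_at_diff: "value_at V (b - c) = value_at V b - value_at V c"
    and value_at_mult: "value_at V (b * c) = value_at V b * value_at V c"
    and value_at_scale: "value_at V (scale t b) = t * value_at V b"
proof -
  obtain e where e: "e \<in> V" "e \<in> idempotents" "e * b = scale (value_at V b) e"
    "e * c = scale (value_at V c) e"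
    using value_at_common[OF V b c] .
  show "value_at V (b + c) = value_at V b + value_at V c"
    by (rule value_at_eqI[OF V e(1,2)]) (simp add: distrib_left scale_add_left e)
  show "value_at V (b - c) = value_at V b - value_at V c"
    by (rule value_at_eqI[OF V e(1,2)]) (simp add: right_diff_distrib scale_diff_left e)
  have "e * (b * c) = scale (value_at V b) (e * c)"
    using e(3) by (metis mult.assoc mult_scale_left)
  then show "value_at V (b * c) = value_at V b * value_at V c"
    by (intro value_at_eqI[OF V e(1,2)]) (simp add: e scale_scale)
  show "value_at V (scale t b) = t * value_at V b"
    by (rule value_at_eqI[OF V e(1,2)]) (simp add: mult_scale_right e scale_scale)
qed

lemma value_at_idem:
  assumes V: "V \<in> uf_units" and e: "e \<in> idempotents"
  shows "value_at V e = (if e \<in> V then 1 else 0)"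
proof (cases "e \<in> V")
  case True
  then show ?thesis using value_at_eqI[OF V True e] by (simp add: idem_idem e scale_one)
next
  case False
  then obtain f where "f \<in> V" "f \<in> idempotents" "f * e = 0" using unit_idem_dichotomy[OF V e] by blast
  then show ?thesis using value_at_eqI[OF V] False by (metis scale_zero_left)
qed

text \<open>
  Every idempotent \<open>x\<close> in an expansion of \<open>b\<close> splits a given idempotent \<open>f\<close> into \<open>f * x\<close> and
  \<open>f - f * x\<close>, on both of which \<open>x\<close> acts as a scalar; one of the two pieces keeps the product nonzero.
\<close>

lemma nonzero_scalar_restriction:
  assumes b: "b \<in> B" and "b \<noteq> 0"
  obtains e t where "e \<in> idempotents" "e \<noteq> 0" "t \<noteq> 0" "e * b = scale t e"
proof -
  have "b \<in> R_span idempotents" using b span_idempotents by simp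
  \<comment> \<open>The nonzero element \<open>y\<close> is kept apart from the element \<open>b\<close> that is made scalar, for the induction.\<close>
  then have "\<forall>e\<in>idempotents. \<forall>y. e * y \<noteq> 0 \<longrightarrow> (\<exists>f\<in>idempotents. f * y \<noteq> 0 \<and> (\<exists>t. f * b = scale t f))"
  proof (induction rule: R_span_induct)
    case zero
    then show ?case by (auto intro!: exI[of _ 0] simp: scale_zero_left)
  next
    case (add a s x)
    show ?case
    proof (intro ballI allI impI)
      fix e y assume "e \<in> idempotents" "e * y \<noteq> 0"
      then obtain f t where f: "f \<in> idempotents" "f * y \<noteq> 0" "f * a = scale t f" using add by blast
      have c: "f * x = x * f" using idem_commute[OF f(1) idem_mem[OF add(2)]] .
      show "\<exists>f\<in>idempotents. f * y \<noteq> 0 \<and> (\<exists>t. f * (a + scale s x) = scale t f)"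
      proof (cases "f * x * y = 0")
        case False
        have "f * x * a = x * (f * a)" using c by (simp flip: mult.assoc)
        then have "f * x * (a + scale s x) = x * (f * a) + scale s (f * (x * x))"
          by (simp add: distrib_left mult_scale_right mult.assoc)
        then have "f * x * (a + scale s x) = scale (t + s) (f * x)"
          using f(3) add(2) by (simp add: idem_idem mult_scale_right c scale_add_left)
        then show ?thesis using False f(1) add(2) idem_mult by blast
      next
        case True
        let ?g = "f - f * x"
        have "?g * y \<noteq> 0" using True f(2) by (simp add: left_diff_distrib)
        moreover have "?g * x = 0" using add(2) by (simp add: left_diff_distrib mult.assoc idem_idem)
        moreover have "f * x * a = x * (f * a)" using c by (simp flip: mult.assoc)
        then have "?g * a = scale t f - scale t (f * x)"
          using f(3) c by (simp add: left_diff_distrib mult_scale_right)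
        then have "?g * a = scale t ?g"
          using scale_add_right[of t ?g "f * x"] by simp
        ultimately have "?g * (a + scale s x) = scale t ?g"
          by (simp add: distrib_left mult_scale_right scale_zero_right)
        then show ?thesis using \<open>?g * y \<noteq> 0\<close> idem_diff f(1) add(2) by blast
      qed
    qed
  qed
  moreover obtain u where "u \<in> idempotents" "u * b = b" using local_unit_obtain by metis
  ultimately obtain f t where f: "f \<in> idempotents" "f * b \<noteq> 0" "f * b = scale t f"
    using \<open>b \<noteq> 0\<close> by metis
  then have "f \<noteq> 0" "t \<noteq> 0" using scale_zero_left by auto
  then show thesis using that f by blast
qed

lemma source_value_in_idem:
  assumes U: "U \<in> ultrafilters" and n: "n \<in> U" and e: "e \<in> idempotents"
  shows "value_at (uf_source U) e = (if n * e \<in> U then 1 else 0)"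
proof -
  have "e \<in> uf_source U" if ne: "n * e \<in> U"
  proof (rule ccontr)
    assume "e \<notin> uf_source U"
    then obtain y where y: "y \<in> U" "y * e = 0" using source_idem_dichotomy[OF U e] by blast
    obtain z where z: "z \<in> U" "normaliser_le z (n * e)" "normaliser_le z y"
      using filter_lower_obtain[OF ultrafilter_filter[OF U] ne y(1)] .
    obtain g where g: "z = g * (n * e)" using le_obtain_left z ultrafilter_normaliser[OF U] by metis
    obtain h where h: "z = h * y" using le_obtain_left z ultrafilter_normaliser[OF U] by metis
    have "z * e = z" unfolding g using e by (simp add: mult.assoc idem_idem)
    moreover have "z * e = 0" unfolding h using y by (simp add: mult.assoc)
    ultimately show False using ultrafilter_nonzero[OF U z(1)] by simp
  qed
  then show ?thesis
    using value_at_idem[OF uf_source_unit[OF U] e] source_idem_mult_mem[OF U e _ n] by auto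
qed

text \<open>
  Compactness leaves finitely many restrictions of \<open>n\<close> on which \<open>h\<close> is constant. They are patched
  one at a time: \<open>b - b * f + c * f\<close> takes the values of \<open>c\<close> where \<open>f\<close> is present and those of
  \<open>b\<close> elsewhere.
\<close>

lemma interpolation:
  assumes n: "n \<in> normalisers"
    and h: "\<And>U. U \<in> basic_open n \<Longrightarrow> \<exists>m\<in>U. \<forall>W\<in>basic_open m. h W = h U"
  obtains b where "b \<in> B" "\<And>U. U \<in> basic_open n \<Longrightarrow> value_at (uf_source U) b = h U"
proof -
  let ?Q = "\<lambda>e. \<exists>b\<in>B. \<forall>U\<in>basic_open n. n * e \<in> U \<longrightarrow> value_at (uf_source U) b = h U"
  obtain e where "?Q e" "n * e = n"
  proof (rule basic_open_compactness[OF n, of ?Q])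
    show "?Q 0" using zero_mem ultrafilter_nonzero unfolding basic_open_def by auto
  next
    fix e f assume e: "e \<in> idempotents" and f: "f \<in> idempotents" and qe: "?Q e" and qf: "?Q f"
    obtain b where b: "b \<in> B" "\<And>U. U \<in> basic_open n \<Longrightarrow> n * e \<in> U \<Longrightarrow> value_at (uf_source U) b = h U"
      using qe by blast
    obtain c where c: "c \<in> B" "\<And>U. U \<in> basic_open n \<Longrightarrow> n * f \<in> U \<Longrightarrow> value_at (uf_source U) c = h U"
      using qf by blast
    have fB: "f \<in> B" using f idem_mem by blast
    show "?Q (e + f - e * f)"
    proof (intro bexI ballI impI)
      show "b - b * f + c * f \<in> B" using b(1) c(1) fB by (intro add_mem diff_mem mult_mem)
      fix U assume U: "U \<in> basic_open n" and x: "n * (e + f - e * f) \<in> U"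
      then have UU: "U \<in> ultrafilters" "n \<in> U" using basic_open_iff by auto
      have split: "n * e \<in> U \<or> n * f \<in> U"
        using basic_open_join[OF n e f] x UU(1) basic_open_iff by blast
      have "value_at (uf_source U) (b - b * f + c * f)
          = value_at (uf_source U) b - value_at (uf_source U) b * value_at (uf_source U) f
            + value_at (uf_source U) c * value_at (uf_source U) f"
        using uf_source_unit[OF UU(1)] b(1) c(1) fB
        by (simp add: value_at_add value_at_diff value_at_mult diff_mem mult_mem)
      also have "\<dots> = h U"
        using source_value_in_idem[OF UU f] split b(2)[OF U] c(2)[OF U] by auto
      finally show "value_at (uf_source U) (b - b * f + c * f) = h U" .
    qed
  next
    fix U assume U: "U \<in> basic_open n"
    then have UU: "U \<in> ultrafilters" "n \<in> U" using basic_open_iff by auto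
    obtain m where m: "m \<in> U" "\<forall>W\<in>basic_open m. h W = h U" using h[OF U] by blast
    obtain e where e: "e \<in> idempotents" "n * e \<in> U" "basic_open (n * e) \<subseteq> basic_open m"
      using basic_open_refine[OF UU m(1)] .
    have "value_at (uf_source W) (scale (h U) e) = h W" if W: "W \<in> basic_open n" "n * e \<in> W" for W
    proof -
      have WU: "W \<in> ultrafilters" "n \<in> W" using W(1) basic_open_iff by auto
      have "value_at (uf_source W) e = 1" using source_value_in_idem[OF WU e(1)] W(2) by simp
      moreover have "h W = h U" using m(2) e(3) WU(1) W(2) basic_open_iff by blast
      ultimately show ?thesis
        using value_at_scale[OF uf_source_unit[OF WU(1)] idem_mem[OF e(1)] idem_mem[OF e(1)]] by simp
    qed
    moreover have "scale (h U) e \<in> B" using idem_mem e scale_mem by blast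
    ultimately show "\<exists>e\<in>idempotents. n * e \<in> U \<and> ?Q e" using e by blast
  qed blast
  then show thesis using that basic_open_iff by metis
qed


lemma subalgebra_B_simps [simp]:
  "elems subalgebra_B = B" "add_of subalgebra_B = (+)" "mult_of subalgebra_B = (*)"
  "scale_of subalgebra_B = scale"
  unfolding subalgebra_B_def whole_algebra_def by simp_all

lemma topspace_uf_units: "topspace (subtopology uf_topology uf_units) = uf_units"
  unfolding topspace_subtopology topspace_uf_topology uf_units_def by blast

lemma basic_open_idem_units: "e \<in> idempotents \<Longrightarrow> basic_open e \<subseteq> uf_units"
  unfolding basic_open_def uf_units_def by blast

lemma openin_units_basic_open:
  assumes "e \<in> idempotents"
  shows "openin (subtopology uf_topology uf_units) (basic_open e)"
  unfolding openin_subtopology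
  using openin_basic_open[OF idem_normaliser[OF assms]] basic_open_idem_units[OF assms] by blast

text \<open>
  The extension by \<open>0\<close>, in both arguments, matches the conditions that determine \<^const>\<open>phi\<close>.
\<close>

definition gelfand :: "'a \<Rightarrow> 'a set \<Rightarrow> 'r" where
  "gelfand b V = (if b \<in> B \<and> V \<in> uf_units then value_at V b else 0)"

lemma gelfand_steinberg:
  assumes b: "b \<in> B"
  shows "gelfand b \<in> elems (steinberg_algebra (subtopology uf_topology uf_units))"
proof -
  let ?X = "subtopology uf_topology uf_units"
  have lc: "gelfand b \<in> locally_constant_functions ?X"
    unfolding locally_constant_functions_def topspace_uf_units
  proof (intro CollectI conjI ballI allI impI)
    fix V assume V: "V \<in> uf_units"
    obtain e where e: "e \<in> V" "e \<in> idempotents" "e * b = scale (value_at V b) e"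
      using value_at_obtain[OF V b] .
    have "gelfand b W = gelfand b V" if W: "W \<in> basic_open e" for W
    proof -
      have "W \<in> uf_units" "e \<in> W" using W basic_open_idem_units[OF e(2)] basic_open_iff by auto
      then show ?thesis unfolding gelfand_def using value_at_eqI[OF _ _ e(2,3)] V by simp
    qed
    moreover have "V \<in> basic_open e" using uf_units_ultrafilter[OF V] e(1) basic_open_iff by simp
    ultimately show "\<exists>W. openin ?X W \<and> V \<in> W \<and> (\<forall>W'\<in>W. gelfand b W' = gelfand b V)"
      using openin_units_basic_open[OF e(2)] by blast
  qed (auto simp: gelfand_def)
  obtain u where u: "u \<in> idempotents" "u * b = b" using local_unit_obtain by metis
  have "{V \<in> topspace ?X. gelfand b V \<noteq> 0} \<subseteq> basic_open u"
  proof
    fix V assume "V \<in> {V \<in> topspace ?X. gelfand b V \<noteq> 0}"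
    then have V: "V \<in> uf_units" "value_at V b \<noteq> 0"
      using b unfolding topspace_uf_units gelfand_def by auto
    have "value_at V b = value_at V u * value_at V b"
      using value_at_mult[OF V(1) idem_mem[OF u(1)] b] u(2) by simp
    then have "value_at V u \<noteq> 0" using V(2) by auto
    then have "u \<in> V" using value_at_idem[OF V(1) u(1)] by (auto split: if_splits)
    then show "V \<in> basic_open u" using uf_units_ultrafilter[OF V(1)] basic_open_iff by simp
  qed
  moreover have "compactin ?X (basic_open u)"
    using compactin_basic_open[OF idem_normaliser[OF u(1)]] basic_open_idem_units[OF u(1)]
    by (simp add: compactin_subtopology)
  ultimately have "compactin ?X {V \<in> topspace ?X. gelfand b V \<noteq> 0}"
    using closed_compactin locally_constant_nonzero_closedin[OF lc] by blast
  with lc show ?thesis unfolding steinberg_algebra_def by simp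
qed

lemma gelfand_surjective:
  assumes f: "f \<in> elems (steinberg_algebra (subtopology uf_topology uf_units))"
  obtains b where "b \<in> B" "gelfand b = f"
proof -
  let ?X = "subtopology uf_topology uf_units"
  let ?K = "{V \<in> topspace ?X. f V \<noteq> 0}"
  have lc: "f \<in> locally_constant_functions ?X" and K: "compactin ?X ?K"
    using f unfolding steinberg_algebra_def by auto
  have "?K \<subseteq> \<Union>(basic_open ` idempotents)"
  proof
    fix V assume "V \<in> ?K"
    then have "V \<in> uf_units" unfolding topspace_uf_units by simp
    then obtain x where "V \<in> ultrafilters" "x \<in> V" "x \<in> idempotents" unfolding uf_units_def by blast
    then show "V \<in> \<Union>(basic_open ` idempotents)" unfolding basic_open_def by blast
  qed
  moreover have "openin ?X W" if "W \<in> basic_open ` idempotents" for W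
    using that openin_units_basic_open by auto
  ultimately obtain \<F> where \<F>: "finite \<F>" "\<F> \<subseteq> basic_open ` idempotents" "?K \<subseteq> \<Union>\<F>"
    using compactinD[OF K, of "basic_open ` idempotents"] by auto
  obtain F where F: "F \<subseteq> idempotents" "finite F" "\<F> = basic_open ` F"
    using finite_subset_image[OF \<F>(1,2)] by auto
  obtain e where e: "e \<in> idempotents" "\<forall>x\<in>F. e * x = x"
    using local_units F(2) unfolding local_units_def by blast
  have sub: "?K \<subseteq> basic_open e"
  proof
    fix V assume V: "V \<in> ?K"
    then obtain x where x: "x \<in> F" "V \<in> basic_open x" using \<F>(3) F(3) by blast
    then have xE: "x \<in> idempotents" and ex: "e * x = x" using F(1) e(2) by auto
    have "normaliser_le x e"
      using le_idem_iff[OF xE e(1)] idem_commute[OF e(1) idem_mem[OF xE]] ex by simp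
    then show "V \<in> basic_open e" using basic_open_mono[OF _ idem_normaliser[OF e(1)]] x(2) by blast
  qed
  have "\<exists>m\<in>U. \<forall>W\<in>basic_open m. f W = f U" if U: "U \<in> basic_open e" for U
  proof -
    have UU: "U \<in> uf_units" "U \<in> ultrafilters" using U basic_open_idem_units[OF e(1)] basic_open_iff by auto
    obtain W where W: "openin ?X W" "U \<in> W" "\<forall>y\<in>W. f y = f U"
      using lc UU(1) unfolding locally_constant_functions_def topspace_uf_units by blast
    have "\<exists>T. openin uf_topology T \<and> W = T \<inter> uf_units" using W(1) unfolding openin_subtopology by blast
    then obtain T where T: "openin uf_topology T" "W = T \<inter> uf_units" by blast
    then obtain m where m: "m \<in> U" "basic_open m \<subseteq> T" using openin_uf_topology W(2) by blast
    obtain g where g: "g \<in> U" "g \<in> idempotents" "normaliser_le g m"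
      using unit_lower_obtain[OF UU(1) m(1)] .
    have "basic_open g \<subseteq> W"
      using basic_open_mono[OF g(3) ultrafilter_normaliser[OF UU(2) m(1)]] m(2) T(2)
        basic_open_idem_units[OF g(2)] by blast
    then show ?thesis using W(3) g(1) by blast
  qed
  then obtain b where b: "b \<in> B" "\<And>U. U \<in> basic_open e \<Longrightarrow> value_at (uf_source U) b = f U"
    using interpolation[OF idem_normaliser[OF e(1)]] by blast
  have eb: "e * b \<in> B" using mult_mem idem_mem e b by blast
  have "gelfand (e * b) V = f V" for V
  proof (cases "V \<in> uf_units")
    case V: True
    have v: "gelfand (e * b) V = value_at V e * value_at V b"
      unfolding gelfand_def using V eb value_at_mult[OF V idem_mem[OF e(1)] b(1)] by simp
    show ?thesis
    proof (cases "e \<in> V")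
      case True
      then have "V \<in> basic_open e" using uf_units_ultrafilter[OF V] basic_open_iff by simp
      then show ?thesis
        using b(2)[of V] v value_at_idem[OF V e(1)] True uf_source_of_unit[OF V] by simp
    next
      case False
      then have "f V = 0" using sub V basic_open_iff unfolding topspace_uf_units by blast
      then show ?thesis using v value_at_idem[OF V e(1)] False by simp
    qed
  next
    case False
    then show ?thesis
      using lc unfolding locally_constant_functions_def topspace_uf_units gelfand_def by auto
  qed
  then have "gelfand (e * b) = f" by blast
  then show thesis using that eb by blast
qed

lemma gelfand_iso: "alg_iso subalgebra_B (steinberg_algebra (subtopology uf_topology uf_units)) gelfand"
  unfolding alg_iso_def subalgebra_B_simps
proof (intro conjI ballI allI)
  let ?S = "steinberg_algebra (subtopology uf_topology uf_units)"
  show "bij_betw gelfand B (elems ?S)"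
    unfolding bij_betw_def
  proof
    show "inj_on gelfand B"
    proof (rule inj_onI, rule ccontr)
      fix b c assume bc: "b \<in> B" "c \<in> B" "gelfand b = gelfand c" "b \<noteq> c"
      then obtain e t where e: "e \<in> idempotents" "e \<noteq> 0" "t \<noteq> 0" "e * (b - c) = scale t e"
        using nonzero_scalar_restriction[of "b - c"] diff_mem by auto
      obtain V where V: "V \<in> ultrafilters" "e \<in> V"
        using ultrafilter_of_normaliser[OF idem_normaliser[OF e(1)] e(2)] .
      have VU: "V \<in> uf_units" using ultrafilter_mem_units[OF V e(1)] .
      have "value_at V (b - c) = t" using value_at_eqI[OF VU V(2) e(1,4)] .
      moreover have "value_at V b = value_at V c"
        using fun_cong[OF bc(3), of V] VU bc(1,2) unfolding gelfand_def by simp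
      ultimately show False using value_at_diff[OF VU bc(1,2)] e(3) by simp
    qed
    have "f \<in> gelfand ` B" if "f \<in> elems ?S" for f
    proof -
      obtain b where "b \<in> B" "gelfand b = f" using gelfand_surjective[OF \<open>f \<in> elems ?S\<close>] .
      then show ?thesis by auto
    qed
    then show "gelfand ` B = elems ?S" using gelfand_steinberg by auto
  qed
  fix b assume b: "b \<in> B"
  show "gelfand (scale t b) = scale_of ?S t (gelfand b)" for t
    unfolding steinberg_algebra_def gelfand_def using b scale_mem value_at_scale by auto
  fix c assume c: "c \<in> B"
  show "gelfand (b + c) = add_of ?S (gelfand b) (gelfand c)"
    unfolding steinberg_algebra_def gelfand_def using b c add_mem value_at_add by auto
  show "gelfand (b * c) = mult_of ?S (gelfand b) (gelfand c)"
    unfolding steinberg_algebra_def gelfand_def using b c mult_mem value_at_mult by auto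
qed

text \<open>An isomorphism with the values prescribed on idempotents is unique, because idempotents span.\<close>

lemma phi_eq_gelfand: "phi = gelfand"
  unfolding phi_def
proof (rule the_equality)
  let ?S = "steinberg_algebra (subtopology uf_topology uf_units)"
  have "gelfand e = (\<lambda>U. if U \<in> basic_open e then 1 else 0)" if e: "e \<in> idempotents" for e
    unfolding gelfand_def
    using value_at_idem[OF _ e] idem_mem[OF e] basic_open_idem_units[OF e] uf_units_ultrafilter
    by (auto simp: basic_open_iff fun_eq_iff)
  moreover have "gelfand a = (\<lambda>U. 0)" if "a \<notin> B" for a unfolding gelfand_def using that by auto
  ultimately show *: "alg_iso subalgebra_B ?S gelfand \<and>
     (\<forall>e\<in>idempotents. gelfand e = (\<lambda>U. if U \<in> basic_open e then 1 else 0)) \<and>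
     (\<forall>a. a \<notin> B \<longrightarrow> gelfand a = (\<lambda>U. 0))"
    using gelfand_iso by blast
  fix \<psi> assume \<psi>: "alg_iso subalgebra_B ?S \<psi> \<and>
     (\<forall>e\<in>idempotents. \<psi> e = (\<lambda>U. if U \<in> basic_open e then 1 else 0)) \<and>
     (\<forall>a. a \<notin> B \<longrightarrow> \<psi> a = (\<lambda>U. 0))"
  have lin: "h (a + scale t x) = (\<lambda>V. h a V + t * h x V)"
    if "alg_iso subalgebra_B ?S h" "a \<in> B" "x \<in> B" for h a t x
    using that scale_mem[OF that(3), of t] unfolding alg_iso_def steinberg_algebra_def by simp
  have eqB: "\<psi> b = gelfand b" if "b \<in> B" for b
  proof -
    have "b \<in> R_span idempotents" using that span_idempotents by simp
    then have "b \<in> B \<and> \<psi> b = gelfand b"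
    proof (induction rule: R_span_induct)
      case zero
      have "h 0 = (\<lambda>V. 0)" if h: "alg_iso subalgebra_B ?S h" for h
      proof -
        have "h (scale 0 0) = scale_of ?S 0 (h 0)"
          using h zero_mem unfolding alg_iso_def subalgebra_B_simps by blast
        then show ?thesis by (simp add: scale_zero_left steinberg_algebra_def)
      qed
      then show ?case using \<psi> gelfand_iso zero_mem by metis
    next
      case (add a t x)
      have "\<psi> x = gelfand x" using \<psi> * add(2) by simp
      then show ?case
        using lin[of \<psi> a x t] lin[of gelfand a x t] \<psi> gelfand_iso add idem_mem[OF add(2)] add_mem scale_mem
        by simp
    qed
    then show ?thesis by blast
  qed
  show "\<psi> = gelfand"
  proof
    fix a show "\<psi> a = gelfand a" using eqB \<psi> * by (cases "a \<in> B") simp_all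
  qed
qed

lemma phi_iso: "alg_iso subalgebra_B (steinberg_algebra (subtopology uf_topology uf_units)) phi"
  using gelfand_iso phi_eq_gelfand by simp

lemma phi_eq: "b \<in> B \<Longrightarrow> V \<in> uf_units \<Longrightarrow> phi b V = value_at V b"
  unfolding phi_eq_gelfand gelfand_def by simp

section \<open>The conditional expectation\<close>

text \<open>
  The defining property is two-sided; a local unit on the other side makes it one-sided.
\<close>

lemma conditional_expectation_mult:
  assumes P: "conditional_expectation P" and b: "b \<in> B"
  shows "P (b * a) = b * P a" "P (a * b) = P a * b"
proof -
  obtain u where u: "u \<in> idempotents" "u * a = a" "a * u = a" "u * P a = P a" "P a * u = P a"
    using local_unit_obtain by metis
  have *: "P (c * a * c') = c * P a * c'" if "c \<in> B" "c' \<in> B" for c c'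
    using P that unfolding conditional_expectation_def by blast
  show "P (b * a) = b * P a" using *[OF b idem_mem[OF u(1)]] u by (simp add: mult.assoc)
  show "P (a * b) = P a * b" using *[OF idem_mem[OF u(1)] b] u by simp
qed

text \<open>
  Two expectations implemented by idempotents restrict a normaliser to \<open>n * e\<close> and \<open>n * f\<close>. As they
  fix these elements of \<open>B\<close>, both restrictions agree with \<open>n * e * f\<close>.
\<close>

lemma expectation_unique:
  assumes P: "conditional_expectation P" "implemented_by_idempotents P"
    and Q: "conditional_expectation Q" "implemented_by_idempotents Q"
  shows "P = Q"
proof
  have half: "P n = P n * f" if P: "conditional_expectation P" "P n = n * e" "e \<in> idempotents"
      and Q: "conditional_expectation Q" "Q n = n * f" "f \<in> idempotents" for P Q n e f
  proof -
    have "P n = Q (P n)" using P(1) Q(1) unfolding conditional_expectation_def by metis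
    also have "\<dots> = Q n * e" using P(2) conditional_expectation_mult(2)[OF Q(1) idem_mem[OF P(3)]] by simp
    also have "\<dots> = n * (f * e)" using Q by (simp add: mult.assoc)
    also have "\<dots> = P n * f"
      using P(2) idem_commute[OF Q(3) idem_mem[OF P(3)]] by (simp add: mult.assoc)
    finally show ?thesis .
  qed
  have N: "P n = Q n" if n: "n \<in> normalisers" for n
  proof -
    obtain e where e: "e \<in> idempotents" "P n = n * e"
      using P(2) n unfolding implemented_by_idempotents_def by blast
    obtain f where f: "f \<in> idempotents" "Q n = n * f"
      using Q(2) n unfolding implemented_by_idempotents_def by blast
    have "P n = P n * f" "Q n = Q n * e"
      using half[OF P(1) e(2,1) Q(1) f(2,1)] half[OF Q(1) f(2,1) P(1) e(2,1)] by auto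
    then show ?thesis
      using e f idem_commute[OF e(1) idem_mem[OF f(1)]] by (metis mult.assoc)
  qed
  fix a
  have "a \<in> R_span normalisers" using span_normalisers by blast
  then show "P a = Q a"
  proof (induction rule: R_span_induct)
    case zero
    have "P 0 = 0" "Q 0 = 0" using P(1) Q(1) zero_mem unfolding conditional_expectation_def by auto
    then show ?case by simp
  next
    case (add a t x)
    then show ?case using P(1) Q(1) N[OF add(2)] unfolding conditional_expectation_def by simp
  qed
qed

lemma expectation_properties:
  "conditional_expectation expectation \<and> faithful expectation \<and> implemented_by_idempotents expectation"
proof -
  have "\<exists>!P. conditional_expectation P \<and> faithful P \<and> implemented_by_idempotents P"
    using expectation_exists expectation_unique by blast
  then show ?thesis unfolding expectation_def by (rule theI')
qed

lemma expectation_mem: "expectation a \<in> B"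
  and expectation_add: "expectation (a + a') = expectation a + expectation a'"
  and expectation_scale: "expectation (scale t a) = scale t (expectation a)"
  and expectation_id: "b \<in> B \<Longrightarrow> expectation b = b"
  using expectation_properties unfolding conditional_expectation_def by blast+

lemma expectation_zero: "expectation 0 = 0"
  using expectation_id zero_mem by blast

lemma expectation_mult: "b \<in> B \<Longrightarrow> expectation (b * a) = b * expectation a"
  using conditional_expectation_mult(1) expectation_properties by blast

lemma expectation_implemented:
  assumes "n \<in> normalisers"
  obtains e where "e \<in> idempotents" "expectation n = n * e" "n * e = e * n"
  using expectation_properties assms unfolding implemented_by_idempotents_def by blast

lemma expectation_faithful:
  assumes "a \<noteq> 0"
  obtains n where "n \<in> normalisers" "expectation (n * a) \<noteq> 0"
  using expectation_properties assms unfolding faithful_def by blast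

section \<open>The function attached to an element of the algebra\<close>

text \<open>
  All computations with \<^term>\<open>hat a U\<close> go through the following description of its value: it is the
  scalar \<open>t\<close> with \<open>expectation (dagger m * a) = scale t (dagger m * m)\<close> for some \<open>m\<close> in \<open>U\<close>, and such
  an equation passes to smaller \<open>m\<close>.
\<close>

lemma hat_equation_le:
  assumes m: "m \<in> normalisers" "expectation (dagger m * a) = scale t (dagger m * m)"
    and k: "k \<in> normalisers" "normaliser_le k m"
  shows "expectation (dagger k * a) = scale t (dagger k * k)"
proof -
  obtain e where e: "e \<in> idempotents" "k = m * e" using le_obtain_right[OF k(2,1) m(1)] .
  have dk: "dagger k = e * dagger m" using e m dagger_mult idem_normaliser dagger_idem by simp
  have "expectation (dagger k * a) = e * expectation (dagger m * a)"
    using dk expectation_mult[OF idem_mem[OF e(1)]] by (simp add: mult.assoc)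
  also have "\<dots> = scale t (e * (dagger m * m))" using m(2) by (simp add: mult_scale_right)
  also have "e * (dagger m * m) = (e * e) * (dagger m * m)" using e(1) by (simp add: idem_idem)
  also have "\<dots> = e * ((dagger m * m) * e)"
    using idem_commute[OF e(1) idem_mem[OF source_idem[OF m(1)]]] by (simp add: mult.assoc)
  also have "\<dots> = dagger k * k" using dk e(2) by (simp add: mult.assoc)
  finally show ?thesis .
qed

lemma hat_eqI:
  assumes U: "U \<in> ultrafilters" and m: "m \<in> U" "expectation (dagger m * a) = scale t (dagger m * m)"
  shows "hat a U = t"
proof -
  note N = ultrafilter_normaliser[OF U]
  have val: "phi (expectation (dagger n * a)) (uf_source U) = t" if n: "n \<in> U" for n
  proof -
    obtain k where k: "k \<in> U" "normaliser_le k m" "normaliser_le k n"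
      using filter_lower_obtain[OF ultrafilter_filter[OF U] m(1) n] .
    let ?g = "dagger k * k"
    have gE: "?g \<in> idempotents" using source_idem N k(1) by blast
    obtain f where f: "f \<in> idempotents" "k = n * f" using le_obtain_right[OF k(3)] N k(1) n by metis
    have dk: "dagger k = f * dagger n" using f N n dagger_mult idem_normaliser dagger_idem by simp
    have gf: "?g * f = ?g" using f by (simp add: mult.assoc idem_idem)
    have "?g * expectation (dagger n * a) = ?g * (f * expectation (dagger n * a))"
      using gf by (metis mult.assoc)
    also have "\<dots> = ?g * expectation (dagger k * a)"
      using dk expectation_mult[OF idem_mem[OF f(1)]] by (simp add: mult.assoc)
    also have "\<dots> = scale t ?g"
      using hat_equation_le[OF N[OF m(1)] m(2) N[OF k(1)] k(2)] idem_idem[OF gE]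
      by (simp add: mult_scale_right)
    finally have "value_at (uf_source U) (expectation (dagger n * a)) = t"
      using value_at_eqI[OF uf_source_unit[OF U] uf_source_mem[OF U k(1)] gE] by blast
    then show ?thesis using phi_eq expectation_mem uf_source_unit[OF U] by simp
  qed
  have "(THE z. \<forall>n\<in>U. z = phi (expectation (dagger n * a)) (uf_source U)) = t"
    by (rule the_equality) (use val m(1) in auto)
  then show ?thesis unfolding hat_def using U by simp
qed

text \<open>
  The scalar is first found for \<open>n\<close> on some idempotent \<open>g\<close> of the source, and the equation then holds
  for the restriction \<open>n * g\<close>.
\<close>

lemma hat_obtain_at:
  assumes U: "U \<in> ultrafilters" and n: "n \<in> U"
  obtains m where "m \<in> U" "normaliser_le m n"
    "expectation (dagger m * a) = scale (hat a U) (dagger m * m)"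
proof -
  note N = ultrafilter_normaliser[OF U]
  obtain g where g: "g \<in> uf_source U" "g \<in> idempotents"
      "g * expectation (dagger n * a) = scale (value_at (uf_source U) (expectation (dagger n * a))) g"
    using value_at_obtain[OF uf_source_unit[OF U] expectation_mem] .
  let ?t = "value_at (uf_source U) (expectation (dagger n * a))" and ?m = "n * g"
  have mU: "?m \<in> U" using source_idem_mult_mem[OF U g(2,1) n] .
  note mN = N[OF mU]
  have dm: "dagger ?m = g * dagger n" using g N n dagger_mult idem_normaliser dagger_idem by simp
  have "expectation (dagger ?m * a) = scale ?t g"
    using dm expectation_mult[OF idem_mem[OF g(2)]] g(3) by (simp add: mult.assoc)
  then have "(dagger ?m * ?m) * expectation (dagger ?m * a) = scale ?t ((dagger ?m * ?m) * g)"
    by (simp add: mult_scale_right)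
  moreover have "(dagger ?m * ?m) * g = dagger ?m * ?m" using g(2) by (simp add: mult.assoc idem_idem)
  moreover have "(dagger ?m * ?m) * (dagger ?m * a) = dagger ?m * a"
    using dagger_mult_dagger[OF mN] by (metis mult.assoc)
  then have "(dagger ?m * ?m) * expectation (dagger ?m * a) = expectation (dagger ?m * a)"
    using expectation_mult[OF idem_mem[OF source_idem[OF mN]], of "dagger ?m * a"] by simp
  ultimately have eq: "expectation (dagger ?m * a) = scale ?t (dagger ?m * ?m)" by simp
  then have "hat a U = ?t" using hat_eqI[OF U mU] by blast
  then show thesis using that[OF mU le_idem_right[OF N[OF n] g(2)]] eq by simp
qed

lemma hat_common_obtain:
  assumes U: "U \<in> ultrafilters"
  obtains m where "m \<in> U" "m \<in> normalisers"
    "expectation (dagger m * a) = scale (hat a U) (dagger m * m)"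
    "expectation (dagger m * b) = scale (hat b U) (dagger m * m)"
proof -
  note N = ultrafilter_normaliser[OF U]
  obtain n where "n \<in> U" using ultrafilter_nonempty[OF U] by blast
  then obtain m where m: "m \<in> U" "expectation (dagger m * a) = scale (hat a U) (dagger m * m)"
    using hat_obtain_at[OF U] by metis
  obtain k where k: "k \<in> U" "normaliser_le k m" "expectation (dagger k * b) = scale (hat b U) (dagger k * k)"
    using hat_obtain_at[OF U m(1)] by metis
  show thesis
    using that[OF k(1) N[OF k(1)]] hat_equation_le[OF N[OF m(1)] m(2) N[OF k(1)] k(2)] k(3) by blast
qed

lemma hat_obtain:
  assumes "U \<in> ultrafilters"
  obtains m where "m \<in> U" "m \<in> normalisers"
    "expectation (dagger m * a) = scale (hat a U) (dagger m * m)"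
  using hat_common_obtain[OF assms, of a a] by metis

lemma hat_outside: "U \<notin> ultrafilters \<Longrightarrow> hat a U = 0"
  unfolding hat_def by simp

lemma hat_add: "hat (a + b) U = hat a U + hat b U"
proof (cases "U \<in> ultrafilters")
  case True
  obtain m where m: "m \<in> U" "m \<in> normalisers"
    "expectation (dagger m * a) = scale (hat a U) (dagger m * m)"
    "expectation (dagger m * b) = scale (hat b U) (dagger m * m)"
    using hat_common_obtain[OF True] .
  show ?thesis
    by (rule hat_eqI[OF True m(1)]) (simp add: distrib_left expectation_add m scale_add_left)
qed (simp add: hat_outside)

lemma hat_scale: "hat (scale t a) U = t * hat a U"
proof (cases "U \<in> ultrafilters")
  case True
  obtain m where m: "m \<in> U" "m \<in> normalisers"
    "expectation (dagger m * a) = scale (hat a U) (dagger m * m)"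
    using hat_obtain[OF True] .
  show ?thesis
    by (rule hat_eqI[OF True m(1)]) (simp add: mult_scale_right expectation_scale m scale_scale)
qed (simp add: hat_outside)

lemma hat_zero: "hat 0 U = 0"
  using hat_scale[of 0 0 U] by (simp add: scale_zero_left)

lemma hat_sum: "hat (\<Sum>x\<in>F. g x) U = (\<Sum>x\<in>F. hat (g x) U)"
  by (induction F rule: infinite_finite_induct) (simp_all add: hat_zero hat_add)

lemma hat_locally_constant:
  assumes U: "U \<in> ultrafilters"
  shows "\<exists>m\<in>U. \<forall>W\<in>basic_open m. hat a W = hat a U"
proof -
  obtain m where m: "m \<in> U" "expectation (dagger m * a) = scale (hat a U) (dagger m * m)"
    using hat_obtain[OF U] by metis
  then show ?thesis using hat_eqI basic_open_iff by blast
qed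

lemma hat_act:
  assumes U: "U \<in> ultrafilters" and t: "t \<in> ring_units"
  shows "hat a (act t U) = unit_inverse t * hat a U"
proof -
  obtain s where s: "s \<in> ring_units" "t * s = 1" "s * t = 1" "unit_inverse t = s"
    using ring_unit_obtain[OF t] .
  obtain m where m: "m \<in> U" "m \<in> normalisers"
    "expectation (dagger m * a) = scale (hat a U) (dagger m * m)"
    using hat_obtain[OF U] .
  have "dagger (scale t m) * scale t m = dagger m * m"
    using dagger_scale[OF m(2) s(2)] s by (simp add: mult_scale_left mult_scale_right scale_scale scale_one)
  moreover have "expectation (dagger (scale t m) * a) = scale (s * hat a U) (dagger m * m)"
    using dagger_scale[OF m(2) s(2)] m(3) by (simp add: mult_scale_left expectation_scale scale_scale)
  ultimately show ?thesis
    using hat_eqI[OF act_ultrafilter[OF U t] act_mem[OF m(1)]] s(4) by simp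
qed

text \<open>
  Faithfulness gives a normaliser \<open>n\<close> with \<open>expectation (n * a)\<close> nonzero, and this element of \<open>B\<close> is a
  nonzero scalar on some idempotent \<open>e\<close>; any ultrafilter through \<open>dagger n * e\<close> detects \<open>a\<close>.
\<close>

lemma hat_injective:
  assumes "a \<noteq> 0"
  obtains U where "U \<in> ultrafilters" "hat a U \<noteq> 0"
proof -
  obtain n where n: "n \<in> normalisers" "expectation (n * a) \<noteq> 0" using expectation_faithful[OF assms] .
  obtain e t where e: "e \<in> idempotents" "e \<noteq> 0" "t \<noteq> 0" "e * expectation (n * a) = scale t e"
    using nonzero_scalar_restriction[OF expectation_mem n(2)] .
  let ?m = "dagger (e * n)" and ?f = "e * n * dagger (e * n)"
  have enN: "e * n \<in> normalisers" using normaliser_mult idem_normaliser e n by blast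
  have mm: "dagger ?m = e * n" using dagger_dagger enN by blast
  have fE: "?f \<in> idempotents" using range_idem enN by blast
  have "expectation (dagger ?m * a) = scale t e"
    using mm e expectation_mult[OF idem_mem[OF e(1)]] by (simp add: mult.assoc)
  moreover have "?f * expectation (dagger ?m * a) = expectation (dagger ?m * a)"
    using expectation_mult[OF idem_mem[OF fE], of "dagger ?m * a"] mm mult_dagger_mult_left[OF enN, of a]
    by (simp add: mult.assoc)
  ultimately have 1: "scale t e = scale t (?f * e)" by (metis mult_scale_right)
  have fe: "?f * e = ?f"
    using dagger_mult[OF idem_normaliser[OF e(1)] n(1)] dagger_idem[OF e(1)] e(1)
    by (simp add: mult.assoc idem_idem)
  have eq: "expectation (dagger ?m * a) = scale t (dagger ?m * ?m)"
    using 1 fe mm \<open>expectation (dagger ?m * a) = scale t e\<close> by simp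
  have "e * n \<noteq> 0"
  proof
    assume "e * n = 0"
    then have "?f = 0" by simp
    then have "scale t e = scale 0 e" using 1 by (simp add: scale_zero_left scale_zero_right)
    then show False using scale_idem_cancel[OF e(1,2)] e(3) by blast
  qed
  then have "?m \<noteq> 0" "?m \<in> normalisers" using dagger_mult_nonzero(3) dagger_normaliser enN by blast+
  then obtain U where U: "U \<in> ultrafilters" "?m \<in> U" using ultrafilter_of_normaliser by metis
  then have "hat a U = t" using hat_eqI eq by blast
  then show thesis using that U(1) e(3) by blast
qed

text \<open>
  The scalars that occur as values of \<^term>\<open>hat n\<close> for a normaliser \<open>n\<close> are units: the quasi-inverse
  of \<open>scale t f\<close> provides an inverse of \<open>t\<close>. That \<open>scale t f\<close> has the same range idempotent as \<open>f\<close>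
  follows from the absence of torsion.
\<close>

lemma scalar_normaliser_unit:
  assumes f: "f \<in> idempotents" "f \<noteq> 0" and t: "t \<noteq> 0" and k: "scale t f \<in> normalisers"
  shows "t \<in> ring_units"
proof -
  let ?k = "scale t f" and ?d = "dagger (scale t f)"
  let ?g = "?k * ?d"
  have gE: "?g \<in> idempotents" using range_idem k by blast
  have fg: "f * ?g = ?g"
    using f(1) by (simp add: mult_scale_left mult_scale_right idem_idem flip: mult.assoc)
  have "?g * f = ?g" using idem_commute[OF f(1) idem_mem[OF gE]] fg by simp
  moreover have "scale t (?g * f) = ?k"
    using mult_dagger_mult[OF k] by (simp add: mult_scale_right mult.assoc)
  ultimately have "scale t (f - f * ?g) = 0"
    using fg scale_add_right[of t "f - ?g" ?g] by simp
  then have "f - f * ?g = 0"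
    using without_torsion idem_diff[OF f(1) gE] t unfolding without_torsion_def by blast
  then have gf: "?g = f" using fg by simp
  let ?b = "expectation (f * ?d)"
  have "scale t (f * ?d) = f" using gf by (simp add: mult_scale_left)
  then have tb: "scale t ?b = f" using expectation_scale[of t "f * ?d"] expectation_id idem_mem[OF f(1)] by simp
  then have "?b \<noteq> 0" using f(2) scale_zero_right by auto
  then obtain e s where e: "e \<in> idempotents" "e \<noteq> 0" "s \<noteq> 0" "e * ?b = scale s e"
    using nonzero_scalar_restriction[OF expectation_mem] by metis
  have "f * ?b = ?b"
    using expectation_mult[OF idem_mem[OF f(1)], of "f * ?d"] f(1) by (simp add: idem_idem_left)
  then have "f * (e * ?b) = e * ?b" using idem_left_commute[OF f(1) idem_mem[OF e(1)]] by simp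
  then have "scale s (f * e) = scale s e" using e(4) by (simp add: mult_scale_right)
  then have "scale s (e - e * f) = 0"
    using scale_add_right[of s "e - e * f" "e * f"] idem_commute[OF f(1) idem_mem[OF e(1)]] by simp
  then have "e = e * f"
    using without_torsion idem_diff[OF e(1) f(1)] e(3) unfolding without_torsion_def by force
  also have "\<dots> = scale (t * s) e" using tb e(4) by (metis mult_scale_right scale_scale)
  finally have "scale (t * s) e = scale 1 e" by (simp add: scale_one)
  then have "t * s = 1" using scale_idem_cancel[OF e(1,2)] by blast
  then show ?thesis unfolding ring_units_def by blast
qed

text \<open>
  The next two lemmas identify the support of \<^term>\<open>hat n\<close>: it consists of the unit multiples of the
  ultrafilters that contain \<open>n\<close>. The idempotent implementing the expectation turns the scalar value
  \<open>t\<close> at \<open>U\<close> into a scalar normaliser, so that \<open>t\<close> is a unit and \<open>scale t m\<close> lies below \<open>n\<close>.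
\<close>

lemma hat_normaliser_eq:
  assumes U: "U \<in> ultrafilters" and t: "t \<in> ring_units" and n: "n \<in> act t U"
  shows "hat n U = t"
proof -
  obtain m where m: "m \<in> U" "n = scale t m" using n unfolding act_def by blast
  have mN: "m \<in> normalisers" using ultrafilter_normaliser[OF U m(1)] .
  have "expectation (dagger m * n) = scale t (dagger m * m)"
    using m(2) expectation_scale expectation_id[OF idem_mem[OF source_idem[OF mN]]]
    by (simp add: mult_scale_right)
  then show ?thesis using hat_eqI[OF U m(1)] by blast
qed

lemma hat_normaliser_nonzero:
  assumes U: "U \<in> ultrafilters" and n: "n \<in> normalisers" and nz: "hat n U \<noteq> 0"
  shows "hat n U \<in> ring_units" "n \<in> act (hat n U) U"
proof -
  let ?t = "hat n U"
  obtain m where m: "m \<in> U" "m \<in> normalisers" "expectation (dagger m * n) = scale ?t (dagger m * m)"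
    using hat_obtain[OF U] .
  have xN: "dagger m * n \<in> normalisers" using normaliser_mult dagger_normaliser m n by blast
  obtain e where e: "e \<in> idempotents" "expectation (dagger m * n) = dagger m * n * e"
    using expectation_implemented[OF xN] by blast
  have "scale ?t (dagger m * m) \<in> normalisers"
    using normaliser_mult[OF xN idem_normaliser[OF e(1)]] e(2) m(3) by simp
  moreover have "dagger m * m \<noteq> 0" using dagger_mult_nonzero m(2) ultrafilter_nonzero[OF U m(1)] by blast
  ultimately show t: "?t \<in> ring_units"
    using scalar_normaliser_unit[OF source_idem[OF m(2)]] nz by blast
  have "dagger m * n * e = scale ?t (dagger m * m)" using e(2) m(3) by simp
  then have "m * (dagger m * n * e) = scale ?t m"
    using mult_dagger_mult[OF m(2)] by (simp only: mult_scale_right)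
  then have "scale ?t m = (m * dagger m) * (n * e)" by (simp add: mult.assoc)
  moreover have "normaliser_le ((m * dagger m) * (n * e)) n"
    by (rule le_trans[OF le_idem_left le_idem_right])
      (use m n e in \<open>simp_all add: range_idem normaliser_mult idem_normaliser\<close>)
  ultimately have "normaliser_le (scale ?t m) n" by simp
  then show "n \<in> act ?t U"
    using filter_up[OF ultrafilter_filter[OF act_ultrafilter[OF U t]] act_mem[OF m(1)]] n by blast
qed

end

section \<open>The quotient groupoid\<close>

context algebraic_quasi_cartan_pair
begin

lemma twist_rel_iff:
  "(U, W) \<in> twist_rel \<longleftrightarrow> U \<in> ultrafilters \<and> W \<in> ultrafilters \<and> (\<exists>t\<in>ring_units. U = act t W)"
  unfolding twist_rel_def by simp

lemma act_inverse:
  assumes "t \<in> ring_units"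
  obtains s where "s \<in> ring_units" "t * s = 1" "unit_inverse t = s" "unit_inverse s = t"
    "\<And>U. act s (act t U) = U" "\<And>U. act t (act s U) = U"
proof -
  obtain s where s: "s \<in> ring_units" "t * s = 1" "s * t = 1" "unit_inverse t = s"
    using ring_unit_obtain[OF assms] .
  obtain t' where t': "s * t' = 1" "unit_inverse s = t'" using ring_unit_obtain[OF s(1)] by metis
  have "t' = t * (s * t')" using s(2) by (metis mult.assoc mult_1)
  then have "unit_inverse s = t" using t' by (simp add: mult.commute[of t 1])
  then show thesis using that[OF s(1,2,4)] s(2,3) by (simp add: act_act act_one)
qed

lemma equiv_twist_rel: "equiv ultrafilters twist_rel"
proof (rule equivI)
  show "twist_rel \<subseteq> ultrafilters \<times> ultrafilters" unfolding twist_rel_def by auto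
  show "refl_on ultrafilters twist_rel"
    using act_one ring_units_one by (auto simp: refl_on_def twist_rel_iff intro!: bexI[of _ 1])
  show "sym twist_rel"
  proof (rule symI)
    fix U W assume "(U, W) \<in> twist_rel"
    then obtain t where t: "U \<in> ultrafilters" "W \<in> ultrafilters" "t \<in> ring_units" "U = act t W"
      unfolding twist_rel_iff by auto
    obtain s where "s \<in> ring_units" "\<And>U. act s (act t U) = U" using act_inverse[OF t(3)] by metis
    then show "(W, U) \<in> twist_rel" unfolding twist_rel_iff using t by auto
  qed
  show "trans twist_rel"
  proof (rule transI)
    fix U W X assume "(U, W) \<in> twist_rel" "(W, X) \<in> twist_rel"
    then obtain s t where *: "U \<in> ultrafilters" "X \<in> ultrafilters" "t \<in> ring_units" "s \<in> ring_units"
        "U = act s (act t X)"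
      unfolding twist_rel_iff by auto
    then have "U = act (s * t) X" "s * t \<in> ring_units" using act_act ring_units_mult by auto
    then show "(U, X) \<in> twist_rel" unfolding twist_rel_iff using * by auto
  qed
qed

lemma q_eq_obtain:
  assumes "q U = q W" "U \<in> ultrafilters" "W \<in> ultrafilters"
  obtains t where "t \<in> ring_units" "U = act t W"
  using eq_equiv_class_iff[OF equiv_twist_rel assms(2,3)] assms(1) unfolding q_def twist_rel_iff by auto

lemma q_act:
  assumes "U \<in> ultrafilters" "t \<in> ring_units"
  shows "q (act t U) = q U"
proof -
  have "(act t U, U) \<in> twist_rel"
    unfolding twist_rel_iff using assms act_ultrafilter[OF assms] by auto
  then show ?thesis unfolding q_def using equiv_class_eq[OF equiv_twist_rel] by simp
qed

lemma q_memE: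
  assumes "W \<in> q U"
  obtains t where "U \<in> ultrafilters" "W \<in> ultrafilters" "t \<in> ring_units" "W = act t U"
proof -
  have UW: "(U, W) \<in> twist_rel" using assms unfolding q_def by auto
  then have "(W, U) \<in> twist_rel" using equiv_twist_rel unfolding equiv_def by (auto dest: symD)
  then show thesis using that unfolding twist_rel_iff by auto
qed

lemma mem_q_self: "U \<in> ultrafilters \<Longrightarrow> U \<in> q U"
  unfolding q_def using equiv_class_self[OF equiv_twist_rel] .

lemma quotient_groupoid_eq: "quotient_groupoid = q ` ultrafilters"
  unfolding quotient_groupoid_def quotient_def q_def by auto

lemma topspace_quotient_topology: "topspace quotient_topology = quotient_groupoid"
proof -
  have "{U \<in> ultrafilters. q U \<in> quotient_groupoid} = ultrafilters"
    unfolding quotient_groupoid_eq by auto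
  then have "openin quotient_topology quotient_groupoid"
    unfolding openin_quotient_topology using openin_topspace[of uf_topology] topspace_uf_topology by simp
  then show ?thesis
    using openin_subset openin_topspace[of quotient_topology]
    unfolding openin_quotient_topology by (metis subset_antisym openin_quotient_topology openin_subset)
qed

lemma continuous_map_q: "continuous_map uf_topology quotient_topology q"
  unfolding continuous_map_def topspace_uf_topology topspace_quotient_topology quotient_groupoid_eq
  by (auto simp: openin_quotient_topology)

text \<open>
  The saturation of an open set is the union of its unit multiples, and the action carries basic open
  sets to basic open sets.
\<close>

lemma openin_q_image:
  assumes W: "openin uf_topology W"
  shows "openin quotient_topology (q ` W)"
  unfolding openin_quotient_topology openin_uf_topology
proof (intro conjI ballI)
  have sub: "W \<subseteq> ultrafilters" using W openin_uf_topology by auto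
  then show "q ` W \<subseteq> quotient_groupoid" unfolding quotient_groupoid_eq by auto
  show "{U \<in> ultrafilters. q U \<in> q ` W} \<subseteq> ultrafilters" by auto
  fix U assume "U \<in> {U \<in> ultrafilters. q U \<in> q ` W}"
  then obtain X where U: "U \<in> ultrafilters" and X: "X \<in> W" "q U = q X" by auto
  obtain t where t: "t \<in> ring_units" "U = act t X" using q_eq_obtain[OF X(2) U] sub X(1) by auto
  obtain s where s: "s \<in> ring_units" "s * t = 1"
    using ring_unit_obtain[OF t(1)] by metis
  obtain m where m: "m \<in> X" "basic_open m \<subseteq> W" using W X(1) unfolding openin_uf_topology by auto
  have "basic_open (scale t m) \<subseteq> {U \<in> ultrafilters. q U \<in> q ` W}"
  proof
    fix Y assume "Y \<in> basic_open (scale t m)"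
    then have Y: "Y \<in> ultrafilters" "scale t m \<in> Y" using basic_open_iff by auto
    have "m \<in> act s Y" using act_mem[OF Y(2), of s] s(2) by (simp add: scale_scale scale_one)
    then have "act s Y \<in> W" using m(2) act_ultrafilter[OF Y(1) s(1)] basic_open_iff by auto
    then have "q (act s Y) \<in> q ` W" by (rule imageI)
    then show "Y \<in> {U \<in> ultrafilters. q U \<in> q ` W}" using Y(1) q_act[OF Y(1) s(1)] by simp
  qed
  moreover have "scale t m \<in> U" using t(2) act_mem[OF m(1)] by simp
  ultimately show "\<exists>m\<in>U. basic_open m \<subseteq> {U \<in> ultrafilters. q U \<in> q ` W}" by (rule bexI)
qed

text \<open>
  A nonzero idempotent below both an idempotent \<open>e\<close> and a multiple \<open>scale t f\<close> of another one forces
  \<open>t = 1\<close>, because there is no torsion.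
\<close>

lemma q_units_inj:
  assumes V: "V \<in> uf_units" and W: "W \<in> uf_units" and eq: "q V = q W"
  shows "V = W"
proof -
  note VU = uf_units_ultrafilter[OF V] and WU = uf_units_ultrafilter[OF W]
  obtain t where t: "t \<in> ring_units" "V = act t W" using q_eq_obtain[OF eq VU WU] .
  obtain e where e: "e \<in> V" "e \<in> idempotents" using V unfolding uf_units_def by auto
  obtain f where f: "f \<in> W" "f \<in> idempotents" using W unfolding uf_units_def by auto
  have "scale t f \<in> V" using t(2) act_mem[OF f(1)] by simp
  then obtain k where k: "k \<in> V" "normaliser_le k e" "normaliser_le k (scale t f)"
    using filter_lower_obtain[OF ultrafilter_filter[OF VU] e(1)] by metis
  have kN: "k \<in> normalisers" using ultrafilter_normaliser[OF VU k(1)] .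
  have kE: "k \<in> idempotents" using le_idem_is_idem[OF k(2) kN e(2)] .
  obtain h where h: "h \<in> idempotents" "k = h * scale t f" using le_obtain_left[OF k(3) kN] .
  let ?x = "h * f"
  have xE: "?x \<in> idempotents" using idem_mult h(1) f(2) by simp
  have kx: "k = scale t ?x" using h(2) by (simp add: mult_scale_right)
  then have "k * ?x = k" using idem_idem[OF xE] by (simp add: mult_scale_left)
  moreover have "k * k = scale t (k * ?x)" using kx by (metis mult_scale_right)
  ultimately have "scale t k = scale 1 k" using idem_idem[OF kE] by (simp add: scale_one)
  then have "t = 1" using scale_idem_cancel[OF kE ultrafilter_nonzero[OF VU k(1)]] by simp
  then show ?thesis using t(2) act_one by simp
qed

lemma G_inv_q:
  assumes U: "U \<in> ultrafilters"
  shows "G_inv (q U) = q (uf_inv U)"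
proof -
  have "q (uf_inv W) = q (uf_inv U)" if W: "W \<in> q U" for W
  proof -
    obtain t where t: "t \<in> ring_units" "W = act t U" using q_memE[OF W] .
    obtain s where s: "s \<in> ring_units" "t * s = 1" using ring_unit_obtain[OF t(1)] by metis
    have "U \<subseteq> normalisers" using ultrafilter_normaliser[OF U] by auto
    then have "uf_inv W = act s (uf_inv U)" using uf_inv_act s(2) t(2) by simp
    then show ?thesis using q_act[OF uf_inv_ultrafilter[OF U] s(1)] by simp
  qed
  then have "G_inv (q U) = (\<Union>W\<in>q U. q (uf_inv U))" unfolding G_inv_def by (intro SUP_cong refl)
  then show ?thesis using mem_q_self[OF U] by (simp only: UN_constant) auto
qed

text \<open>
  All composable representatives of a class and its inverse have the same product up to the action, so
  the union that defines the product is the class of the product of one such pair.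
\<close>

lemma G_range_q:
  assumes U: "U \<in> ultrafilters"
  shows "G_range (q U) = q (uf_range U)"
proof -
  have sub: "U \<subseteq> normalisers" "uf_inv U \<subseteq> normalisers"
    using ultrafilter_normaliser[OF U] uf_inv_subset by auto
  have all: "q (uf_mult X Y) = q (uf_range U)" if X: "X \<in> q U" and Y: "Y \<in> q (uf_inv U)" for X Y
  proof -
    obtain t where t: "t \<in> ring_units" "X = act t U" using q_memE[OF X] .
    obtain s where s: "s \<in> ring_units" "Y = act s (uf_inv U)" using q_memE[OF Y] .
    have "uf_mult X Y = act (t * s) (uf_range U)"
      unfolding uf_range_def using uf_mult_act[OF sub t(1) s(1)] t(2) s(2) by simp
    then show ?thesis using q_act[OF uf_range_ultrafilter[OF U] ring_units_mult[OF t(1) s(1)]] by simp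
  qed
  have U1: "U \<in> q U" "uf_inv U \<in> {W \<in> q (uf_inv U). uf_composable U W}"
    using mem_q_self U uf_inv_ultrafilter[OF U] uf_inv_composable[OF U] by auto
  show ?thesis
    unfolding G_range_def G_inv_q[OF U] G_mult_def
  proof
    show "(\<Union>X\<in>q U. \<Union>Y\<in>{W \<in> q (uf_inv U). uf_composable X W}. q (uf_mult X Y)) \<subseteq> q (uf_range U)"
      using all by auto
    have "q (uf_range U) = q (uf_mult U (uf_inv U))" unfolding uf_range_def by simp
    then show "q (uf_range U)
        \<subseteq> (\<Union>X\<in>q U. \<Union>Y\<in>{W \<in> q (uf_inv U). uf_composable X W}. q (uf_mult X Y))"
      using U1 by blast
  qed
qed

lemma G_units_eq: "G_units = q ` uf_units"
proof
  show "G_units \<subseteq> q ` uf_units"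
  proof
    fix \<alpha> assume "\<alpha> \<in> G_units"
    then obtain U where "U \<in> ultrafilters" "\<alpha> = G_range (q U)"
      unfolding G_units_def quotient_groupoid_eq by blast
    then show "\<alpha> \<in> q ` uf_units" using G_range_q uf_range_unit by simp
  qed
  show "q ` uf_units \<subseteq> G_units"
  proof
    fix \<alpha> assume "\<alpha> \<in> q ` uf_units"
    then obtain V where V: "V \<in> uf_units" "\<alpha> = q V" by auto
    have "G_range (q V) = \<alpha>" using G_range_q[OF uf_units_ultrafilter[OF V(1)]] uf_range_of_unit[OF V(1)] V(2) by simp
    then show "\<alpha> \<in> G_units"
      unfolding G_units_def quotient_groupoid_eq using uf_units_ultrafilter[OF V(1)] by blast
  qed
qed

section \<open>Equivariant functions and the image of the map\<close>

definition equivariant :: "('a set \<Rightarrow> 'r) \<Rightarrow> bool" where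
  "equivariant f \<longleftrightarrow> (\<forall>t\<in>ring_units. \<forall>\<sigma>\<in>ultrafilters. f (act t \<sigma>) = unit_inverse t * f \<sigma>)"

lemma equivariantD:
  "equivariant f \<Longrightarrow> t \<in> ring_units \<Longrightarrow> U \<in> ultrafilters \<Longrightarrow> f (act t U) = unit_inverse t * f U"
  unfolding equivariant_def by simp

lemma equivariant_zero_iff:
  assumes f: "equivariant f" and t: "t \<in> ring_units" and U: "U \<in> ultrafilters"
  shows "f (act t U) = 0 \<longleftrightarrow> f U = 0"
proof -
  obtain s where s: "t * s = 1" "unit_inverse t = s" using ring_unit_obtain[OF t] by metis
  have "f U = t * f (act t U)" using equivariantD[OF f t U] s by (metis mult.assoc mult_1)
  then show ?thesis using equivariantD[OF f t U] by auto
qed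

lemma equivariant_hat: "equivariant (hat a)"
  unfolding equivariant_def using hat_act by simp

lemma supp_G_iff:
  assumes f: "equivariant f" and U: "U \<in> ultrafilters"
  shows "q U \<in> supp_G f \<longleftrightarrow> f U \<noteq> 0"
proof
  assume "q U \<in> supp_G f"
  then obtain W where W: "q U = q W" "W \<in> ultrafilters" "f W \<noteq> 0" unfolding supp_G_def supp_def by auto
  then obtain t where "t \<in> ring_units" "U = act t W" using q_eq_obtain[OF W(1) U W(2)] by metis
  then show "f U \<noteq> 0" using equivariant_zero_iff[OF f _ W(2)] W(3) by simp
qed (use U in \<open>auto simp: supp_G_def supp_def\<close>)

lemma locally_constant_uf_iff:
  "f \<in> locally_constant_functions uf_topology \<longleftrightarrow>
    (\<forall>U\<in>ultrafilters. \<exists>m\<in>U. \<forall>W\<in>basic_open m. f W = f U) \<and> (\<forall>U. U \<notin> ultrafilters \<longrightarrow> f U = 0)"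
proof -
  have "(\<exists>X. openin uf_topology X \<and> U \<in> X \<and> (\<forall>W\<in>X. f W = f U)) \<longleftrightarrow>
      (\<exists>m\<in>U. \<forall>W\<in>basic_open m. f W = f U)" if U: "U \<in> ultrafilters" for U
  proof
    assume "\<exists>X. openin uf_topology X \<and> U \<in> X \<and> (\<forall>W\<in>X. f W = f U)"
    then obtain X where X: "openin uf_topology X" "U \<in> X" "\<forall>W\<in>X. f W = f U" by auto
    then obtain m where "m \<in> U" "basic_open m \<subseteq> X" unfolding openin_uf_topology by auto
    then show "\<exists>m\<in>U. \<forall>W\<in>basic_open m. f W = f U" using X(3) by auto
  next
    assume "\<exists>m\<in>U. \<forall>W\<in>basic_open m. f W = f U"
    then obtain m where m: "m \<in> U" "\<forall>W\<in>basic_open m. f W = f U" by auto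
    then show "\<exists>X. openin uf_topology X \<and> U \<in> X \<and> (\<forall>W\<in>X. f W = f U)"
      using openin_basic_open[OF ultrafilter_normaliser[OF U m(1)]] U basic_open_iff[of U m] by blast
  qed
  then show ?thesis unfolding locally_constant_functions_def topspace_uf_topology by auto
qed

lemma hat_locally_constant_functions: "hat a \<in> locally_constant_functions uf_topology"
  unfolding locally_constant_uf_iff
proof (intro conjI ballI allI impI)
  fix U assume "U \<in> ultrafilters"
  then show "\<exists>m\<in>U. \<forall>W\<in>basic_open m. hat a W = hat a U" by (rule hat_locally_constant)
qed (simp add: hat_outside)

lemma elems_twisted_steinberg:
  "f \<in> elems twisted_steinberg_algebra \<longleftrightarrow>
    f \<in> locally_constant_functions uf_topology \<and> equivariant f \<and> compactin quotient_topology (supp_G f)"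
  unfolding twisted_steinberg_algebra_def equivariant_def by simp

lemma closedin_supp_G:
  assumes f: "f \<in> locally_constant_functions uf_topology" "equivariant f"
  shows "closedin quotient_topology (supp_G f)"
  unfolding closedin_def topspace_quotient_topology
proof
  show "supp_G f \<subseteq> quotient_groupoid" unfolding supp_G_def supp_def quotient_groupoid_eq by auto
  have "{U \<in> ultrafilters. q U \<in> quotient_groupoid - supp_G f} = ultrafilters - {U \<in> ultrafilters. f U \<noteq> 0}"
    using supp_G_iff[OF f(2)] unfolding quotient_groupoid_eq by auto
  moreover have "openin uf_topology (ultrafilters - {U \<in> ultrafilters. f U \<noteq> 0})"
    using locally_constant_nonzero_closedin[OF f(1)] unfolding closedin_def topspace_uf_topology by simp
  ultimately show "openin quotient_topology (quotient_groupoid - supp_G f)"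
    unfolding openin_quotient_topology by auto
qed

lemma hat_normaliser_supp:
  assumes U: "U \<in> ultrafilters" and n: "n \<in> normalisers" and nz: "hat n U \<noteq> 0"
  shows "q U \<in> q ` basic_open n"
proof -
  note t = hat_normaliser_nonzero[OF U n nz]
  have "act (hat n U) U \<in> basic_open n" using t act_ultrafilter[OF U t(1)] basic_open_iff by simp
  then have "q (act (hat n U) U) \<in> q ` basic_open n" by (rule imageI)
  then show ?thesis using q_act[OF U t(1)] by simp
qed

lemma hat_normaliser_one: "U \<in> basic_open n \<Longrightarrow> hat n U = 1"
  using hat_normaliser_eq[OF _ ring_units_one] act_one basic_open_iff by simp

lemma normaliser_expansion:
  obtains F c where "finite F" "F \<subseteq> normalisers" "a = (\<Sum>x\<in>F. scale (c x) x)"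
proof -
  have "a \<in> R_span normalisers" unfolding span_normalisers[symmetric] by (rule UNIV_I)
  then show thesis using that unfolding R_span_def by auto
qed

lemma supp_G_hat_subset:
  assumes F: "finite F" "F \<subseteq> normalisers"
  shows "supp_G (hat (\<Sum>x\<in>F. scale (c x) x)) \<subseteq> (\<Union>x\<in>F. q ` basic_open x)"
proof
  fix \<alpha> assume "\<alpha> \<in> supp_G (hat (\<Sum>x\<in>F. scale (c x) x))"
  then obtain U where U: "\<alpha> = q U" "U \<in> ultrafilters" "hat (\<Sum>x\<in>F. scale (c x) x) U \<noteq> 0"
    unfolding supp_G_def supp_def by auto
  have "(\<Sum>x\<in>F. c x * hat x U) \<noteq> 0" using U(3) by (simp add: hat_sum hat_scale)
  then have "\<not> (\<forall>x\<in>F. c x * hat x U = 0)" by (rule contrapos_nn) (rule sum.neutral)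
  then obtain x where "x \<in> F" "c x * hat x U \<noteq> 0" by auto
  then have x: "x \<in> F" "hat x U \<noteq> 0" by auto
  then have "q U \<in> q ` basic_open x" using hat_normaliser_supp U(2) F(2) by blast
  then show "\<alpha> \<in> (\<Union>x\<in>F. q ` basic_open x)" using x(1) U(1) by auto
qed

lemma hat_mem: "hat a \<in> elems twisted_steinberg_algebra"
proof -
  obtain F c where F: "finite F" "F \<subseteq> normalisers" "a = (\<Sum>x\<in>F. scale (c x) x)"
    using normaliser_expansion .
  have "compactin quotient_topology (q ` basic_open x)" if "x \<in> F" for x
    using image_compactin[OF compactin_basic_open continuous_map_q] that F(2) by auto
  then have "compactin quotient_topology (\<Union>x\<in>F. q ` basic_open x)"
    using F(1) by (intro compactin_Union) auto
  then have "compactin quotient_topology (supp_G (hat a))"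
    using closed_compactin[OF _ _ closedin_supp_G[OF hat_locally_constant_functions equivariant_hat]]
      supp_G_hat_subset[OF F(1,2)] F(3) by simp
  then show ?thesis
    unfolding elems_twisted_steinberg using hat_locally_constant_functions equivariant_hat by simp
qed

text \<open>
  If \<open>g * b = scale t g\<close> with \<open>g\<close> in the source of \<open>U\<close>, the restriction \<open>n * g\<close> witnesses the value \<open>t\<close>.
\<close>

lemma hat_mult_right:
  assumes U: "U \<in> ultrafilters" and n: "n \<in> U" and b: "b \<in> B"
  shows "hat (n * b) U = value_at (uf_source U) b"
proof -
  have nN: "n \<in> normalisers" using ultrafilter_normaliser[OF U n] .
  let ?t = "value_at (uf_source U) b" and ?s = "dagger n * n"
  obtain g where g: "g \<in> uf_source U" "g \<in> idempotents" "g * b = scale ?t g"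
    using value_at_obtain[OF uf_source_unit[OF U] b] .
  let ?m = "n * g"
  have mU: "?m \<in> U" using source_idem_mult_mem[OF U g(2,1) n] .
  have dm: "dagger ?m = g * dagger n" using g nN dagger_mult idem_normaliser dagger_idem by simp
  have gs: "g * ?s = ?s * g" using idem_commute[OF g(2) idem_mem[OF source_idem[OF nN]]] .
  have "dagger ?m * ?m = (g * ?s) * g" using dm by (simp add: mult.assoc)
  also have "\<dots> = ?s * g" unfolding gs using g(2) by (simp add: mult.assoc idem_idem)
  finally have mm: "dagger ?m * ?m = ?s * g" .
  have "dagger ?m * (n * b) = (g * ?s) * b" using dm by (simp add: mult.assoc)
  also have "\<dots> = scale ?t (?s * g)" unfolding gs using g(3) by (simp add: mult.assoc mult_scale_right)
  finally have "expectation (dagger ?m * (n * b)) = scale ?t (dagger ?m * ?m)"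
    using mm expectation_scale expectation_id[OF idem_mem[OF idem_mult[OF source_idem[OF nN] g(2)]]] by simp
  then show ?thesis using hat_eqI[OF U mU] by simp
qed

lemma hat_mult_right_zero:
  assumes U: "U \<in> ultrafilters" and n: "n \<in> normalisers" and b: "b \<in> B" and z: "hat n U = 0"
  shows "hat (n * b) U = 0"
proof -
  have "b \<in> R_span idempotents" using b span_idempotents by simp
  then show ?thesis
  proof (induction rule: R_span_induct)
    case zero
    then show ?case by (simp add: hat_zero)
  next
    case (add a t x)
    have neN: "n * x \<in> normalisers" using normaliser_mult n idem_normaliser add(2) by simp
    have "hat (n * x) U = 0"
    proof (rule ccontr)
      assume nz: "hat (n * x) U \<noteq> 0"
      note h = hat_normaliser_nonzero[OF U neN nz]
      have "n \<in> act (hat (n * x) U) U"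
        using filter_up[OF ultrafilter_filter[OF act_ultrafilter[OF U h(1)]] h(2) le_idem_right[OF n add(2)] n] .
      then have "hat n U = hat (n * x) U" using hat_normaliser_eq[OF U h(1)] by simp
      then show False using nz z by simp
    qed
    then show ?case using add(1) by (simp add: distrib_left mult_scale_right hat_add hat_scale)
  qed
qed

text \<open>
  Interpolation provides \<open>b\<close> such that \<open>hat (n * b)\<close> agrees with \<open>f\<close> at the ultrafilters containing
  \<open>n\<close>; equivariance carries the equality over to their unit multiples, and both functions vanish
  elsewhere.
\<close>

lemma hat_surjective_basic:
  assumes f: "f \<in> locally_constant_functions uf_topology" "equivariant f"
    and n: "n \<in> normalisers" and sub: "\<And>U. U \<in> ultrafilters \<Longrightarrow> hat n U = 0 \<Longrightarrow> f U = 0"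
  obtains a where "hat a = f"
proof -
  have "\<exists>m\<in>U. \<forall>W\<in>basic_open m. f W = f U" if "U \<in> basic_open n" for U
    using f(1) that unfolding locally_constant_uf_iff basic_open_iff by simp
  then obtain b where b: "b \<in> B" "\<And>U. U \<in> basic_open n \<Longrightarrow> value_at (uf_source U) b = f U"
    using interpolation[OF n, of f] by metis
  have "hat (n * b) U = f U" for U
  proof (cases "U \<in> ultrafilters")
    case U: True
    show ?thesis
    proof (cases "hat n U = 0")
      case True
      then show ?thesis using sub[OF U] hat_mult_right_zero[OF U n b(1)] by simp
    next
      case False
      let ?t = "hat n U"
      note h = hat_normaliser_nonzero[OF U n False]
      obtain s where s: "?t * s = 1" "unit_inverse ?t = s" using ring_unit_obtain[OF h(1)] by metis
      have "hat (n * b) (act ?t U) = f (act ?t U)"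
        using hat_mult_right[OF act_ultrafilter[OF U h(1)] h(2) b(1)] b(2)[of "act ?t U"]
          act_ultrafilter[OF U h(1)] h(2) basic_open_iff by simp
      then have "s * hat (n * b) U = s * f U" using hat_act[OF U h(1)] equivariantD[OF f(2) h(1) U] s by simp
      then have "(?t * s) * hat (n * b) U = (?t * s) * f U" by (simp add: mult.assoc)
      then show ?thesis using s by simp
    qed
  next
    case False
    then show ?thesis using f(1) hat_outside unfolding locally_constant_uf_iff by simp
  qed
  then have "hat (n * b) = f" by (rule ext)
  then show thesis by (rule that)
qed

text \<open>
  Cutting a function along the clopen supports of finitely many \<^term>\<open>hat n\<close> reduces to the case
  of one basic open set.
\<close>

lemma hat_surjective_finite:
  assumes "finite F" "F \<subseteq> normalisers"
    and "f \<in> locally_constant_functions uf_topology" "equivariant f"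
    and "\<And>U. U \<in> ultrafilters \<Longrightarrow> \<forall>n\<in>F. hat n U = 0 \<Longrightarrow> f U = 0"
  shows "\<exists>a. hat a = f"
  using assms
proof (induction F arbitrary: f rule: finite_induct)
  case empty
  have "f U = 0" for U
    using empty.prems(2,4) unfolding locally_constant_uf_iff by (cases "U \<in> ultrafilters") simp_all
  then have "hat 0 U = f U" for U using hat_zero by simp
  then have "hat 0 = f" by (rule ext)
  then show ?case by auto
next
  case (insert n F)
  have n: "n \<in> normalisers" using insert.prems(1) by simp
  let ?g = "\<lambda>U. if hat n U = 0 then 0 else f U" and ?h = "\<lambda>U. if hat n U = 0 then f U else 0"
  have const: "\<exists>m\<in>U. \<forall>W\<in>basic_open m. f W = f U \<and> hat n W = hat n U" if U: "U \<in> ultrafilters" for U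
  proof -
    note N = ultrafilter_normaliser[OF U]
    obtain m where m: "m \<in> U" "\<forall>W\<in>basic_open m. f W = f U"
      using insert.prems(2) U unfolding locally_constant_uf_iff by auto
    obtain m' where m': "m' \<in> U" "\<forall>W\<in>basic_open m'. hat n W = hat n U"
      using hat_locally_constant[OF U, where a = n] by auto
    obtain k where k: "k \<in> U" "normaliser_le k m" "normaliser_le k m'"
      using filter_lower_obtain[OF ultrafilter_filter[OF U] m(1) m'(1)] .
    have "basic_open k \<subseteq> basic_open m" "basic_open k \<subseteq> basic_open m'"
      using basic_open_mono[OF k(2) N[OF m(1)]] basic_open_mono[OF k(3) N[OF m'(1)]] .
    then show ?thesis using m(2) m'(2) k(1) by blast
  qed
  have out: "f U = 0" if "U \<notin> ultrafilters" for U
    using insert.prems(2) that unfolding locally_constant_uf_iff by simp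
  have lc: "?g \<in> locally_constant_functions uf_topology" "?h \<in> locally_constant_functions uf_topology"
    unfolding locally_constant_uf_iff
  proof (safe)
    fix U assume U: "U \<in> ultrafilters"
    obtain m where m: "m \<in> U" "\<forall>W\<in>basic_open m. f W = f U \<and> hat n W = hat n U"
      using const[OF U] by auto
    show "\<exists>m\<in>U. \<forall>W\<in>basic_open m. ?g W = ?g U" by (rule bexI[OF _ m(1)]) (use m(2) in simp)
    show "\<exists>m\<in>U. \<forall>W\<in>basic_open m. ?h W = ?h U" by (rule bexI[OF _ m(1)]) (use m(2) in simp)
  qed (simp_all add: out)
  have eq: "equivariant ?g" "equivariant ?h"
    unfolding equivariant_def
    using equivariantD[OF insert.prems(3)] equivariant_zero_iff[OF equivariant_hat] by simp_all
  obtain a where a: "hat a = ?g"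
    using hat_surjective_basic[OF lc(1) eq(1) n] by (metis (mono_tags, lifting))
  have "\<exists>b. hat b = ?h"
  proof (rule insert.IH[OF _ lc(2) eq(2)])
    show "F \<subseteq> normalisers" using insert.prems(1) by simp
    fix U assume "U \<in> ultrafilters" "\<forall>n\<in>F. hat n U = 0"
    then show "?h U = 0" using insert.prems(4)[of U] by simp
  qed
  then obtain b where b: "hat b = ?h" by auto
  have "hat (a + b) U = f U" for U using fun_cong[OF a, of U] fun_cong[OF b, of U] by (simp add: hat_add)
  then have "hat (a + b) = f" by (rule ext)
  then show ?case by auto
qed

lemma hat_surjective:
  assumes f: "f \<in> elems twisted_steinberg_algebra"
  shows "\<exists>a. hat a = f"
proof -
  have lc: "f \<in> locally_constant_functions uf_topology" and eq: "equivariant f"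
    and K: "compactin quotient_topology (supp_G f)"
    using f unfolding elems_twisted_steinberg by auto
  let ?C = "(\<lambda>n. q ` basic_open n) ` normalisers"
  have op: "openin quotient_topology W" if "W \<in> ?C" for W
    using that openin_q_image openin_basic_open by auto
  have "supp_G f \<subseteq> \<Union>?C"
  proof
    fix \<alpha> assume "\<alpha> \<in> supp_G f"
    then obtain U where U: "\<alpha> = q U" "U \<in> ultrafilters" unfolding supp_G_def supp_def by auto
    obtain n where "n \<in> U" using ultrafilter_nonempty[OF U(2)] by auto
    then have "n \<in> normalisers" "\<alpha> \<in> q ` basic_open n"
      using ultrafilter_normaliser[OF U(2)] U basic_open_iff by auto
    then show "\<alpha> \<in> \<Union>?C" by auto
  qed
  then have "\<exists>\<F>. finite \<F> \<and> \<F> \<subseteq> ?C \<and> supp_G f \<subseteq> \<Union>\<F>"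
    by (rule compactinD[OF K, rotated]) (rule op)
  then obtain \<F> where \<F>: "finite \<F>" "\<F> \<subseteq> ?C" "supp_G f \<subseteq> \<Union>\<F>" by blast
  obtain F where F: "F \<subseteq> normalisers" "finite F" "\<F> = (\<lambda>n. q ` basic_open n) ` F"
    using finite_subset_image[OF \<F>(1,2)] by auto
  show ?thesis
  proof (rule hat_surjective_finite[OF F(2,1) lc eq], rule ccontr)
    fix U assume U: "U \<in> ultrafilters" "\<forall>n\<in>F. hat n U = 0" and "f U \<noteq> 0"
    then have "q U \<in> supp_G f" using supp_G_iff[OF eq U(1)] by simp
    then obtain n where n: "n \<in> F" "q U \<in> q ` basic_open n" using \<F>(3) F(3) by auto
    then obtain W where W: "W \<in> basic_open n" "q U = q W" by auto
    then have WU: "W \<in> ultrafilters" using basic_open_iff by simp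
    obtain t where t: "t \<in> ring_units" "U = act t W" using q_eq_obtain[OF W(2) U(1) WU] .
    have "hat n W = 0" using U(2) n(1) t equivariant_zero_iff[OF equivariant_hat t(1) WU] by auto
    then have "(1::'r) = 0" using hat_normaliser_one[OF W(1)] by simp
    then have "f U = 0" by (metis mult_1 mult_zero_left)
    then show False using \<open>f U \<noteq> 0\<close> by simp
  qed
qed

section \<open>Convolution\<close>

definition range_fibre :: "'a set \<Rightarrow> 'a set set set" where
  "range_fibre \<sigma> = {\<alpha> \<in> quotient_groupoid. G_range \<alpha> = q (uf_range \<sigma>)}"

text \<open>
  The convolution sum is evaluated with the fixed choice of representatives \<open>SOME U. U \<in> \<alpha>\<close>; equivariance
  makes each summand independent of the choice, so the sum may be taken over any finite part of the
  fibre that covers the support of the first factor.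
\<close>

definition conv_term :: "('a set \<Rightarrow> 'r) \<Rightarrow> ('a set \<Rightarrow> 'r) \<Rightarrow> 'a set \<Rightarrow> 'a set set \<Rightarrow> 'r" where
  "conv_term f g \<sigma> \<alpha> = f (SOME U. U \<in> \<alpha>) * g (uf_mult (uf_inv (SOME U. U \<in> \<alpha>)) \<sigma>)"

lemma range_fibre_iff:
  assumes U: "U \<in> ultrafilters" and \<sigma>: "\<sigma> \<in> ultrafilters"
  shows "q U \<in> range_fibre \<sigma> \<longleftrightarrow> uf_range U = uf_range \<sigma>"
  unfolding range_fibre_def quotient_groupoid_eq
  using G_range_q[OF U] q_units_inj[OF uf_range_unit[OF U] uf_range_unit[OF \<sigma>]] U by auto

lemma range_fibre_obtain:
  assumes "\<alpha> \<in> range_fibre \<sigma>" and \<sigma>: "\<sigma> \<in> ultrafilters"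
  obtains U where "U \<in> ultrafilters" "\<alpha> = q U" "uf_range U = uf_range \<sigma>"
proof -
  obtain U where U: "U \<in> ultrafilters" "\<alpha> = q U"
    using assms(1) unfolding range_fibre_def quotient_groupoid_eq by auto
  then show thesis using that range_fibre_iff[OF U(1) \<sigma>] assms(1) by simp
qed

lemma conv_term_eq:
  assumes f: "equivariant f" and g: "equivariant g" and U: "U \<in> ultrafilters" and W: "W \<in> q U"
    and \<sigma>: "\<sigma> \<in> ultrafilters" and r: "uf_range U = uf_range \<sigma>"
  shows "f W * g (uf_mult (uf_inv W) \<sigma>) = f U * g (uf_mult (uf_inv U) \<sigma>)"
proof -
  obtain t where t: "t \<in> ring_units" "W = act t U" using q_memE[OF W] .
  obtain s where s: "s \<in> ring_units" "t * s = 1" "unit_inverse t = s" "unit_inverse s = t"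
    using act_inverse[OF t(1)] by metis
  have sub: "U \<subseteq> normalisers" "\<sigma> \<subseteq> normalisers" using ultrafilter_normaliser U \<sigma> by auto
  note sub = sub uf_inv_subset[OF sub(1)]
  let ?\<tau> = "uf_mult (uf_inv U) \<sigma>"
  have "uf_mult (uf_inv W) \<sigma> = uf_mult (act s (uf_inv U)) (act 1 \<sigma>)"
    using uf_inv_act[OF sub(1) s(2)] t(2) act_one by simp
  also have "\<dots> = act s ?\<tau>"
    using uf_mult_act[OF sub(3,2) s(1) ring_units_one] by (simp add: mult.commute[of s 1])
  finally have "g (uf_mult (uf_inv W) \<sigma>) = t * g ?\<tau>"
    using equivariantD[OF g s(1) uf_divide_ultrafilter[OF U \<sigma> r]] s(4) by simp
  moreover have "f W = s * f U" using equivariantD[OF f t(1) U] t(2) s(3) by simp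
  ultimately have "f W * g (uf_mult (uf_inv W) \<sigma>) = (t * s) * (f U * g ?\<tau>)"
    by (simp add: mult.assoc mult.left_commute mult.commute)
  then show ?thesis using s(2) by simp
qed

lemma conv_term_q:
  assumes "equivariant f" "equivariant g" "U \<in> ultrafilters" "\<sigma> \<in> ultrafilters"
    and "uf_range U = uf_range \<sigma>"
  shows "conv_term f g \<sigma> (q U) = f U * g (uf_mult (uf_inv U) \<sigma>)"
proof -
  have "(SOME W. W \<in> q U) \<in> q U" using someI[of "\<lambda>W. W \<in> q U"] mem_q_self[OF assms(3)] by simp
  then show ?thesis unfolding conv_term_def using conv_term_eq[OF assms(1,2,3) _ assms(4,5)] by simp
qed

lemma convolution_eq:
  assumes f: "equivariant f" and g: "equivariant g" and \<sigma>: "\<sigma> \<in> ultrafilters"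
    and T: "finite T" "T \<subseteq> range_fibre \<sigma>" "range_fibre \<sigma> \<inter> supp_G f \<subseteq> T"
  shows "convolution f g \<sigma> = (\<Sum>\<alpha>\<in>T. conv_term f g \<sigma> \<alpha>)"
proof -
  let ?D = "range_fibre \<sigma> \<inter> supp_G f"
  have zero: "conv_term f g \<sigma> \<alpha> = 0" if "\<alpha> \<in> T - ?D" for \<alpha>
  proof -
    have \<alpha>: "\<alpha> \<in> range_fibre \<sigma>" "\<alpha> \<notin> supp_G f" using that T(2) by auto
    obtain U where U: "U \<in> ultrafilters" "\<alpha> = q U" "uf_range U = uf_range \<sigma>"
      using range_fibre_obtain[OF \<alpha>(1) \<sigma>] .
    then have "f U = 0" using supp_G_iff[OF f U(1)] \<alpha>(2) by simp
    then show ?thesis using conv_term_q[OF f g U(1) \<sigma> U(3)] U(2) by simp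
  qed
  let ?s = "\<lambda>S. \<Sum>\<alpha>\<in>?D. f (S \<alpha>) * g (uf_mult (uf_inv (S \<alpha>)) \<sigma>)"
  have val: "?s S = (\<Sum>\<alpha>\<in>T. conv_term f g \<sigma> \<alpha>)" if S: "is_section f S" for S
  proof -
    have "?s S = (\<Sum>\<alpha>\<in>?D. conv_term f g \<sigma> \<alpha>)"
    proof (rule sum.cong[OF refl])
      fix \<alpha> assume \<alpha>: "\<alpha> \<in> ?D"
      then have q: "S \<alpha> \<in> ultrafilters" "q (S \<alpha>) = \<alpha>" using S unfolding is_section_def supp_def by auto
      then have "uf_range (S \<alpha>) = uf_range \<sigma>" using range_fibre_iff[OF q(1) \<sigma>] \<alpha> by simp
      then show "f (S \<alpha>) * g (uf_mult (uf_inv (S \<alpha>)) \<sigma>) = conv_term f g \<sigma> \<alpha>"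
        using conv_term_q[OF f g q(1) \<sigma>] q(2) by simp
    qed
    also have "\<dots> = (\<Sum>\<alpha>\<in>T. conv_term f g \<sigma> \<alpha>)"
      using T zero by (intro sum.mono_neutral_left) auto
    finally show ?thesis .
  qed
  have "\<exists>U. U \<in> supp f \<and> q U = \<alpha>" if "\<alpha> \<in> supp_G f" for \<alpha> using that unfolding supp_G_def by auto
  then have "is_section f (\<lambda>\<alpha>. SOME U. U \<in> supp f \<and> q U = \<alpha>)"
    unfolding is_section_def using someI_ex[of "\<lambda>U. U \<in> supp f \<and> q U = _"] by simp
  then have "(THE z. \<forall>S. is_section f S \<longrightarrow> z = ?s S) = (\<Sum>\<alpha>\<in>T. conv_term f g \<sigma> \<alpha>)"
    by (intro the_equality) (auto simp: val)
  then show ?thesis unfolding convolution_def range_fibre_def using \<sigma> by simp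
qed

lemma range_fibre_basic_open_unique:
  assumes \<sigma>: "\<sigma> \<in> ultrafilters" and \<alpha>: "\<alpha> \<in> range_fibre \<sigma>" "\<alpha> \<in> q ` basic_open n"
  obtains W where "W \<in> basic_open n" "\<alpha> = q W" "uf_range W = uf_range \<sigma>"
proof -
  obtain W where W: "W \<in> basic_open n" "\<alpha> = q W" using \<alpha>(2) by auto
  then show thesis using that range_fibre_iff[OF _ \<sigma>, of W] \<alpha>(1) basic_open_iff by auto
qed

lemma finite_range_fibre_basic_open:
  assumes \<sigma>: "\<sigma> \<in> ultrafilters"
  shows "finite (range_fibre \<sigma> \<inter> q ` basic_open n)"
proof (cases "range_fibre \<sigma> \<inter> q ` basic_open n = {}")
  case False
  then obtain \<alpha> where "\<alpha> \<in> range_fibre \<sigma>" "\<alpha> \<in> q ` basic_open n" by auto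
  then obtain W where W: "W \<in> basic_open n" "uf_range W = uf_range \<sigma>"
    using range_fibre_basic_open_unique[OF \<sigma>] by metis
  have "range_fibre \<sigma> \<inter> q ` basic_open n \<subseteq> {q W}"
  proof
    fix \<beta> assume "\<beta> \<in> range_fibre \<sigma> \<inter> q ` basic_open n"
    then have "\<beta> \<in> range_fibre \<sigma>" "\<beta> \<in> q ` basic_open n" by auto
    then obtain X where "X \<in> basic_open n" "\<beta> = q X" "uf_range X = uf_range \<sigma>"
      using range_fibre_basic_open_unique[OF \<sigma>] by metis
    then show "\<beta> \<in> {q W}" using ultrafilter_eq_of_range[of X W n] W basic_open_iff by simp
  qed
  then show ?thesis using finite_subset by blast
qed simp

text \<open>
  If \<open>k\<close> witnesses the value of \<^term>\<open>hat b\<close> at the quotient, then \<open>n * k\<close> witnesses the value of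
  \<^term>\<open>hat (n * b)\<close> at \<open>\<sigma>\<close>, once \<open>k\<close> is restricted to \<open>dagger n * n\<close>.
\<close>

lemma hat_mult_left:
  assumes U: "U \<in> ultrafilters" and \<sigma>: "\<sigma> \<in> ultrafilters" and r: "uf_range U = uf_range \<sigma>"
    and n: "n \<in> U"
  shows "hat (n * b) \<sigma> = hat b (uf_mult (uf_inv U) \<sigma>)"
proof -
  let ?\<tau> = "uf_mult (uf_inv U) \<sigma>"
  have \<tau>: "?\<tau> \<in> ultrafilters" using uf_divide_ultrafilter[OF U \<sigma> r] .
  have nN: "n \<in> normalisers" using ultrafilter_normaliser[OF U n] .
  obtain k where k: "k \<in> ?\<tau>" "k \<in> normalisers" "expectation (dagger k * b) = scale (hat b ?\<tau>) (dagger k * k)"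
    using hat_obtain[OF \<tau>] .
  let ?k = "dagger n * n * k"
  have kN: "?k \<in> normalisers" using normaliser_mult dagger_normaliser nN k(2) by simp
  have eq: "expectation (dagger ?k * b) = scale (hat b ?\<tau>) (dagger ?k * ?k)"
    using hat_equation_le[OF k(2,3) kN le_idem_left[OF k(2) source_idem[OF nN]]] .
  have nk: "n * ?k = n * k" using mult_dagger_mult_left[OF nN] by (simp add: mult.assoc)
  have m: "n * k \<in> \<sigma>" using uf_divide_mult_mem[OF U \<sigma> r n k(1)] .
  have dm: "dagger (n * k) = dagger ?k * dagger n" using dagger_mult[OF nN kN] nk by simp
  have absorb: "dagger ?k * (dagger n * n) = dagger ?k"
  proof -
    have "dagger ?k = dagger k * (dagger n * n)"
      using dagger_mult[OF idem_normaliser[OF source_idem[OF nN]] k(2)] dagger_idem[OF source_idem[OF nN]]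
      by simp
    then show ?thesis using idem_idem[OF source_idem[OF nN]] by (simp add: mult.assoc)
  qed
  have "dagger (n * k) * (n * b) = (dagger ?k * (dagger n * n)) * b" using dm by (simp add: mult.assoc)
  moreover have "dagger (n * k) * (n * ?k) = (dagger ?k * (dagger n * n)) * ?k" using dm by (simp add: mult.assoc)
  ultimately have "expectation (dagger (n * k) * (n * b)) = scale (hat b ?\<tau>) (dagger (n * k) * (n * k))"
    using eq absorb nk by simp
  then show ?thesis using hat_eqI[OF \<sigma> m] by simp
qed

text \<open>
  The fibre meets the support of \<^term>\<open>hat n\<close> in at most one point, and in none precisely when
  \<open>n * dagger n\<close> annihilates an element of \<open>\<sigma>\<close>; in the latter case \<^term>\<open>hat (n * b)\<close> vanishes too.
\<close>

lemma convolution_normaliser: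
  assumes n: "n \<in> normalisers" and \<sigma>: "\<sigma> \<in> ultrafilters"
    and T: "finite T" "T \<subseteq> range_fibre \<sigma>" "range_fibre \<sigma> \<inter> q ` basic_open n \<subseteq> T"
  shows "(\<Sum>\<alpha>\<in>T. conv_term (hat n) (hat b) \<sigma> \<alpha>) = hat (n * b) \<sigma>"
proof -
  have zero: "conv_term (hat n) (hat b) \<sigma> \<alpha> = 0" if \<alpha>: "\<alpha> \<in> T" "\<alpha> \<notin> q ` basic_open n" for \<alpha>
  proof -
    have "\<alpha> \<in> range_fibre \<sigma>" using \<alpha>(1) T(2) by auto
    then obtain U where U: "U \<in> ultrafilters" "\<alpha> = q U" "uf_range U = uf_range \<sigma>"
      using range_fibre_obtain[OF _ \<sigma>] by metis
    have "hat n U = 0" using hat_normaliser_supp[OF U(1) n] \<alpha>(2) U(2) by auto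
    then show ?thesis using conv_term_q[OF equivariant_hat equivariant_hat U(1) \<sigma> U(3)] U(2) by simp
  qed
  show ?thesis
  proof (cases "n * dagger n \<in> uf_range \<sigma>")
    case True
    obtain U where U: "U \<in> ultrafilters" "n \<in> U" "uf_range U = uf_range \<sigma>"
      using ultrafilter_with_range[OF uf_range_unit[OF \<sigma>] n True] .
    have Un: "U \<in> basic_open n" using U basic_open_iff by simp
    have qU: "q U \<in> T" using range_fibre_iff[OF U(1) \<sigma>] U(3) Un T(3) by auto
    have "conv_term (hat n) (hat b) \<sigma> \<alpha> = 0" if "\<alpha> \<in> T - {q U}" for \<alpha>
    proof (cases "\<alpha> \<in> q ` basic_open n")
      case True
      have "\<alpha> \<in> range_fibre \<sigma>" using that T(2) by auto
      then obtain X where "X \<in> basic_open n" "\<alpha> = q X" "uf_range X = uf_range \<sigma>"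
        using range_fibre_basic_open_unique[OF \<sigma> _ True] by metis
      then have "\<alpha> = q U" using ultrafilter_eq_of_range[of X U n] U basic_open_iff by simp
      then show ?thesis using that by simp
    qed (use that zero in simp)
    then have "(\<Sum>\<alpha>\<in>T. conv_term (hat n) (hat b) \<sigma> \<alpha>) = (\<Sum>\<alpha>\<in>{q U}. conv_term (hat n) (hat b) \<sigma> \<alpha>)"
      using T(1) qU by (intro sum.mono_neutral_right) auto
    also have "\<dots> = hat n U * hat b (uf_mult (uf_inv U) \<sigma>)"
      using conv_term_q[OF equivariant_hat equivariant_hat U(1) \<sigma> U(3)] by simp
    also have "\<dots> = hat (n * b) \<sigma>"
      using hat_normaliser_one[OF Un] hat_mult_left[OF U(1) \<sigma> U(3,2)] by simp
    finally show ?thesis .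
  next
    case False
    have "conv_term (hat n) (hat b) \<sigma> \<alpha> = 0" if "\<alpha> \<in> T" for \<alpha>
    proof (rule zero[OF that], rule notI)
      assume a: "\<alpha> \<in> q ` basic_open n"
      have "\<alpha> \<in> range_fibre \<sigma>" using that T(2) by auto
      then obtain X where "X \<in> basic_open n" "uf_range X = uf_range \<sigma>"
        using range_fibre_basic_open_unique[OF \<sigma> _ a] by metis
      then have "n * dagger n \<in> uf_range \<sigma>"
        using uf_range_mem[OF ultrafilter_filter, of X n] basic_open_iff by simp
      then show False using False by simp
    qed
    then have "(\<Sum>\<alpha>\<in>T. conv_term (hat n) (hat b) \<sigma> \<alpha>) = 0" by simp
    moreover have "hat (n * b) \<sigma> = 0"
    proof -
      obtain m where m: "m \<in> \<sigma>" "n * dagger n * m = 0"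
        using range_idem_dichotomy[OF \<sigma> range_idem[OF n]] False by auto
      have mN: "m \<in> normalisers" using ultrafilter_normaliser[OF \<sigma> m(1)] .
      have "dagger n * (n * dagger n * m) = dagger n * m"
        using dagger_mult_dagger_left[OF n] by (simp add: mult.assoc)
      then have "dagger n * m = 0" using m(2) by simp
      then have "dagger m * n = 0"
        using dagger_mult[OF dagger_normaliser[OF n] mN] dagger_dagger[OF n] dagger_zero by simp
      then have "dagger m * (n * b) = 0" by (simp flip: mult.assoc)
      then show ?thesis
        using hat_eqI[OF \<sigma> m(1), of "n * b" 0] by (simp add: expectation_zero scale_zero_left)
    qed
    ultimately show ?thesis by simp
  qed
qed

lemma hat_mult: "hat (a * b) = convolution (hat a) (hat b)"
proof
  fix \<sigma>
  show "hat (a * b) \<sigma> = convolution (hat a) (hat b) \<sigma>"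
  proof (cases "\<sigma> \<in> ultrafilters")
    case \<sigma>: True
    obtain F c where F: "finite F" "F \<subseteq> normalisers" "a = (\<Sum>x\<in>F. scale (c x) x)"
      using normaliser_expansion .
    let ?T = "range_fibre \<sigma> \<inter> (\<Union>x\<in>F. q ` basic_open x)"
    have "finite (\<Union>x\<in>F. range_fibre \<sigma> \<inter> q ` basic_open x)"
      by (intro finite_UN_I F(1) finite_range_fibre_basic_open[OF \<sigma>])
    then have T: "finite ?T" by (simp only: Int_UN_distrib)
    have "convolution (hat a) (hat b) \<sigma> = (\<Sum>\<alpha>\<in>?T. conv_term (hat a) (hat b) \<sigma> \<alpha>)"
      using T supp_G_hat_subset[OF F(1,2)] F(3)
      by (intro convolution_eq[OF equivariant_hat equivariant_hat \<sigma>]) auto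
    also have "\<dots> = (\<Sum>\<alpha>\<in>?T. \<Sum>x\<in>F. c x * conv_term (hat x) (hat b) \<sigma> \<alpha>)"
      unfolding conv_term_def F(3) by (simp add: hat_sum hat_scale sum_distrib_right mult.assoc)
    also have "\<dots> = (\<Sum>x\<in>F. c x * (\<Sum>\<alpha>\<in>?T. conv_term (hat x) (hat b) \<sigma> \<alpha>))"
      unfolding sum_distrib_left by (rule sum.swap)
    also have "\<dots> = (\<Sum>x\<in>F. c x * hat (x * b) \<sigma>)"
    proof (rule sum.cong[OF refl])
      fix x assume x: "x \<in> F"
      have "(\<Sum>\<alpha>\<in>?T. conv_term (hat x) (hat b) \<sigma> \<alpha>) = hat (x * b) \<sigma>"
        using x F(2) T by (intro convolution_normaliser[OF _ \<sigma>]) auto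
      then show "c x * (\<Sum>\<alpha>\<in>?T. conv_term (hat x) (hat b) \<sigma> \<alpha>) = c x * hat (x * b) \<sigma>" by simp
    qed
    also have "\<dots> = hat (a * b) \<sigma>"
      unfolding F(3) by (simp add: sum_distrib_right mult_scale_left hat_sum hat_scale)
    finally show ?thesis by simp
  qed (simp add: hat_outside convolution_def)
qed

lemma whole_algebra_simps [simp]:
  "elems whole_algebra = UNIV" "add_of whole_algebra = (+)" "mult_of whole_algebra = (*)"
  "scale_of whole_algebra = scale"
  unfolding whole_algebra_def by simp_all

lemma twisted_steinberg_algebra_simps [simp]:
  "add_of twisted_steinberg_algebra f g = (\<lambda>\<sigma>. f \<sigma> + g \<sigma>)"
  "mult_of twisted_steinberg_algebra = convolution"
  "scale_of twisted_steinberg_algebra t f = (\<lambda>\<sigma>. t * f \<sigma>)"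
  unfolding twisted_steinberg_algebra_def by simp_all

lemma hat_eq_imp_eq:
  assumes "hat a = hat b"
  shows "a = b"
proof (rule ccontr)
  assume "a \<noteq> b"
  then obtain U where U: "hat (a - b) U \<noteq> 0" using hat_injective[of "a - b"] by auto
  have "hat (a - b) U + hat b U = hat a U" using hat_add[of "a - b" b U] by simp
  then show False using U assms by simp
qed

lemma hat_iso: "alg_iso whole_algebra twisted_steinberg_algebra hat"
proof -
  have "bij_betw hat UNIV (elems twisted_steinberg_algebra)"
    unfolding bij_betw_def
  proof
    show "inj hat" by (rule injI) (rule hat_eq_imp_eq)
    show "range hat = elems twisted_steinberg_algebra"
    proof
      show "range hat \<subseteq> elems twisted_steinberg_algebra" using hat_mem by auto
      show "elems twisted_steinberg_algebra \<subseteq> range hat"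
      proof
        fix f assume "f \<in> elems twisted_steinberg_algebra"
        then obtain a where "hat a = f" using hat_surjective by auto
        then show "f \<in> range hat" by auto
      qed
    qed
  qed
  moreover have "hat (a + b) = (\<lambda>\<sigma>. hat a \<sigma> + hat b \<sigma>)" "hat (scale t a) = (\<lambda>\<sigma>. t * hat a \<sigma>)" for a b t
    by (rule ext, rule hat_add, rule ext, rule hat_scale)
  ultimately show ?thesis unfolding alg_iso_def by (simp add: hat_mult)
qed

end

section \<open>The subalgebra and the unit spaces\<close>

text \<open>
  The inverse of \<open>h\<close> respects the operations because they do not lead out of the carrier of \<open>X\<close>.
\<close>

lemma alg_isomorphic_through:
  assumes h: "alg_iso X Y h" and g: "alg_iso X Z g"
    and add: "\<And>x y. x \<in> elems X \<Longrightarrow> y \<in> elems X \<Longrightarrow> add_of X x y \<in> elems X"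
    and mult: "\<And>x y. x \<in> elems X \<Longrightarrow> y \<in> elems X \<Longrightarrow> mult_of X x y \<in> elems X"
    and scale: "\<And>t x. x \<in> elems X \<Longrightarrow> scale_of X t x \<in> elems X"
  shows "alg_isomorphic Y Z"
proof -
  let ?k = "the_inv_into (elems X) h"
  have bh: "bij_betw h (elems X) (elems Y)" and bg: "bij_betw g (elems X) (elems Z)"
    using h g unfolding alg_iso_def by simp_all
  have k: "?k y \<in> elems X" "h (?k y) = y" if "y \<in> elems Y" for y
    using that bh f_the_inv_into_f_bij_betw[OF bh] the_inv_into_into[of h "elems X" y "elems X"]
    by (auto simp: bij_betw_def)
  have kh: "?k (h x) = x" if "x \<in> elems X" for x
    using that bh the_inv_into_f_f[of h "elems X" x] by (simp add: bij_betw_def)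
  have "alg_iso Y Z (\<lambda>y. g (?k y))"
    unfolding alg_iso_def
  proof (intro conjI ballI allI)
    have "bij_betw ?k (elems Y) (elems X)" using bij_betw_the_inv_into[OF bh] .
    then show "bij_betw (\<lambda>y. g (?k y)) (elems Y) (elems Z)"
      using bij_betw_trans[OF _ bg] by (simp add: comp_def)
    fix x assume x: "x \<in> elems Y"
    note kx = k[OF x]
    show "g (?k (scale_of Y t x)) = scale_of Z t (g (?k x))" for t
    proof -
      have "scale_of Y t x = h (scale_of X t (?k x))" using h kx unfolding alg_iso_def by simp
      then have "?k (scale_of Y t x) = scale_of X t (?k x)" using kh[OF scale[OF kx(1)]] by simp
      then show ?thesis using g kx unfolding alg_iso_def by simp
    qed
    fix y assume y: "y \<in> elems Y"
    note ky = k[OF y]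
    have "add_of Y x y = h (add_of X (?k x) (?k y))" using h kx ky unfolding alg_iso_def by simp
    then have "?k (add_of Y x y) = add_of X (?k x) (?k y)" using kh[OF add[OF kx(1) ky(1)]] by simp
    then show "g (?k (add_of Y x y)) = add_of Z (g (?k x)) (g (?k y))"
      using g kx ky unfolding alg_iso_def by simp
    have "mult_of Y x y = h (mult_of X (?k x) (?k y))" using h kx ky unfolding alg_iso_def by simp
    then have "?k (mult_of Y x y) = mult_of X (?k x) (?k y)" using kh[OF mult[OF kx(1) ky(1)]] by simp
    then show "g (?k (mult_of Y x y)) = mult_of Z (g (?k x)) (g (?k y))"
      using g kx ky unfolding alg_iso_def by simp
  qed
  then show ?thesis unfolding alg_isomorphic_def by blast
qed

lemma alg_iso_trans:
  assumes "alg_iso X Y h" "alg_iso Y Z g"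
  shows "alg_iso X Z (\<lambda>x. g (h x))"
proof -
  have "h x \<in> elems Y" if "x \<in> elems X" for x
    using assms(1) that bij_betwE unfolding alg_iso_def by blast
  moreover have "bij_betw (\<lambda>x. g (h x)) (elems X) (elems Z)"
    using bij_betw_trans[of h "elems X" "elems Y" g "elems Z"] assms unfolding alg_iso_def
    by (simp add: comp_def)
  ultimately show ?thesis using assms unfolding alg_iso_def by simp
qed

text \<open>
  Functions are composed with the inverse homeomorphism and extended by zero again.
\<close>

lemma homeomorphic_steinberg_algebra:
  assumes hom: "homeomorphic_map X Y p"
  shows "\<exists>h. alg_iso (steinberg_algebra X :: ('r::{comm_ring, comm_monoid_mult}, 'x \<Rightarrow> 'r) alg)
               (steinberg_algebra Y) h"
proof -
  obtain p' where p': "homeomorphic_maps X Y p p'" using hom homeomorphic_map_maps by blast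
  have homs: "homeomorphic_map Y X p'" using homeomorphic_maps_map p' by blast
  have inv: "x \<in> topspace X \<Longrightarrow> p' (p x) = x" "y \<in> topspace Y \<Longrightarrow> p (p' y) = y"
    and into: "x \<in> topspace X \<Longrightarrow> p x \<in> topspace Y" "y \<in> topspace Y \<Longrightarrow> p' y \<in> topspace X" for x y
    using p' unfolding homeomorphic_maps_def continuous_map_def by auto
  \<comment> \<open>Stated for arbitrary spaces, as it is applied in both directions.\<close>
  have pull: "(\<lambda>y. if y \<in> topspace Y then f (p' y) else 0) \<in> elems (steinberg_algebra Y)"
    if f: "f \<in> elems (steinberg_algebra X)" and hom: "homeomorphic_map X Y p" "homeomorphic_map Y X p'"
      and inv: "\<And>x. x \<in> topspace X \<Longrightarrow> p' (p x) = x" "\<And>y. y \<in> topspace Y \<Longrightarrow> p (p' y) = y"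
      and into: "\<And>x. x \<in> topspace X \<Longrightarrow> p x \<in> topspace Y" "\<And>y. y \<in> topspace Y \<Longrightarrow> p' y \<in> topspace X"
    for X :: "'u topology" and Y :: "'v topology" and p p' and f :: "'u \<Rightarrow> 'r"
  proof -
    let ?g = "\<lambda>y. if y \<in> topspace Y then f (p' y) else 0"
    have lc: "f \<in> locally_constant_functions X" and K: "compactin X {x \<in> topspace X. f x \<noteq> 0}"
      using f unfolding steinberg_algebra_def by simp_all
    have "\<exists>W. openin Y W \<and> y \<in> W \<and> (\<forall>z\<in>W. ?g z = ?g y)" if y: "y \<in> topspace Y" for y
    proof -
      obtain V where V: "openin X V" "p' y \<in> V" "\<forall>x\<in>V. f x = f (p' y)"
        using lc into(2)[OF y] unfolding locally_constant_functions_def by blast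
      let ?W = "{z \<in> topspace Y. p' z \<in> V}"
      have "openin Y ?W"
        using openin_continuous_map_preimage[OF homeomorphic_imp_continuous_map[OF hom(2)] V(1)] .
      moreover have "\<forall>z\<in>?W. ?g z = ?g y" using V(3) y by simp
      moreover have "y \<in> ?W" using y V(2) by simp
      ultimately show ?thesis by blast
    qed
    then have "?g \<in> locally_constant_functions Y" unfolding locally_constant_functions_def by simp
    moreover have "{y \<in> topspace Y. ?g y \<noteq> 0} = p ` {x \<in> topspace X. f x \<noteq> 0}"
    proof
      show "{y \<in> topspace Y. ?g y \<noteq> 0} \<subseteq> p ` {x \<in> topspace X. f x \<noteq> 0}"
      proof
        fix y assume "y \<in> {y \<in> topspace Y. ?g y \<noteq> 0}"
        then have "y \<in> topspace Y" "f (p' y) \<noteq> 0" by auto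
        then show "y \<in> p ` {x \<in> topspace X. f x \<noteq> 0}"
          using inv(2) into(2) by (intro image_eqI[of _ _ "p' y"]) auto
      qed
      show "p ` {x \<in> topspace X. f x \<noteq> 0} \<subseteq> {y \<in> topspace Y. ?g y \<noteq> 0}" using inv(1) into(1) by auto
    qed
    ultimately show ?thesis
      using image_compactin[OF K homeomorphic_imp_continuous_map[OF hom(1)]]
      unfolding steinberg_algebra_def by simp
  qed
  let ?h = "\<lambda>f y. if y \<in> topspace Y then f (p' y) else 0"
  let ?k = "\<lambda>g x. if x \<in> topspace X then g (p x) else 0"
  have out: "f x = 0" if "f \<in> elems (steinberg_algebra Z)" "x \<notin> topspace Z"
    for f :: "'u \<Rightarrow> 'r" and Z x
    using that unfolding steinberg_algebra_def locally_constant_functions_def by simp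
  have "bij_betw ?h (elems (steinberg_algebra X :: ('r, 'x \<Rightarrow> 'r) alg)) (elems (steinberg_algebra Y))"
  proof (rule bij_betw_byWitness[where f' = ?k])
    show "\<forall>f\<in>elems (steinberg_algebra X). ?k (?h f) = (f :: 'x \<Rightarrow> 'r)"
      using inv into out[of _ X] by (auto intro!: ext)
    show "\<forall>g\<in>elems (steinberg_algebra Y). ?h (?k g) = (g :: _ \<Rightarrow> 'r)"
      using inv into out[of _ Y] by (auto intro!: ext)
    show "?h ` elems (steinberg_algebra X :: ('r, 'x \<Rightarrow> 'r) alg) \<subseteq> elems (steinberg_algebra Y)"
    proof
      fix g assume "g \<in> ?h ` elems (steinberg_algebra X :: ('r, 'x \<Rightarrow> 'r) alg)"
      then obtain f :: "'x \<Rightarrow> 'r" where f: "f \<in> elems (steinberg_algebra X)" "g = ?h f" by blast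
      show "g \<in> elems (steinberg_algebra Y)"
        unfolding f(2) by (rule pull[OF f(1) hom homs]) (use inv into in auto)
    qed
    show "?k ` elems (steinberg_algebra Y :: ('r, _ \<Rightarrow> 'r) alg) \<subseteq> elems (steinberg_algebra X)"
    proof
      fix f assume "f \<in> ?k ` elems (steinberg_algebra Y :: ('r, _ \<Rightarrow> 'r) alg)"
      then obtain g :: "_ \<Rightarrow> 'r" where g: "g \<in> elems (steinberg_algebra Y)" "f = ?k g" by blast
      show "f \<in> elems (steinberg_algebra X)"
        unfolding g(2) by (rule pull[OF g(1) homs hom]) (use inv into in auto)
    qed
  qed
  then have iso: "alg_iso (steinberg_algebra X :: ('r, 'x \<Rightarrow> 'r) alg) (steinberg_algebra Y) ?h"
    unfolding alg_iso_def
  proof (intro conjI ballI allI)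
    fix f g :: "'x \<Rightarrow> 'r" and t :: 'r
    show "?h (add_of (steinberg_algebra X) f g) = add_of (steinberg_algebra Y) (?h f) (?h g)"
      "?h (mult_of (steinberg_algebra X) f g) = mult_of (steinberg_algebra Y) (?h f) (?h g)"
      "?h (scale_of (steinberg_algebra X) t f) = scale_of (steinberg_algebra Y) t (?h f)"
      unfolding steinberg_algebra_def by (rule ext, simp)+
  qed
  show ?thesis by (rule exI[of _ ?h]) (rule iso)
qed

context algebraic_quasi_cartan_pair
begin

lemma hat_of_subalgebra_supp:
  assumes b: "b \<in> B" and U: "U \<in> ultrafilters" and nz: "hat b U \<noteq> 0"
  shows "q U \<in> G_units"
proof (rule ccontr)
  assume no: "q U \<notin> G_units"
  have "b \<in> R_span idempotents" using b span_idempotents by simp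
  then have "hat b U = 0"
  proof (induction rule: R_span_induct)
    case zero
    show ?case by (rule hat_zero)
  next
    case (add a t x)
    have "hat x U = 0"
    proof (rule ccontr)
      assume "hat x U \<noteq> 0"
      then obtain V where V: "V \<in> basic_open x" "q U = q V"
        using hat_normaliser_supp[OF U idem_normaliser[OF add(2)]] by blast
      then have "V \<in> uf_units" using basic_open_idem_units[OF add(2)] by blast
      then show False using no V(2) G_units_eq by blast
    qed
    then show ?case using add(1) by (simp add: hat_add hat_scale)
  qed
  then show False using nz by simp
qed

text \<open>
  Below every element of a unit ultrafilter there is an idempotent \<open>e\<close> of the ultrafilter, and
  multiplication by \<open>e\<close> commutes with the expectation.
\<close>

lemma hat_expectation_unit:
  assumes V: "V \<in> uf_units"
  shows "hat (expectation a) V = hat a V"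
proof -
  note VU = uf_units_ultrafilter[OF V]
  obtain m where m: "m \<in> V" "m \<in> normalisers" "expectation (dagger m * a) = scale (hat a V) (dagger m * m)"
    using hat_obtain[OF VU] .
  obtain e where e: "e \<in> V" "e \<in> idempotents" "normaliser_le e m" using unit_lower_obtain[OF V m(1)] .
  have eq: "expectation (dagger e * a) = scale (hat a V) (dagger e * e)"
    using hat_equation_le[OF m(2,3) idem_normaliser[OF e(2)] e(3)] .
  have "expectation (dagger e * expectation a) = expectation (dagger e * a)"
    using e(2) by (simp add: dagger_idem expectation_mult[OF idem_mem] expectation_id[OF expectation_mem])
  then have "expectation (dagger e * expectation a) = scale (hat a V) (dagger e * e)" using eq by (rule trans)
  then show ?thesis by (rule hat_eqI[OF VU e(1)])
qed

lemma elems_unit_twisted_steinberg: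
  "f \<in> elems unit_twisted_steinberg_algebra \<longleftrightarrow>
    f \<in> elems twisted_steinberg_algebra \<and> (\<forall>\<sigma>\<in>supp f. q \<sigma> \<in> G_units)"
  unfolding unit_twisted_steinberg_algebra_def by simp

text \<open>
  A function supported over the units is \<^term>\<open>hat a\<close> for some \<open>a\<close>, and it is unchanged when \<open>a\<close> is
  replaced by its expectation; injectivity then puts \<open>a\<close> into \<open>B\<close>.
\<close>

lemma hat_image_subalgebra: "hat ` B = elems unit_twisted_steinberg_algebra"
proof
  show "hat ` B \<subseteq> elems unit_twisted_steinberg_algebra"
  proof
    fix f assume "f \<in> hat ` B"
    then obtain b where b: "b \<in> B" "f = hat b" by blast
    have "\<forall>\<sigma>\<in>supp (hat b). q \<sigma> \<in> G_units"
      using hat_of_subalgebra_supp[OF b(1)] unfolding supp_def by simp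
    then show "f \<in> elems unit_twisted_steinberg_algebra"
      unfolding elems_unit_twisted_steinberg b(2) using hat_mem by simp
  qed
  show "elems unit_twisted_steinberg_algebra \<subseteq> hat ` B"
  proof
    fix f assume f: "f \<in> elems unit_twisted_steinberg_algebra"
    then obtain a where a: "hat a = f"
      using hat_surjective unfolding elems_unit_twisted_steinberg by blast
    have "hat (expectation a) U = hat a U" for U
    proof (cases "U \<in> ultrafilters")
      case U: True
      show ?thesis
      proof (cases "q U \<in> G_units")
        case True
        then obtain V where V: "V \<in> uf_units" "q U = q V" unfolding G_units_eq by blast
        note VU = uf_units_ultrafilter[OF V(1)]
        obtain t where "t \<in> ring_units" "U = act t V" using q_eq_obtain[OF V(2) U VU] .
        then show ?thesis
          using equivariantD[OF equivariant_hat _ VU] hat_expectation_unit[OF V(1)] by simp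
      next
        case False
        then have "hat a U = 0"
          using f U a unfolding elems_unit_twisted_steinberg supp_def by auto
        moreover have "hat (expectation a) U = 0"
          using hat_of_subalgebra_supp[OF expectation_mem U] False by auto
        ultimately show ?thesis by simp
      qed
    qed (simp add: hat_outside)
    then have "hat (expectation a) = hat a" by (rule ext)
    then have "expectation a = a" by (rule hat_eq_imp_eq)
    then have "a \<in> B" using expectation_mem[of a] by simp
    then show "f \<in> hat ` B" using a by blast
  qed
qed

lemma hat_iso_subalgebra: "alg_iso subalgebra_B unit_twisted_steinberg_algebra hat"
proof -
  have "inj_on hat B"
  proof (rule inj_onI)
    fix a b assume "hat a = hat b"
    then show "a = b" by (rule hat_eq_imp_eq)
  qed
  then have "bij_betw hat B (elems unit_twisted_steinberg_algebra)"
    using hat_image_subalgebra unfolding bij_betw_def by simp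
  then show ?thesis
    using hat_iso unfolding alg_iso_def unit_twisted_steinberg_algebra_def by simp
qed

lemma topspace_G_units: "topspace (subtopology quotient_topology G_units) = G_units"
proof -
  have "uf_units \<subseteq> ultrafilters" unfolding uf_units_def by blast
  then have "q ` uf_units \<subseteq> q ` ultrafilters" by (rule image_mono)
  then show ?thesis
    unfolding topspace_subtopology topspace_quotient_topology quotient_groupoid_eq G_units_eq
    by (rule Int_absorb1)
qed

text \<open>
  The quotient map is open and the unit space is open, so the restriction is open onto its image.
\<close>

lemma homeomorphic_map_q_units:
  "homeomorphic_map (subtopology uf_topology uf_units) (subtopology quotient_topology G_units) q"
proof (rule bijective_open_imp_homeomorphic_map)
  show "continuous_map (subtopology uf_topology uf_units) (subtopology quotient_topology G_units) q"
    unfolding continuous_map_in_subtopology topspace_uf_units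
    using continuous_map_from_subtopology[OF continuous_map_q] G_units_eq by auto
  show "open_map (subtopology uf_topology uf_units) (subtopology quotient_topology G_units) q"
    unfolding open_map_def
  proof (intro allI impI)
    fix W assume W: "openin (subtopology uf_topology uf_units) W"
    have "openin uf_topology uf_units"
      unfolding openin_uf_topology
    proof (intro conjI ballI)
      show "uf_units \<subseteq> ultrafilters" unfolding uf_units_def by blast
      fix U assume "U \<in> uf_units"
      then obtain e where "e \<in> U" "e \<in> idempotents" unfolding uf_units_def by blast
      then show "\<exists>m\<in>U. basic_open m \<subseteq> uf_units" using basic_open_idem_units by blast
    qed
    then have "openin uf_topology W" using W openin_trans_full by blast
    then have "openin quotient_topology (q ` W)" by (rule openin_q_image)
    moreover have "W \<subseteq> uf_units" using openin_subset[OF W] topspace_uf_units by simp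
    then have "q ` W \<subseteq> G_units" unfolding G_units_eq by (rule image_mono)
    ultimately show "openin (subtopology quotient_topology G_units) (q ` W)"
      using openin_subtopology_Int[of quotient_topology "q ` W" G_units] by (simp add: Int_absorb2)
  qed
  show "q ` topspace (subtopology uf_topology uf_units) = topspace (subtopology quotient_topology G_units)"
    unfolding topspace_uf_units topspace_G_units by (rule G_units_eq[symmetric])
  show "inj_on q (topspace (subtopology uf_topology uf_units))"
    unfolding topspace_uf_units
  proof (rule inj_onI)
    fix V W assume "V \<in> uf_units" "W \<in> uf_units" "q V = q W"
    then show "V = W" by (rule q_units_inj)
  qed
qed

lemma unit_algebra_isomorphic_unit_space:
  "alg_isomorphic unit_twisted_steinberg_algebra (steinberg_algebra (subtopology uf_topology uf_units))"
  by (rule alg_isomorphic_through[OF hat_iso_subalgebra phi_iso])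
    (simp_all add: add_mem mult_mem scale_mem)

lemma unit_algebra_isomorphic_quotient_unit_space:
  "alg_isomorphic unit_twisted_steinberg_algebra
     (steinberg_algebra (subtopology quotient_topology G_units))"
proof -
  obtain h where h: "alg_iso (steinberg_algebra (subtopology uf_topology uf_units) :: ('r, 'a set \<Rightarrow> 'r) alg)
      (steinberg_algebra (subtopology quotient_topology G_units)) h"
    using homeomorphic_steinberg_algebra[OF homeomorphic_map_q_units] by auto
  show ?thesis
    by (rule alg_isomorphic_through[OF hat_iso_subalgebra alg_iso_trans[OF phi_iso h]])
      (simp_all add: add_mem mult_mem scale_mem)
qed

end

theorem theorem6p6:
  fixes scale :: "'r::{comm_ring, comm_monoid_mult} \<Rightarrow> 'a::ring \<Rightarrow> 'a"
    and B :: "'a set"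
  assumes "algebraic_quasi_cartan_pair scale B"
  shows "alg_iso (R_algebra.whole_algebra scale)
           (algebraic_quasi_cartan_pair.twisted_steinberg_algebra scale B)
           (algebraic_quasi_cartan_pair.hat scale B)
       \<and> algebraic_quasi_cartan_pair.hat scale B ` B =
           elems (algebraic_quasi_cartan_pair.unit_twisted_steinberg_algebra scale B)
       \<and> alg_isomorphic
           (algebraic_quasi_cartan_pair.unit_twisted_steinberg_algebra scale B)
           (steinberg_algebra
             (subtopology (algebraic_quasi_cartan_pair.uf_topology B)
               (algebraic_quasi_cartan_pair.uf_units B)))
       \<and> alg_isomorphic
           (algebraic_quasi_cartan_pair.unit_twisted_steinberg_algebra scale B)
           (steinberg_algebra
             (subtopology (algebraic_quasi_cartan_pair.quotient_topology scale B)
               (algebraic_quasi_cartan_pair.G_units scale B)))"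
proof -
  interpret algebraic_quasi_cartan_pair scale B by (rule assms)
  show ?thesis
    using hat_iso hat_image_subalgebra unit_algebra_isomorphic_unit_space
      unit_algebra_isomorphic_quotient_unit_space by blast
qed

end
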